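(* Let $(W,S)$ be a right-angled Coxeter system (with $S$ finite), let $\mathcal{L}=\mathcal{L}(W,S)$ be its left greedy normal form, and let $\chi_{\mathcal{L}}=\sum_{\alpha\in\mathcal{L}}\alpha$ be its characteristic series. If the nerve $N(W,S)$ is an Eulerian sphere of dimension $k$, then the reciprocal $\chi_{\mathcal{L}}^*$ exists and $$\chi_{\mathcal{L}}^*=(-1)^{k+1}\chi_{\mathcal{L}}.$$
   Context: Coxeter groups. A Coxeter system $(W,S)$: $W=\langle S\mid (ss')^{m(s,s')}=1\rangle$ (one relation for each pair with $m(s,s')<\infty$), $m$ symmetric with values in $\{1,2,\dots,\infty\}$, $m(s,s')=1$ iff $s=s'$. It is right-angled if $m(s,s')\in\{2,\infty\}$ for all $s\ne s'$. $|w|$ is word length with respect to $S$. For $\sigma\subset S$, $W_\sigma$ is the subgroup generated by $\sigma$; $\sigma$ is spherical if $W_\sigma$ is finite. The nerve $N=N(W,S)$ is the set of spherical subsets of $S$ (including $\emptyset$), an abstract simplicial complex; $\mathcal{A}=N\setminus\{\emptyset\}$. $w_\sigma$ is the longest element of $W_\sigma$ for $\sigma\in N$. $\mathrm{Desc}(w)=\{s\in S:|sw|<|w|\}$. The left greedy normal form $\mathcal{L}(W,S)\subset\mathcal{A}^*$ (free monoid) is the set of all words $\sigma_n\cdots\sigma_1$ (including the empty word) such that $\sigma_i=\mathrm{Desc}(w_{\sigma_i}\cdots w_{\sigma_1})$ for all $i=1,\dots,n$. Eulerian spheres. For a finite simplicial complex $K$ (with the empty simplex included, of dimension $-1$), the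 reduced Euler characteristic is $\bar{\boldsymbol\chi}(K)=\sum_{\sigma\in K}(-1)^{\dim\sigma}$ (empty simplex included in the sum). $K$ is an Eulerian sphere of dimension $k$ if $\bar{\boldsymbol\chi}(K)=(-1)^k$ and $\bar{\boldsymbol\chi}(\mathrm{Lk}(\sigma))=(-1)^{k-1-\dim\sigma}$ for every simplex $\sigma$ of $K$, where $\mathrm{Lk}(\sigma)$ is the link of $\sigma$. Series. $F(\mathcal{A})$ is the free group on $\mathcal{A}$, its elements written as reduced words $a_1^{m_1}\cdots a_n^{m_n}$ with $m_i=\pm1$. The order of such an element is $-\#\{i: m_i=-1\}$, and the order of a formal series $\lambda=\sum_{\alpha\in F(\mathcal{A})}r_\alpha\alpha$ ($r_\alpha\in\mathbb{Q}$) is the infimum of the orders of the $\alpha$ with $r_\alpha\neq0$. $\mathbb{Q}((\mathcal{A}))$ is the ring of Laurent series, i.e. the formal series with order $>-\infty$, with the usual convolution product. $\mathbb{Q}\langle\langle\mathcal{A}\rangle\rangle\subset\mathbb{Q}((\mathcal{A}))$ is the subring of series supported on $\mathcal{A}^*$, and $\mathbb{Q}\langle\mathcal{A}\rangle$ the subring of noncommutative polynomials. Reciprocals. A representation of a series $\lambda\in\mathbb{Q}\langle\langle\mathcal{A}\rangle\rangle$ is a triple $(A,Q,B)$ with $A\in\mathbb{Q}^{1\times n}$, $B\in\mathbb{Q}^{n\times1}$, $Q\in\mathbb{Q}\langle\mathcal{A}\rangle^{n\times n}$ having homogeneous linear entries (i.e. $\mathbb{Q}$-linear combinations of letters), such that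 $\lambda=A(I-Q)^{-1}B$. Let $\bar Q$ be $Q$ with every letter $a$ replaced by $a^{-1}$. The reciprocal $\lambda^*$ exists if some representation $(A,Q,B)$ of $\lambda$ has $I-\bar Q$ invertible over $\mathbb{Q}((\mathcal{A}))$, and then $\lambda^*=A(I-\bar Q)^{-1}B\in\mathbb{Q}((\mathcal{A}))$; this value does not depend on the choice of such a representation. The characteristic series $\chi_{\mathcal{L}}$ is rational, and hence has a representation. *)

theory Defs
  imports
    "HOL-Algebra.Generated_Groups"
    "HOL-Algebra.Coset"
    "HOL-Library.Extended_Nat"
    "Jordan_Normal_Form.Matrix"
begin

section \<open>Free groups\<close>

text \<open>
  A free group element is a reduced word; the pair \<open>(a, True)\<close> stands for the letter \<open>a\<close> and
  \<open>(a, False)\<close> for its inverse. The product \<open>free_mult u v\<close> pushes the letters of \<open>u\<close> one by one onto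
  \<open>v\<close>, cancelling on the way, so it is the reduced form of \<open>u @ v\<close> whenever \<open>v\<close> is reduced.
\<close>

type_synonym 'x word = "('x \<times> bool) list"

definition inv_letter :: "'x \<times> bool \<Rightarrow> 'x \<times> bool" where
  "inv_letter x = (fst x, \<not> snd x)"

definition reduced :: "'x word \<Rightarrow> bool" where
  "reduced w \<longleftrightarrow> successively (\<lambda>x y. y \<noteq> inv_letter x) w"

fun push :: "'x \<times> bool \<Rightarrow> 'x word \<Rightarrow> 'x word" where
  "push x [] = [x]"
| "push x (y # ys) = (if y = inv_letter x then ys else x # y # ys)"

definition free_mult :: "'x word \<Rightarrow> 'x word \<Rightarrow> 'x word" where
  "free_mult u v = foldr push u v"

definition free_group :: "'x set \<Rightarrow> 'x word monoid" where
  "free_group A = \<lparr>carrier = {w. reduced w \<and> fst ` set w \<subseteq> A}, monoid.mult = free_mult, one = []\<rparr>"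

lemma inv_letter_inv_letter [simp]: "inv_letter (inv_letter x) = x"
  by (simp add: inv_letter_def)

lemma fst_inv_letter [simp]: "fst (inv_letter x) = fst x"
  by (simp add: inv_letter_def)

lemma reduced_Nil [simp]: "reduced []"
  by (simp add: reduced_def)

lemma reduced_ConsD: "reduced (x # w) \<Longrightarrow> reduced w"
  by (cases w) (auto simp: reduced_def)

lemma reduced_Cons_Cons: "reduced (x # y # w) \<longleftrightarrow> y \<noteq> inv_letter x \<and> reduced (y # w)"
  by (simp add: reduced_def)

lemma reduced_push: "reduced w \<Longrightarrow> reduced (push x w)"
  by (cases w) (auto simp: reduced_Cons_Cons dest: reduced_ConsD, simp add: reduced_def)

lemma push_push_inv: "reduced w \<Longrightarrow> push x (push (inv_letter x) w) = w"
  by (cases w; cases "tl w") (auto simp: reduced_Cons_Cons)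

lemma reduced_free_mult: "reduced v \<Longrightarrow> reduced (free_mult u v)"
  unfolding free_mult_def by (induction u) (auto intro: reduced_push)

lemma set_push: "set (push x w) \<subseteq> insert x (set w)"
  by (cases w) auto

lemma letters_free_mult: "fst ` set (free_mult u v) \<subseteq> fst ` set u \<union> fst ` set v"
  unfolding free_mult_def
proof (induction u)
  case (Cons x u)
  then show ?case using set_push[of x "foldr push u v"] by auto
qed simp

lemma free_mult_in_carrier:
  "u \<in> carrier (free_group A) \<Longrightarrow> v \<in> carrier (free_group A) \<Longrightarrow>
    free_mult u v \<in> carrier (free_group A)"
  using letters_free_mult[of u v] unfolding free_group_def
  by (simp add: reduced_free_mult) blast

lemma free_mult_Nil_left [simp]: "free_mult [] v = v"
  by (simp add: free_mult_def)

lemma free_mult_Nil_right: "reduced u \<Longrightarrow> free_mult u [] = u"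
proof (induction u)
  case (Cons x u)
  then have "free_mult u [] = u" by (blast dest: reduced_ConsD)
  with Cons.prems show ?case
    by (cases u) (auto simp: free_mult_def reduced_Cons_Cons)
qed simp

lemma free_mult_push:
  assumes "reduced t"
  shows "free_mult (push x w) t = push x (free_mult w t)"
proof (cases w)
  case (Cons y ys)
  show ?thesis
  proof (cases "y = inv_letter x")
    case True
    then show ?thesis
      using Cons push_push_inv[OF reduced_free_mult[OF assms, of ys], of x]
      by (simp add: free_mult_def)
  qed (simp add: Cons free_mult_def)
qed (simp add: free_mult_def)

lemma free_mult_assoc:
  assumes "reduced t"
  shows "free_mult (free_mult u v) t = free_mult u (free_mult v t)"
proof (induction u)
  case (Cons x u)
  have "free_mult (free_mult (x # u) v) t = free_mult (push x (free_mult u v)) t"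
    by (simp add: free_mult_def)
  also have "\<dots> = push x (free_mult u (free_mult v t))"
    by (simp add: free_mult_push assms Cons)
  finally show ?case by (simp add: free_mult_def)
qed simp

definition free_inv :: "'x word \<Rightarrow> 'x word" where
  "free_inv w = rev (map inv_letter w)"

lemma free_mult_free_inv: "free_mult (free_inv u) u = []"
  by (induction u) (auto simp: free_mult_def free_inv_def)

lemma reduced_free_inv: "reduced u \<Longrightarrow> reduced (free_inv u)"
  unfolding reduced_def free_inv_def successively_rev successively_map
  by (erule successively_mono) auto

lemma group_free_group: "group (free_group A)"
proof (rule groupI)
  fix u v assume "u \<in> carrier (free_group A)" "v \<in> carrier (free_group A)"
  then show "u \<otimes>\<^bsub>free_group A\<^esub> v \<in> carrier (free_group A)"
    using free_mult_in_carrier[of u A v] by (simp add: free_group_def)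
next
  fix u assume "u \<in> carrier (free_group A)"
  then show "\<exists>v\<in>carrier (free_group A). v \<otimes>\<^bsub>free_group A\<^esub> u = \<one>\<^bsub>free_group A\<^esub>"
    by (intro bexI[of _ "free_inv u"])
       (auto simp: free_group_def free_mult_free_inv reduced_free_inv,
        auto simp: free_inv_def inv_letter_def)
qed (auto simp: free_group_def free_mult_assoc)


section \<open>Coxeter systems\<close>

definition normal_closure :: "('a, 'b) monoid_scheme \<Rightarrow> 'a set \<Rightarrow> 'a set" where
  "normal_closure G R = \<Inter> {N. N \<lhd> G \<and> R \<subseteq> N}"

definition eval_word :: "('a, 'b) monoid_scheme \<Rightarrow> 'a word \<Rightarrow> 'a" where
  "eval_word G w = foldr (\<lambda>(s, b) g. (if b then s else inv\<^bsub>G\<^esub> s) \<otimes>\<^bsub>G\<^esub> g) w \<one>\<^bsub>G\<^esub>"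

text \<open>The canonical map from the free group on \<open>S\<close> to \<open>G\<close> is onto, and its kernel is the normal closure
  of \<open>R\<close>; that is, \<open>G = \<langle>S | R\<rangle>\<close>.\<close>

definition presented_by :: "('a, 'b) monoid_scheme \<Rightarrow> 'a set \<Rightarrow> 'a word set \<Rightarrow> bool" where
  "presented_by G S R \<longleftrightarrow>
     group G \<and> S \<subseteq> carrier G \<and> generate G S = carrier G \<and>
     kernel (free_group S) G (eval_word G) = normal_closure (free_group S) R"

definition coxeter_matrix :: "'a set \<Rightarrow> ('a \<Rightarrow> 'a \<Rightarrow> enat) \<Rightarrow> bool" where
  "coxeter_matrix S m \<longleftrightarrow>
     (\<forall>s\<in>S. \<forall>t\<in>S. m s t = m t s \<and> 1 \<le> m s t \<and> (m s t = 1 \<longleftrightarrow> s = t))"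

definition coxeter_relators :: "'a set \<Rightarrow> ('a \<Rightarrow> 'a \<Rightarrow> enat) \<Rightarrow> 'a word set" where
  "coxeter_relators S m =
     {([(s, True)] \<otimes>\<^bsub>free_group S\<^esub> [(t, True)]) [^]\<^bsub>free_group S\<^esub> (n :: nat) | s t n.
        s \<in> S \<and> t \<in> S \<and> m s t = enat n}"

definition coxeter_system ::
    "('a, 'b) monoid_scheme \<Rightarrow> 'a set \<Rightarrow> ('a \<Rightarrow> 'a \<Rightarrow> enat) \<Rightarrow> bool" where
  "coxeter_system G S m \<longleftrightarrow> coxeter_matrix S m \<and> presented_by G S (coxeter_relators S m)"

definition right_angled :: "'a set \<Rightarrow> ('a \<Rightarrow> 'a \<Rightarrow> enat) \<Rightarrow> bool" where
  "right_angled S m \<longleftrightarrow> (\<forall>s\<in>S. \<forall>t\<in>S. s \<noteq> t \<longrightarrow> m s t \<in> {2, \<infinity>})"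

definition list_prod :: "('a, 'b) monoid_scheme \<Rightarrow> 'a list \<Rightarrow> 'a" where
  "list_prod G xs = foldr (\<otimes>\<^bsub>G\<^esub>) xs \<one>\<^bsub>G\<^esub>"

text \<open>Words in \<open>S\<close> suffice for the length because the generators of a Coxeter system are involutions.\<close>

definition word_length :: "('a, 'b) monoid_scheme \<Rightarrow> 'a set \<Rightarrow> 'a \<Rightarrow> nat" where
  "word_length G S w = (LEAST n. \<exists>xs. set xs \<subseteq> S \<and> length xs = n \<and> list_prod G xs = w)"

definition nerve :: "('a, 'b) monoid_scheme \<Rightarrow> 'a set \<Rightarrow> 'a set set" where
  "nerve G S = {\<sigma>. \<sigma> \<subseteq> S \<and> finite (generate G \<sigma>)}"

definition nerve_alphabet :: "('a, 'b) monoid_scheme \<Rightarrow> 'a set \<Rightarrow> 'a set set" where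
  "nerve_alphabet G S = nerve G S - {{}}"

definition longest_element :: "('a, 'b) monoid_scheme \<Rightarrow> 'a set \<Rightarrow> 'a set \<Rightarrow> 'a" where
  "longest_element G S \<sigma> = arg_max_on (word_length G S) (generate G \<sigma>)"

definition descents :: "('a, 'b) monoid_scheme \<Rightarrow> 'a set \<Rightarrow> 'a \<Rightarrow> 'a set" where
  "descents G S w = {s \<in> S. word_length G S (s \<otimes>\<^bsub>G\<^esub> w) < word_length G S w}"

text \<open>A word \<open>\<sigma>\<^sub>n \<dots> \<sigma>\<^sub>1\<close> is the list \<open>[\<sigma>\<^sub>n, \<dots>, \<sigma>\<^sub>1]\<close>, so its suffixes \<open>\<sigma>\<^sub>i \<dots> \<sigma>\<^sub>1\<close> are obtained by \<open>drop\<close>.\<close>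

definition left_greedy_nf :: "('a, 'b) monoid_scheme \<Rightarrow> 'a set \<Rightarrow> 'a set list set" where
  "left_greedy_nf G S =
     {\<sigma>s. set \<sigma>s \<subseteq> nerve_alphabet G S \<and>
          (\<forall>i<length \<sigma>s.
             \<sigma>s ! i = descents G S (list_prod G (map (longest_element G S) (drop i \<sigma>s))))}"


section \<open>Eulerian spheres\<close>

definition simplicial_complex :: "'v set set \<Rightarrow> bool" where
  "simplicial_complex K \<longleftrightarrow>
     {} \<in> K \<and> (\<forall>\<sigma>\<in>K. finite \<sigma> \<and> (\<forall>\<tau>. \<tau> \<subseteq> \<sigma> \<longrightarrow> \<tau> \<in> K))"

definition simplex_dim :: "'v set \<Rightarrow> int" where
  "simplex_dim \<sigma> = int (card \<sigma>) - 1"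

definition link :: "'v set set \<Rightarrow> 'v set \<Rightarrow> 'v set set" where
  "link K \<sigma> = {\<tau> \<in> K. \<sigma> \<inter> \<tau> = {} \<and> \<sigma> \<union> \<tau> \<in> K}"

text \<open>The value is an integer; the type is \<open>rat\<close> only to allow the negative exponent \<open>-1\<close>.\<close>

definition reduced_euler_char :: "'v set set \<Rightarrow> rat" where
  "reduced_euler_char K = (\<Sum>\<sigma>\<in>K. (- 1) powi simplex_dim \<sigma>)"

definition eulerian_sphere :: "int \<Rightarrow> 'v set set \<Rightarrow> bool" where
  "eulerian_sphere k K \<longleftrightarrow>
     finite K \<and> simplicial_complex K \<and>
     reduced_euler_char K = (- 1) powi k \<and>
     (\<forall>\<sigma>\<in>K. reduced_euler_char (link K \<sigma>) = (- 1) powi (k - 1 - simplex_dim \<sigma>))"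


section \<open>Noncommutative Laurent series\<close>

definition word_order :: "'x word \<Rightarrow> int" where
  "word_order w = - int (length (filter (\<lambda>x. \<not> snd x) w))"

text \<open>
  The type \<open>'x laurent\<close> is the union of the rings \<open>\<rat>((A))\<close> over all finite sets \<open>A\<close> of letters of
  type \<open>'x\<close>; finiteness of \<open>A\<close> and the lower bound on the orders make the sums in the convolution
  product finite. For finite \<open>A\<close>, the subring \<open>\<rat>((A))\<close> is \<open>laurent_series A\<close> below. A set of integers
  is bounded below iff its infimum is not \<open>-\<infinity>\<close>.
\<close>

definition laurent_fun :: "('x word \<Rightarrow> rat) \<Rightarrow> bool" where
  "laurent_fun f \<longleftrightarrow>
     (\<exists>A. finite A \<and> {w. f w \<noteq> 0} \<subseteq> carrier (free_group A)) \<and>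
     bdd_below (word_order ` {w. f w \<noteq> 0})"

typedef 'x laurent = "{f :: 'x word \<Rightarrow> rat. laurent_fun f}"
  morphisms coeff Abs_laurent
  by (rule exI[of _ "\<lambda>_. 0"]) (auto simp: laurent_fun_def)

setup_lifting type_definition_laurent

definition bounded_words :: "'x set \<Rightarrow> int \<Rightarrow> 'x word set" where
  "bounded_words A p = {w \<in> carrier (free_group A). p \<le> word_order w}"

lemma laurent_fun_iff:
  "laurent_fun f \<longleftrightarrow> (\<exists>A p. finite A \<and> {w. f w \<noteq> 0} \<subseteq> bounded_words A p)"
  unfolding laurent_fun_def bdd_below_def bounded_words_def by blast

lemma bounded_words_mono:
  "A \<subseteq> B \<Longrightarrow> q \<le> p \<Longrightarrow> bounded_words A p \<subseteq> bounded_words B q"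
  by (auto simp: bounded_words_def free_group_def)

lemma common_bound:
  assumes "laurent_fun f" "laurent_fun g"
  obtains A p where "finite A" "{w. f w \<noteq> 0} \<subseteq> bounded_words A p" "{w. g w \<noteq> 0} \<subseteq> bounded_words A p"
proof -
  from assms obtain A p B q where
    "finite A" "{w. f w \<noteq> 0} \<subseteq> bounded_words A p" "finite B" "{w. g w \<noteq> 0} \<subseteq> bounded_words B q"
    unfolding laurent_fun_iff by blast
  with bounded_words_mono[of A "A \<union> B" "min p q" p] bounded_words_mono[of B "A \<union> B" "min p q" q]
  show thesis by (intro that[of "A \<union> B" "min p q"]) auto
qed

lemma word_order_free_mult: "word_order u + word_order v \<le> word_order (free_mult u v)"
proof (induction u)
  case (Cons x u)
  have "word_order [x] + word_order w \<le> word_order (push x w)" for w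
    by (cases w) (auto simp: word_order_def inv_letter_def)
  from this[of "free_mult u v"] Cons show ?case
    by (auto simp: free_mult_def word_order_def split: if_splits)
qed (simp add: word_order_def)

lemma free_mult_bounded_words:
  assumes "u \<in> bounded_words A p" "v \<in> bounded_words A q"
  shows "free_mult u v \<in> bounded_words A (p + q)"
  using assms word_order_free_mult[of u v] free_mult_in_carrier[of u A v]
  by (auto simp: bounded_words_def)

definition exponent_sum :: "'x word \<Rightarrow> int" where
  "exponent_sum w = (\<Sum>x\<leftarrow>w. if snd x then 1 else - 1)"

lemma exponent_sum_free_mult: "exponent_sum (free_mult u v) = exponent_sum u + exponent_sum v"
proof (induction u)
  case (Cons x u)
  have "exponent_sum (push x w) = exponent_sum [x] + exponent_sum w" for w
    by (cases w) (auto simp: exponent_sum_def inv_letter_def)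
  from this[of "free_mult u v"] Cons show ?case
    by (simp add: free_mult_def exponent_sum_def)
qed (simp add: exponent_sum_def)

lemma exponent_sum_length: "exponent_sum w = int (length w) + 2 * word_order w"
  by (induction w) (auto simp: exponent_sum_def word_order_def)

lemma finite_factorizations:
  assumes "finite A"
  shows "finite {(u, v). u \<in> bounded_words A p \<and> v \<in> bounded_words A q \<and> free_mult u v = w}"
proof -
  define n where "n = nat (exponent_sum w - 2 * p - 2 * q)"
  let ?X = "{u :: 'a word. set u \<subseteq> A \<times> UNIV \<and> length u \<le> n}"
  have "finite ?X" by (rule finite_lists_length_le) (simp add: assms)
  moreover have "{(u, v). u \<in> bounded_words A p \<and> v \<in> bounded_words A q \<and> free_mult u v = w}
      \<subseteq> ?X \<times> ?X"
  proof clarify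
    fix u v assume u: "u \<in> bounded_words A p" and v: "v \<in> bounded_words A q"
      and w: "w = free_mult u v"
    have "int (length u) + int (length v) \<le> exponent_sum w - 2 * p - 2 * q"
      using u v w exponent_sum_free_mult[of u v]
      by (auto simp: bounded_words_def exponent_sum_length)
    then have "length u \<le> n" "length v \<le> n"
      unfolding n_def by linarith+
    moreover have "set u \<subseteq> A \<times> UNIV" "set v \<subseteq> A \<times> UNIV"
      using u v by (auto simp: bounded_words_def free_group_def)
    ultimately show "u \<in> ?X \<and> v \<in> ?X" by auto
  qed
  ultimately show ?thesis by (meson finite_SigmaI finite_subset)
qed

definition convolution :: "('x word \<Rightarrow> rat) \<Rightarrow> ('x word \<Rightarrow> rat) \<Rightarrow> 'x word \<Rightarrow> rat" where
  "convolution f g w =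
     (\<Sum>(u, v) \<in> {(u, v). f u \<noteq> 0 \<and> g v \<noteq> 0 \<and> free_mult u v = w}. f u * g v)"

lemma convolution_eq:
  assumes "finite A" "{w. f w \<noteq> 0} \<subseteq> bounded_words A p" "{w. g w \<noteq> 0} \<subseteq> bounded_words A q"
  shows "convolution f g w =
    (\<Sum>(u, v) \<in> {(u, v). u \<in> bounded_words A p \<and> v \<in> bounded_words A q \<and> free_mult u v = w}. f u * g v)"
  unfolding convolution_def
  by (rule sum.mono_neutral_left) (use assms in \<open>auto simp: finite_factorizations\<close>)

lemma convolution_support:
  assumes "{w. f w \<noteq> 0} \<subseteq> bounded_words A p" "{w. g w \<noteq> 0} \<subseteq> bounded_words A q"
  shows "{w. convolution f g w \<noteq> 0} \<subseteq> bounded_words A (p + q)"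
proof clarify
  fix w assume "convolution f g w \<noteq> 0"
  then have "{(u, v). f u \<noteq> 0 \<and> g v \<noteq> 0 \<and> free_mult u v = w} \<noteq> {}"
    unfolding convolution_def by (metis (no_types, lifting) sum.empty)
  then show "w \<in> bounded_words A (p + q)"
    using assms free_mult_bounded_words by blast
qed

lemma convolution_assoc:
  assumes "laurent_fun f" "laurent_fun g" "laurent_fun h"
  shows "convolution (convolution f g) h = convolution f (convolution g h)"
proof
  fix w
  obtain A p B q where 0:
    "finite A" "{w. f w \<noteq> 0} \<subseteq> bounded_words A p" "{w. g w \<noteq> 0} \<subseteq> bounded_words A p"
    "finite B" "{w. h w \<noteq> 0} \<subseteq> bounded_words B q"
    using common_bound[OF assms(1,2)] assms(3)[unfolded laurent_fun_iff] by metis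
  define X where "X = A \<union> B"
  define n where "n = min p q"
  have fin: "finite X" and
    s: "{w. f w \<noteq> 0} \<subseteq> bounded_words X n" "{w. g w \<noteq> 0} \<subseteq> bounded_words X n"
       "{w. h w \<noteq> 0} \<subseteq> bounded_words X n"
    using 0 bounded_words_mono[of A X n p] bounded_words_mono[of B X n q]
    by (auto simp: X_def n_def)
  let ?N = "bounded_words X n" and ?M = "bounded_words X (n + n)"
  let ?T = "{(u, v, t). u \<in> ?N \<and> v \<in> ?N \<and> t \<in> ?N \<and> free_mult u (free_mult v t) = w}"
  have red: "reduced u" if "u \<in> ?N" for u
    using that by (simp add: bounded_words_def free_group_def)
  let ?P = "\<lambda>Y Z x. {(u, v). u \<in> bounded_words X Y \<and> v \<in> bounded_words X Z \<and> free_mult u v = x}"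
  have MI: "free_mult u v \<in> bounded_words X (2 * n)" if "u \<in> ?N" "v \<in> ?N" for u v
    using free_mult_bounded_words[OF that] by simp
  have finP: "finite (?P Y Z x)" for Y Z x by (rule finite_factorizations[OF fin])
  have "convolution (convolution f g) h w =
      (\<Sum>(x, t) \<in> ?P (n + n) n w. convolution f g x * h t)"
    by (rule convolution_eq[OF fin convolution_support]) (use s in auto)
  also have "\<dots> = (\<Sum>z \<in> ?P (n + n) n w. \<Sum>y \<in> ?P n n (fst z). f (fst y) * g (snd y) * h (snd z))"
    by (rule sum.cong)
       (auto simp: convolution_eq[OF fin s(1,2)] sum_distrib_right case_prod_unfold)
  also have "\<dots> = (\<Sum>(z, y) \<in> Sigma (?P (n + n) n w) (\<lambda>z. ?P n n (fst z)).
      f (fst y) * g (snd y) * h (snd z))"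
    by (rule sum.Sigma) (auto simp: finP)
  also have "\<dots> = (\<Sum>(u, v, t) \<in> ?T. f u * g v * h t)"
    by (rule sum.reindex_bij_witness[of _ "\<lambda>(u, v, t). ((free_mult u v, t), (u, v))"
          "\<lambda>((x, t), (u, v)). (u, v, t)"])
       (auto simp: free_mult_assoc red intro: MI)
  also have "\<dots> = (\<Sum>(z, y) \<in> Sigma (?P n (n + n) w) (\<lambda>z. ?P n n (snd z)).
      f (fst z) * (g (fst y) * h (snd y)))"
    by (rule sum.reindex_bij_witness[of _ "\<lambda>((u, x), (v, t)). (u, v, t)"
          "\<lambda>(u, v, t). ((u, free_mult v t), (v, t))"])
       (auto simp: mult.assoc intro: MI)
  also have "\<dots> = (\<Sum>z \<in> ?P n (n + n) w. \<Sum>y \<in> ?P n n (snd z). f (fst z) * (g (fst y) * h (snd y)))"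
    by (rule sum.Sigma[symmetric]) (auto simp: finP)
  also have "\<dots> = (\<Sum>(u, x) \<in> ?P n (n + n) w. f u * convolution g h x)"
    by (rule sum.cong)
       (auto simp: convolution_eq[OF fin s(2,3)] sum_distrib_left case_prod_unfold)
  also have "\<dots> = convolution f (convolution g h) w"
    by (rule convolution_eq[OF fin _ convolution_support, symmetric]) (use s in auto)
  finally show "convolution (convolution f g) h w = convolution f (convolution g h) w" .
qed

lemma laurent_fun_single: "reduced w \<Longrightarrow> laurent_fun (\<lambda>v. if v = w then r else 0)"
  unfolding laurent_fun_def free_group_def
  by (intro conjI exI[of _ "fst ` set w"] bdd_belowI[of _ "word_order w"])
     (auto split: if_splits)

lemma laurent_fun_add: "laurent_fun f \<Longrightarrow> laurent_fun g \<Longrightarrow> laurent_fun (\<lambda>w. f w + g w)"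
  using common_bound[of f g] unfolding laurent_fun_iff
  by (smt (verit) Collect_mono_iff add_0 mem_Collect_eq subset_eq)

lemma laurent_fun_minus: "laurent_fun f \<Longrightarrow> laurent_fun (\<lambda>w. - f w)"
  by (simp add: laurent_fun_def)

lemma laurent_fun_convolution:
  assumes "laurent_fun f" "laurent_fun g"
  shows "laurent_fun (convolution f g)"
proof -
  obtain A p where "finite A" "{w. f w \<noteq> 0} \<subseteq> bounded_words A p" "{w. g w \<noteq> 0} \<subseteq> bounded_words A p"
    using common_bound[OF assms] .
  then show ?thesis using convolution_support[of f A p g p] unfolding laurent_fun_iff by blast
qed

lemma convolution_add_left:
  assumes "laurent_fun f" "laurent_fun f'" "laurent_fun g"
  shows "convolution (\<lambda>w. f w + f' w) g w = convolution f g w + convolution f' g w"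
proof -
  obtain A p B q where 0:
    "finite A" "{w. f w \<noteq> 0} \<subseteq> bounded_words A p" "{w. f' w \<noteq> 0} \<subseteq> bounded_words A p"
    "finite B" "{w. g w \<noteq> 0} \<subseteq> bounded_words B q"
    using common_bound[OF assms(1,2)] assms(3)[unfolded laurent_fun_iff] by metis
  define X where "X = A \<union> B"
  have fin: "finite X" and s: "{w. f w \<noteq> 0} \<subseteq> bounded_words X p"
      "{w. f' w \<noteq> 0} \<subseteq> bounded_words X p" "{w. g w \<noteq> 0} \<subseteq> bounded_words X q"
    using 0 bounded_words_mono[of A X p p] bounded_words_mono[of B X q q] by (auto simp: X_def)
  have "{w. f w + f' w \<noteq> 0} \<subseteq> bounded_words X p" using s(1,2) by force
  from convolution_eq[OF fin this s(3)] convolution_eq[OF fin s(1,3)] convolution_eq[OF fin s(2,3)]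
  show ?thesis by (simp only: case_prod_unfold distrib_right sum.distrib)
qed

lemma convolution_add_right:
  assumes "laurent_fun f" "laurent_fun g" "laurent_fun g'"
  shows "convolution f (\<lambda>w. g w + g' w) w = convolution f g w + convolution f g' w"
proof -
  obtain A p B q where 0:
    "finite A" "{w. g w \<noteq> 0} \<subseteq> bounded_words A p" "{w. g' w \<noteq> 0} \<subseteq> bounded_words A p"
    "finite B" "{w. f w \<noteq> 0} \<subseteq> bounded_words B q"
    using common_bound[OF assms(2,3)] assms(1)[unfolded laurent_fun_iff] by metis
  define X where "X = A \<union> B"
  have fin: "finite X" and s: "{w. g w \<noteq> 0} \<subseteq> bounded_words X p"
      "{w. g' w \<noteq> 0} \<subseteq> bounded_words X p" "{w. f w \<noteq> 0} \<subseteq> bounded_words X q"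
    using 0 bounded_words_mono[of A X p p] bounded_words_mono[of B X q q] by (auto simp: X_def)
  have "{w. g w + g' w \<noteq> 0} \<subseteq> bounded_words X p" using s(1,2) by force
  from convolution_eq[OF fin s(3) this] convolution_eq[OF fin s(3,1)] convolution_eq[OF fin s(3,2)]
  show ?thesis by (simp only: case_prod_unfold distrib_left sum.distrib)
qed

lemma convolution_one_left:
  assumes "laurent_fun g"
  shows "convolution (\<lambda>v. if v = [] then 1 else 0) g = g"
proof
  fix w
  have "{(u, v). (if u = [] then 1 else 0 :: rat) \<noteq> 0 \<and> g v \<noteq> 0 \<and> free_mult u v = w}
      = (if g w = 0 then {} else {([], w)})"
    by (auto split: if_splits)
  then show "convolution (\<lambda>v. if v = [] then 1 else 0) g w = g w"
    by (simp add: convolution_def)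
qed

lemma convolution_one_right:
  assumes "laurent_fun g"
  shows "convolution g (\<lambda>v. if v = [] then 1 else 0) = g"
proof
  fix w
  have "reduced u" if "g u \<noteq> 0" for u
    using assms that unfolding laurent_fun_def free_group_def by fastforce
  then have "{(u, v). g u \<noteq> 0 \<and> (if v = [] then 1 else 0 :: rat) \<noteq> 0 \<and> free_mult u v = w}
      = (if g w = 0 then {} else {(w, [])})"
    by (auto simp: free_mult_Nil_right split: if_splits)
  then show "convolution g (\<lambda>v. if v = [] then 1 else 0) w = g w"
    by (simp add: convolution_def)
qed

instantiation laurent :: (type) ring_1
begin

lift_definition zero_laurent :: "'a laurent" is "\<lambda>_. 0"
  by (auto simp: laurent_fun_def)

lift_definition one_laurent :: "'a laurent" is "\<lambda>w. if w = [] then 1 else 0"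
  by (simp add: laurent_fun_single)

lift_definition plus_laurent :: "'a laurent \<Rightarrow> 'a laurent \<Rightarrow> 'a laurent" is "\<lambda>f g w. f w + g w"
  by (rule laurent_fun_add)

lift_definition uminus_laurent :: "'a laurent \<Rightarrow> 'a laurent" is "\<lambda>f w. - f w"
  by (rule laurent_fun_minus)

lift_definition minus_laurent :: "'a laurent \<Rightarrow> 'a laurent \<Rightarrow> 'a laurent" is "\<lambda>f g w. f w - g w"
  using laurent_fun_add[OF _ laurent_fun_minus] by simp

lift_definition times_laurent :: "'a laurent \<Rightarrow> 'a laurent \<Rightarrow> 'a laurent" is convolution
  by (rule laurent_fun_convolution)

instance
proof
  fix a b c :: "'a laurent"
  show "a * b * c = a * (b * c)" by transfer (rule convolution_assoc)
  show "(a + b) * c = a * c + b * c" by transfer (auto simp: convolution_add_left)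
  show "a * (b + c) = a * b + a * c" by transfer (auto simp: convolution_add_right)
  show "1 * a = a" by transfer (rule convolution_one_left)
  show "a * 1 = a" by transfer (rule convolution_one_right)
  show "(0 :: 'a laurent) \<noteq> 1" by transfer (auto dest: fun_cong[of _ _ "[]"])
qed (transfer; auto simp: algebra_simps)+

end

lift_definition const :: "rat \<Rightarrow> 'x laurent" is "\<lambda>r w. if w = [] then r else 0"
  by (simp add: laurent_fun_single)

lift_definition letter :: "'x \<Rightarrow> 'x laurent" is "\<lambda>a w. if w = [(a, True)] then 1 else 0"
  by (simp add: laurent_fun_single reduced_def)

lift_definition letter_inv :: "'x \<Rightarrow> 'x laurent" is "\<lambda>a w. if w = [(a, False)] then 1 else 0"
  by (simp add: laurent_fun_single reduced_def)

definition laurent_series :: "'x set \<Rightarrow> 'x laurent set" where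
  "laurent_series A = {f. \<forall>w. coeff f w \<noteq> 0 \<longrightarrow> w \<in> carrier (free_group A)}"

definition power_series :: "'x set \<Rightarrow> 'x laurent set" where
  "power_series A = {f. \<forall>w. coeff f w \<noteq> 0 \<longrightarrow> set w \<subseteq> A \<times> {True}}"

definition linear_forms :: "'x set \<Rightarrow> 'x laurent set" where
  "linear_forms A = {\<Sum>a\<in>A. const (c a) * letter a | c. True}"

definition pos_word :: "'x list \<Rightarrow> 'x word" where
  "pos_word xs = map (\<lambda>a. (a, True)) xs"

text \<open>Meaningful for languages over a finite alphabet only; see \<open>coeff_char_series\<close>.\<close>

definition char_series :: "'x list set \<Rightarrow> 'x laurent" where
  "char_series L = Abs_laurent (\<lambda>w. if w \<in> pos_word ` L then 1 else 0)"

lemma reduced_pos_word: "reduced (pos_word xs)"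
  unfolding reduced_def pos_word_def successively_map inv_letter_def
  by (induction xs rule: induct_list012) auto

lemma coeff_char_series:
  assumes "finite A" "L \<subseteq> lists A"
  shows "coeff (char_series L) w = (if w \<in> pos_word ` L then 1 else 0)"
proof -
  have "laurent_fun (\<lambda>w. if w \<in> pos_word ` L then 1 else 0)"
    unfolding laurent_fun_def free_group_def using assms
    by (intro conjI exI[of _ A] bdd_belowI[of _ 0])
       (auto simp: reduced_pos_word word_order_def split: if_splits,
        auto simp: pos_word_def)
  then show ?thesis by (simp add: char_series_def Abs_laurent_inverse)
qed

lemma left_greedy_nf_subset_lists: "left_greedy_nf G S \<subseteq> lists (nerve_alphabet G S)"
  by (auto simp: left_greedy_nf_def)

lemma finite_nerve_alphabet: "finite S \<Longrightarrow> finite (nerve_alphabet G S)"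
  by (rule finite_subset[of _ "Pow S"]) (auto simp: nerve_alphabet_def nerve_def)


section \<open>Representations and reciprocals\<close>

definition inverse_mat_over :: "'r :: semiring_1 set \<Rightarrow> 'r mat \<Rightarrow> 'r mat \<Rightarrow> bool" where
  "inverse_mat_over R X M \<longleftrightarrow>
     square_mat X \<and> M \<in> carrier_mat (dim_row X) (dim_row X) \<and> elements_mat M \<subseteq> R \<and>
     inverts_mat X M \<and> inverts_mat M X"

definition sandwich :: "rat mat \<Rightarrow> 'x laurent mat \<Rightarrow> rat mat \<Rightarrow> 'x laurent" where
  "sandwich U M V = (map_mat const U * M * map_mat const V) $$ (0, 0)"

text \<open>The matrix \<open>1 - Q\<close> is inverted over the power series; its inverse is unique.\<close>

definition representation ::
    "'x set \<Rightarrow> 'x laurent \<Rightarrow> nat \<Rightarrow> rat mat \<Rightarrow> 'x laurent mat \<Rightarrow> rat mat \<Rightarrow> bool" where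
  "representation A f n U Q V \<longleftrightarrow>
     U \<in> carrier_mat 1 n \<and> V \<in> carrier_mat n 1 \<and>
     Q \<in> carrier_mat n n \<and> elements_mat Q \<subseteq> linear_forms A \<and>
     (\<exists>M. inverse_mat_over (power_series A) (1\<^sub>m n - Q) M \<and> f = sandwich U M V)"

text \<open>Applied to \<open>linear_forms A\<close> only, whose elements are determined by their letter coefficients.\<close>

definition bar :: "'x set \<Rightarrow> 'x laurent \<Rightarrow> 'x laurent" where
  "bar A q = (\<Sum>a\<in>A. const (coeff q [(a, True)]) * letter_inv a)"

definition is_reciprocal :: "'x set \<Rightarrow> 'x laurent \<Rightarrow> 'x laurent \<Rightarrow> bool" where
  "is_reciprocal A f g \<longleftrightarrow>
     (\<exists>n U Q V M. representation A f n U Q V \<and>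
        inverse_mat_over (laurent_series A) (1\<^sub>m n - map_mat (bar A) Q) M \<and>
        g = sandwich U M V)"

definition reciprocal_exists :: "'x set \<Rightarrow> 'x laurent \<Rightarrow> bool" where
  "reciprocal_exists A f \<longleftrightarrow> (\<exists>g. is_reciprocal A f g)"

definition reciprocal :: "'x set \<Rightarrow> 'x laurent \<Rightarrow> 'x laurent" where
  "reciprocal A f = (THE g. is_reciprocal A f g)"

end

theory Submission
  imports Defs
begin

text \<open>
  Let \<open>N\<close> be the nerve, \<open>E(\<sigma>, \<tau>) = [\<sigma> \<union> \<tau> \<in> N]\<close>, \<open>C(\<sigma>, \<tau>) = [\<sigma> \<subseteq> \<tau>]\<close>, \<open>\<Delta> = diag((-1)^|\<sigma>|)\<close> and
  \<open>\<epsilon> = (-1)^(k+1)\<close>. A word is in the greedy normal form iff its consecutive letters \<open>\<sigma>, \<tau>\<close> satisfy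
  \<open>\<sigma> \<union> {t} \<notin> N\<close> for all \<open>t \<in> \<tau>\<close>; let \<open>J\<close> be the 0-1 matrix of this relation. As \<open>N\<close> is a flag complex,
  \<open>J = E \<Delta> C\<close>, and the Euler characteristics of the links give \<open>C \<Delta> E = \<epsilon> C\<^sup>T\<close>. Together with Moebius
  inversion \<open>C \<Delta> C = \<Delta>\<close> this yields \<open>J \<Delta> J = \<Delta>\<close>: inverting \<open>J\<close> only changes signs. Inverting all letters in the
  linear system of the automaton replaces \<open>J\<close> by its inverse, hence the series is multiplied by \<open>\<epsilon>\<close>.

  The combinatorics of descents comes from the numbers game on the Coxeter graph. That the reciprocal
  does not depend on the representation is proved by pushing series forward along the action of the free
  group on finite sets, keeping the exponent sum: in the resulting finite-dimensional space every
  solution obeys a linear recurrence in the exponent sum, and it vanishes far below.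
\<close>

section \<open>Presentations\<close>

text \<open>Let y(\<sigma>) be the series of all words that may follow the letter \<sigma>. Counting
  the empty simplex as a state with y = 1 there, the automaton reads y = J \<Lambda> y, with
  \<Lambda> the diagonal matrix of the letters and entry 1 at the empty simplex. For z = \<Delta>
  \<Lambda> y the involution J \<Delta> turns this into z = J \<Lambda>^-1 z, the same system with
  inverted letters. The characteristic series is the sum of the entries of \<Lambda> y, but a
  representation wants a constant combination of the entries of y. The rows of J with weights
  \<epsilon> (-1)^|\<sigma>| add up to the row of ones, so these weights serve as initial vector;
  applied to z they give \<epsilon> times the characteristic series.

  The obstacle to uniqueness is that inverted letters have negative order: the Neumann series of the
  barred matrix need not be a Laurent series, and iterating the system only expresses a coefficient
  by coefficients at ever larger exponent sums. Finiteness is therefore imported from permutations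
  of balls, as in the proof that free groups are residually finite, and the iteration is turned into
  a recurrence.\<close>

lemma letters_free_mult_subset:
  "fst ` set u \<subseteq> S \<Longrightarrow> fst ` set v \<subseteq> S \<Longrightarrow> fst ` set (free_mult u v) \<subseteq> S"
  by (rule order_trans[OF letters_free_mult]) simp

lemma (in group) eval_word_closed:
  assumes "S \<subseteq> carrier G" "fst ` set w \<subseteq> S"
  shows "eval_word G w \<in> carrier G"
  using assms(2)
proof (induction w)
  case (Cons x w)
  then show ?case using assms(1) by (cases x) (auto simp: eval_word_def)
qed (simp add: eval_word_def)

lemma (in group) eval_word_push:
  assumes "S \<subseteq> carrier G" "fst x \<in> S" "fst ` set w \<subseteq> S"
  shows "eval_word G (push x w) = eval_word G [x] \<otimes> eval_word G w"
proof (cases w)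
  case Nil
  then show ?thesis using assms by (cases x) (auto simp: eval_word_def)
next
  case (Cons y ys)
  have [simp]: "eval_word G ys \<in> carrier G"
    using assms Cons by (auto intro: eval_word_closed)
  obtain s b where x: "x = (s, b)" by (cases x)
  have s: "s \<in> carrier G" using assms x by auto
  have y: "fst y \<in> carrier G" using assms Cons by auto
  have ev: "eval_word G (z # zs) = (if snd z then fst z else inv fst z) \<otimes> eval_word G zs" for z zs
    by (simp add: eval_word_def case_prod_unfold)
  have e0: "eval_word G [] = \<one>" by (simp add: eval_word_def)
  show ?thesis
    using s y by (auto simp: Cons x ev e0 inv_letter_def m_assoc[symmetric])
qed

lemma (in group) eval_word_free_mult:
  assumes "S \<subseteq> carrier G" "fst ` set u \<subseteq> S" "fst ` set v \<subseteq> S"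
  shows "eval_word G (free_mult u v) = eval_word G u \<otimes> eval_word G v"
  using assms(2)
proof (induction u)
  case Nil
  then show ?case using eval_word_closed[OF assms(1,3)] by (simp add: eval_word_def)
next
  case (Cons x u)
  have fm: "fst ` set (free_mult u v) \<subseteq> S"
    using letters_free_mult_subset[of u S v] Cons.prems assms(3) by simp
  have "eval_word G (free_mult (x # u) v) = eval_word G [x] \<otimes> eval_word G (free_mult u v)"
    using eval_word_push[OF assms(1) _ fm, of x] Cons.prems by (simp add: free_mult_def)
  also have "\<dots> = (eval_word G [x] \<otimes> eval_word G u) \<otimes> eval_word G v"
    using Cons eval_word_closed[OF assms(1), of u] eval_word_closed[OF assms(1,3)]
      eval_word_closed[OF assms(1), of "[x]"] by (simp add: m_assoc)
  also have "eval_word G [x] \<otimes> eval_word G u = eval_word G (x # u)"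
    using eval_word_closed[OF assms(1), of u] Cons.prems assms(1)
    by (cases x) (auto simp: eval_word_def)
  finally show ?case .
qed

lemma (in group) relator_eval:
  assumes "presented_by G S R" "r \<in> R" "R \<subseteq> carrier (free_group S)"
  shows "eval_word G r = \<one>"
proof -
  have "r \<in> normal_closure (free_group S) R"
    using assms(2) by (auto simp: normal_closure_def)
  then have "r \<in> kernel (free_group S) G (eval_word G)"
    using assms(1) by (simp add: presented_by_def)
  then show ?thesis by (simp add: kernel_def)
qed

section \<open>Actions of presented groups\<close>

lemma act_push:
  assumes "\<And>x f. A (inv_letter x) (A x f) = f"
  shows "foldr A (push x w) f = A x (foldr A w f)"
proof (cases w)
  case (Cons y ys)
  then show ?thesis using assms[of "inv_letter x"] by auto
qed simp

lemma act_free_mult: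
  assumes "\<And>x f. A (inv_letter x) (A x f) = f"
  shows "foldr A (free_mult u v) f = foldr A u (foldr A v f)"
  by (induction u) (simp_all add: free_mult_def act_push[of A, OF assms])

text \<open>The words that act trivially form a normal subgroup containing the relators, hence they
  contain the kernel of evaluation.\<close>

lemma presented_action_kernel:
  fixes A :: "'a \<times> bool \<Rightarrow> 'c \<Rightarrow> 'c"
  assumes pres: "presented_by G S R" and inv: "\<And>x f. A (inv_letter x) (A x f) = f"
    and R: "R \<subseteq> carrier (free_group S)" "\<And>r f. r \<in> R \<Longrightarrow> foldr A r f = f"
    and u: "u \<in> carrier (free_group S)" "eval_word G u = \<one>\<^bsub>G\<^esub>"
  shows "foldr A u f = f"
proof -
  let ?F = "free_group S"
  interpret F: group ?F by (rule group_free_group)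
  let ?K = "{w \<in> carrier ?F. \<forall>f. foldr A w f = f}"
  have m: "foldr A (x \<otimes>\<^bsub>?F\<^esub> y) f = foldr A x (foldr A y f)" for x y f
    by (simp add: free_group_def act_free_mult[of A, OF inv])
  have one: "\<one>\<^bsub>?F\<^esub> = []" by (simp add: free_group_def)
  have i: "foldr A (inv\<^bsub>?F\<^esub> x) (foldr A x f) = f" if "x \<in> carrier ?F" for x f
    using that m[of "inv\<^bsub>?F\<^esub> x" x f] by (simp add: one)
  have i': "foldr A x (foldr A (inv\<^bsub>?F\<^esub> x) f) = f" if "x \<in> carrier ?F" for x f
    using that m[of x "inv\<^bsub>?F\<^esub> x" f] by (simp add: one)
  have "subgroup ?K ?F"
  proof (rule F.subgroupI)
    show "?K \<noteq> {}" using F.one_closed one by (auto intro!: exI[of _ "[]"])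
    fix a assume a: "a \<in> ?K"
    have "foldr A (inv\<^bsub>?F\<^esub> a) f = f" for f using i[of a f] a by simp
    then show "inv\<^bsub>?F\<^esub> a \<in> ?K" using a by simp
  qed (auto simp: m)
  then have "?K \<lhd> ?F" by (auto simp: F.normal_inv_iff m i')
  moreover have "R \<subseteq> ?K" using R by auto
  ultimately have "normal_closure ?F R \<subseteq> ?K" by (auto simp: normal_closure_def)
  then have "kernel ?F G (eval_word G) \<subseteq> ?K" using pres by (simp add: presented_by_def)
  then show ?thesis using u by (auto simp: kernel_def)
qed

text \<open>The universal property of a presentation, for actions: words with equal value differ by
  a kernel element and so act alike. It is stated for arbitrary, not only reduced, words so that a
  single letter can be prepended.\<close>

lemma presented_action:
  fixes A :: "'a \<times> bool \<Rightarrow> 'c \<Rightarrow> 'c"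
  assumes pres: "presented_by G S R" and inv: "\<And>x f. A (inv_letter x) (A x f) = f"
    and R: "R \<subseteq> carrier (free_group S)" "\<And>r f. r \<in> R \<Longrightarrow> foldr A r f = f"
  shows "\<exists>\<phi>. \<forall>u f. fst ` set u \<subseteq> S \<longrightarrow> \<phi> (eval_word G u) f = foldr A u f"
proof -
  interpret group G using pres by (simp add: presented_by_def)
  have S: "S \<subseteq> carrier G" using pres by (simp add: presented_by_def)
  have eq: "foldr A u f = foldr A v f"
    if u: "fst ` set u \<subseteq> S" and v: "fst ` set v \<subseteq> S" and e: "eval_word G u = eval_word G v" for u v f
  proof -
    let ?i = "free_inv v"
    have fi: "fst ` set ?i \<subseteq> S" using v by (auto simp: free_inv_def)
    \<comment> \<open>A product is known to be reduced only if its right factor is; multiplying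
      \<open>u\<close> by the empty word first makes it reduced.\<close>
    define w where "w = free_mult ?i (free_mult u [])"
    have red: "reduced w" by (simp add: w_def reduced_free_mult)
    have "fst ` set (free_mult u []) \<subseteq> S" using letters_free_mult_subset[OF u, of "[]"] by simp
    then have "fst ` set w \<subseteq> S"
      using letters_free_mult_subset[OF fi] unfolding w_def by blast
    then have wc: "w \<in> carrier (free_group S)" using red by (simp add: free_group_def)
    have "eval_word G (free_mult u []) = eval_word G u"
      using eval_word_free_mult[OF S u, of "[]"] eval_word_closed[OF S u]
      by (simp add: eval_word_def)
    then have "eval_word G w = eval_word G ?i \<otimes>\<^bsub>G\<^esub> eval_word G v"
      unfolding w_def e[symmetric]
      using eval_word_free_mult[OF S fi, of "free_mult u []"] \<open>fst ` set (free_mult u []) \<subseteq> S\<close>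
      by simp
    also have "\<dots> = eval_word G (free_mult ?i v)" using eval_word_free_mult[OF S fi v] by simp
    also have "\<dots> = \<one>\<^bsub>G\<^esub>" by (simp add: free_mult_free_inv eval_word_def)
    finally have 1: "foldr A w f = f" for f
      using presented_action_kernel[of G S R A, OF pres inv R wc] by simp
    have "foldr A v (foldr A ?i f) = f" for f
    proof -
      have "foldr A v (foldr A (free_inv v) f) = f" for f
      proof (induction v arbitrary: f)
        case (Cons x v)
        then show ?case
          using inv[of "inv_letter x"] by (simp add: free_inv_def)
      qed (simp add: free_inv_def)
      then show ?thesis .
    qed
    then have "foldr A v f = foldr A v (foldr A ?i (foldr A u f))"
      using 1 by (simp add: w_def act_free_mult[of A, OF inv])
    also have "\<dots> = foldr A u f"
      using \<open>\<And>f. foldr A v (foldr A ?i f) = f\<close> by simp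
    finally show ?thesis by simp
  qed
  define \<phi> where "\<phi> g = foldr A (SOME u. fst ` set u \<subseteq> S \<and> eval_word G u = g)" for g
  show ?thesis
  proof (intro exI[of _ \<phi>] allI impI)
    fix u :: "'a word" and f assume u: "fst ` set u \<subseteq> S"
    then have "\<exists>v. fst ` set v \<subseteq> S \<and> eval_word G v = eval_word G u" by blast
    from someI_ex[OF this] show "\<phi> (eval_word G u) f = foldr A u f"
      unfolding \<phi>_def using eq[OF _ u] by blast
  qed
qed

section \<open>Right-angled Coxeter groups\<close>

text \<open>Firing a node in Mozes' numbers game: the contragredient of the geometric representation,
  in the coordinates given by the simple roots.\<close>

definition fire :: "('a \<Rightarrow> 'a \<Rightarrow> enat) \<Rightarrow> 'a \<Rightarrow> ('a \<Rightarrow> int) \<Rightarrow> 'a \<Rightarrow> int" where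
  "fire m s f = (\<lambda>t. if t = s then - f s else if m s t = \<infinity> then f t + 2 * f s else f t)"

lemma fire_fire [simp]: "fire m s (fire m s f) = f"
  by (auto simp: fire_def)

lemma fire_commute:
  assumes "m s t \<noteq> \<infinity>" "m t s \<noteq> \<infinity>"
  shows "fire m s (fire m t f) = fire m t (fire m s f)"
  using assms by (auto simp: fire_def fun_eq_iff)

locale racg = group G for G :: "('a, 'b) monoid_scheme" (structure) +
  fixes S :: "'a set" and m :: "'a \<Rightarrow> 'a \<Rightarrow> enat"
  assumes cox: "coxeter_system G S m" and ra: "right_angled S m"
begin

lemma S_carrier: "S \<subseteq> carrier G" and S_generate: "generate G S = carrier G"
  and pres: "presented_by G S (coxeter_relators S m)"
  and m_sym: "s \<in> S \<Longrightarrow> t \<in> S \<Longrightarrow> m s t = m t s"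
  and m_one: "s \<in> S \<Longrightarrow> t \<in> S \<Longrightarrow> m s t = 1 \<longleftrightarrow> s = t"
  and m_diff: "s \<in> S \<Longrightarrow> t \<in> S \<Longrightarrow> s \<noteq> t \<Longrightarrow> m s t = 2 \<or> m s t = \<infinity>"
  using cox ra
  by (auto simp: coxeter_system_def presented_by_def coxeter_matrix_def right_angled_def)

lemma S_closed [simp, intro]: "s \<in> S \<Longrightarrow> s \<in> carrier G"
  using S_carrier by auto

lemma relators_carrier: "coxeter_relators S m \<subseteq> carrier (free_group S)"
proof -
  interpret F: group "free_group S" by (rule group_free_group)
  have "[(s, True)] \<in> carrier (free_group S)" if "s \<in> S" for s
    using that by (simp add: free_group_def reduced_def)
  then show ?thesis by (auto simp: coxeter_relators_def)
qed

lemma coxeter_relation: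
  assumes "s \<in> S" "t \<in> S" "m s t = enat n"
  shows "(s \<otimes> t) [^] n = \<one>"
proof -
  interpret F: group "free_group S" by (rule group_free_group)
  let ?x = "[(s, True)] \<otimes>\<^bsub>free_group S\<^esub> [(t, True)]"
  have st: "[(s, True)] \<in> carrier (free_group S)" "[(t, True)] \<in> carrier (free_group S)"
    using assms by (auto simp: free_group_def reduced_def)
  then have x: "?x \<in> carrier (free_group S)" by simp
  have hom: "eval_word G (u \<otimes>\<^bsub>free_group S\<^esub> v) = eval_word G u \<otimes> eval_word G v"
    if "u \<in> carrier (free_group S)" "v \<in> carrier (free_group S)" for u v
    using that eval_word_free_mult[OF S_carrier, of u v] by (simp add: free_group_def)
  have "eval_word G (?x [^]\<^bsub>free_group S\<^esub> k) = (s \<otimes> t) [^] k" for k :: nat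
  proof (induction k)
    case 0
    then show ?case by (simp add: free_group_def eval_word_def)
  next
    case (Suc k)
    then show ?case
      using hom[OF F.nat_pow_closed[OF x] x] hom[OF st] assms by (simp add: eval_word_def)
  qed
  moreover have "?x [^]\<^bsub>free_group S\<^esub> n \<in> coxeter_relators S m"
    using assms by (auto simp: coxeter_relators_def)
  ultimately show ?thesis using relator_eval[OF pres _ relators_carrier] by metis
qed

lemma involution [simp]: "s \<in> S \<Longrightarrow> s \<otimes> s = \<one>"
  using coxeter_relation[of s s 1] m_one[of s s] by (simp add: one_enat_def)

lemma inv_generator [simp]: "s \<in> S \<Longrightarrow> inv s = s"
  using inv_equality[of s s] by simp

lemma involution_left [simp]: "s \<in> S \<Longrightarrow> w \<in> carrier G \<Longrightarrow> s \<otimes> (s \<otimes> w) = w"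
  using m_assoc[of s s w] by simp

lemma commute:
  assumes "s \<in> S" "t \<in> S" "m s t \<noteq> \<infinity>"
  shows "s \<otimes> t = t \<otimes> s"
proof (cases "s = t")
  case False
  then have "m s t = enat 2" using assms m_diff[of s t] by (auto simp: numeral_eq_enat)
  then have "(s \<otimes> t) [^] (2::nat) = \<one>" by (rule coxeter_relation[OF assms(1,2)])
  then have "(s \<otimes> t) \<otimes> (s \<otimes> t) = \<one>" using assms by (simp add: numeral_2_eq_2)
  then have "inv (s \<otimes> t) = s \<otimes> t" using assms by (intro inv_equality) auto
  then show ?thesis using assms inv_mult_group[of s t] by simp
qed simp

lemma commute_left:
  assumes "s \<in> S" "t \<in> S" "m s t \<noteq> \<infinity>" "w \<in> carrier G"
  shows "s \<otimes> (t \<otimes> w) = t \<otimes> (s \<otimes> w)"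
  using commute[OF assms(1-3)] assms m_assoc[of s t w] m_assoc[of t s w] by simp

text \<open>Firing is an involution and firings at nodes with a finite label commute, so the
  relators act trivially. The start with all values 1 is an interior point of the fundamental
  chamber, which is why the signs of its images can detect descents.\<close>

lemma state_exists:
  "\<exists>\<phi> :: 'a \<Rightarrow> 'a \<Rightarrow> int. \<phi> \<one> = (\<lambda>_. 1) \<and> (\<forall>s\<in>S. \<forall>w\<in>carrier G. \<phi> (s \<otimes> w) = fire m s (\<phi> w))"
proof -
  let ?A = "\<lambda>x :: 'a \<times> bool. fire m (fst x)"
  interpret F: group "free_group S" by (rule group_free_group)
  have inv: "?A (inv_letter x) (?A x f) = f" for x f by simp
  have rel: "foldr ?A r f = f" if r: "r \<in> coxeter_relators S m" for r f
  proof -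
    obtain s t n where r': "s \<in> S" "t \<in> S" "m s t = enat n"
      "r = ([(s, True)] \<otimes>\<^bsub>free_group S\<^esub> [(t, True)]) [^]\<^bsub>free_group S\<^esub> (n :: nat)"
      using r by (auto simp: coxeter_relators_def)
    let ?x = "[(s, True)] \<otimes>\<^bsub>free_group S\<^esub> [(t, True)]"
    have x: "foldr ?A ?x f = fire m s (fire m t f)" for f
      using act_free_mult[of ?A "[(s, True)]" "[(t, True)]" f] by (simp add: free_group_def)
    have p: "foldr ?A (u \<otimes>\<^bsub>free_group S\<^esub> v) f = foldr ?A u (foldr ?A v f)" for u v f
      using act_free_mult[of ?A u v f] by (simp add: free_group_def)
    have one: "\<one>\<^bsub>free_group S\<^esub> = []" by (simp add: free_group_def)
    have pow: "foldr ?A (?x [^]\<^bsub>free_group S\<^esub> (k::nat)) f = ((\<lambda>f. fire m s (fire m t f)) ^^ k) f" for k f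
    proof (induction k arbitrary: f)
      case 0
      show ?case by (simp add: one)
    next
      case (Suc k)
      have "foldr ?A (?x [^]\<^bsub>free_group S\<^esub> Suc k) f
          = ((\<lambda>f. fire m s (fire m t f)) ^^ k) (fire m s (fire m t f))"
        by (simp add: p Suc)
      also have "\<dots> = ((\<lambda>f. fire m s (fire m t f)) ^^ Suc k) f"
        by (simp only: funpow_Suc_right comp_apply)
      finally show ?case .
    qed
    show ?thesis
    proof (cases "s = t")
      case True
      have "((\<lambda>f. fire m s (fire m t f)) ^^ k) f = f" for k
        unfolding True fire_fire by (induction k) simp_all
      then show ?thesis by (simp only: r'(4) pow)
    next
      case False
      then have n: "n = 2" using r' m_diff[of s t] by (auto simp: numeral_eq_enat)
      have "m s t \<noteq> \<infinity>" "m t s \<noteq> \<infinity>" using r' m_sym[of s t] by auto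
      then have "fire m s (fire m t (fire m s (fire m t f))) = f"
        by (metis fire_commute fire_fire)
      then show ?thesis by (simp only: r'(4) pow n numeral_2_eq_2 funpow.simps comp_apply id_apply)
    qed
  qed
  have "\<exists>\<phi>. \<forall>u f. fst ` set u \<subseteq> S \<longrightarrow> \<phi> (eval_word G u) f = foldr ?A u f"
    by (rule presented_action[OF pres inv relators_carrier rel])
  then obtain \<phi> where
    \<phi>: "\<And>u f. fst ` set u \<subseteq> S \<Longrightarrow> \<phi> (eval_word G u) f = foldr ?A u f"
    by metis
  have surj: "\<exists>u. fst ` set u \<subseteq> S \<and> eval_word G u = w" if "w \<in> generate G S" for w
    using that
  proof induction
    case one
    then show ?case by (intro exI[of _ "[]"]) (simp add: eval_word_def)
  next
    case (incl h)
    then show ?case by (intro exI[of _ "[(h, True)]"]) (simp add: eval_word_def)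
  next
    case (inv h)
    then show ?case by (intro exI[of _ "[(h, True)]"]) (simp add: eval_word_def)
  next
    case (eng h1 h2)
    then obtain u v where uv: "fst ` set u \<subseteq> S" "eval_word G u = h1"
      "fst ` set v \<subseteq> S" "eval_word G v = h2"
      by blast
    then have "fst ` set (free_mult u v) \<subseteq> S" by (intro letters_free_mult_subset)
    then show ?case using eval_word_free_mult[OF S_carrier uv(1,3)] uv
      by (intro exI[of _ "free_mult u v"]) simp
  qed
  let ?\<phi> = "\<lambda>w. \<phi> w (\<lambda>_. 1)"
  have "?\<phi> \<one> = (\<lambda>_. 1)" using \<phi>[of "[]"] by (simp add: eval_word_def)
  moreover have "?\<phi> (s \<otimes> w) = fire m s (?\<phi> w)" if sw: "s \<in> S" "w \<in> carrier G" for s w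
  proof -
    obtain u where u: "fst ` set u \<subseteq> S" "eval_word G u = w"
      using surj[of w] sw(2) unfolding S_generate by blast
    have e: "eval_word G ((s, True) # u) = s \<otimes> eval_word G u" by (simp add: eval_word_def)
    have "\<phi> (eval_word G ((s, True) # u)) (\<lambda>_. 1) = fire m s (\<phi> (eval_word G u) (\<lambda>_. 1))"
      using u(1) sw(1) by (simp add: \<phi>)
    then show ?thesis by (simp only: e u(2))
  qed
  ultimately show ?thesis by (intro exI[of _ ?\<phi>]) simp
qed

section \<open>Legal firings, word length and descents\<close>

definition state :: "'a \<Rightarrow> 'a \<Rightarrow> int" where
  "state = (SOME \<phi>. \<phi> \<one> = (\<lambda>_. 1) \<and> (\<forall>s\<in>S. \<forall>w\<in>carrier G. \<phi> (s \<otimes> w) = fire m s (\<phi> w)))"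

lemma state_one: "state \<one> t = 1"
  and state_mult: "s \<in> S \<Longrightarrow> w \<in> carrier G \<Longrightarrow> state (s \<otimes> w) = fire m s (state w)"
  using someI_ex[OF state_exists] unfolding state_def[symmetric] by auto

text \<open>Legal plays of the game: only positive nodes are fired. The counter turns out to be the
  word length, and induction on plays replaces the exchange condition of general Coxeter
  theory.\<close>

inductive reach :: "nat \<Rightarrow> 'a \<Rightarrow> bool" where
  reach_one: "reach 0 \<one>"
| reach_Suc: "reach n w \<Longrightarrow> s \<in> S \<Longrightarrow> state w s > 0 \<Longrightarrow> reach (Suc n) (s \<otimes> w)"

lemma reach_carrier: "reach n w \<Longrightarrow> w \<in> carrier G"
  by (induction rule: reach.induct) auto

lemma reach_0: "reach 0 w \<longleftrightarrow> w = \<one>"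
  by (auto elim: reach.cases intro: reach_one)

text \<open>A firing negates a value or adds an even number, so oddness persists and no value is
  ever 0. If one of two joined nodes is fired at value p > 0, the new sum is p plus the old value of
  the other node, which is the old sum; firing a third node only increases values.\<close>

lemma reach_invariant:
  assumes "reach n w"
  shows "\<forall>s\<in>S. odd (state w s)" "\<forall>s\<in>S. \<forall>t\<in>S. m s t = \<infinity> \<longrightarrow> state w s + state w t > 0"
proof -
  have "(\<forall>s\<in>S. odd (state w s)) \<and> (\<forall>s\<in>S. \<forall>t\<in>S. m s t = \<infinity> \<longrightarrow> state w s + state w t > 0)"
    using assms
  proof induction
    case reach_one
    then show ?case by (simp add: state_one)
  next
    case (reach_Suc n w r)
    then have [simp]: "state (r \<otimes> w) = fire m r (state w)"
      using reach_carrier state_mult by blast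
    show ?case
    proof (intro conjI ballI impI)
      fix s assume "s \<in> S"
      then show "odd (state (r \<otimes> w) s)" using reach_Suc by (auto simp: fire_def)
    next
      fix s t assume st: "s \<in> S" "t \<in> S" "m s t = \<infinity>"
      have "s \<noteq> t" using st m_one[of s s] by auto
      moreover have "state w s + state w t > 0" using reach_Suc st by blast
      ultimately show "state (r \<otimes> w) s + state (r \<otimes> w) t > 0"
        using st m_sym[of s t] reach_Suc.hyps by (auto simp: fire_def)
    qed
  qed
  then show "\<forall>s\<in>S. odd (state w s)" "\<forall>s\<in>S. \<forall>t\<in>S. m s t = \<infinity> \<longrightarrow> state w s + state w t > 0"
    by auto
qed

text \<open>The exchange property. Let \<open>q\<close> be the last fired node. If \<open>r\<close>
  differs from \<open>q\<close>, both are negative now, so they are not joined and commute; thus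
  \<open>r\<close> was negative before, the induction hypothesis undoes it there, and
  \<open>q\<close> can be fired again afterwards.\<close>

lemma reach_neg:
  assumes "reach n w" "r \<in> S" "state w r < 0"
  shows "\<exists>n'. n = Suc n' \<and> reach n' (r \<otimes> w)"
  using assms
proof (induction arbitrary: r)
  case reach_one
  then show ?case by (simp add: state_one)
next
  case (reach_Suc n w q)
  note w = reach_carrier[OF reach_Suc.hyps(1)]
  have st: "state (q \<otimes> w) = fire m q (state w)" using state_mult reach_Suc w by simp
  show ?case
  proof (cases "r = q")
    case True
    then show ?thesis using reach_Suc w by simp
  next
    case False
    have "m q r \<noteq> \<infinity>"
    proof
      assume "m q r = \<infinity>"
      then have "state (q \<otimes> w) q + state (q \<otimes> w) r > 0"
        using reach_invariant(2)[OF reach.reach_Suc[OF reach_Suc.hyps]] reach_Suc by blast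
      moreover have "state (q \<otimes> w) q < 0" using reach_Suc st by (simp add: fire_def)
      ultimately show False using reach_Suc.prems by simp
    qed
    then have "m r q \<noteq> \<infinity>" using m_sym reach_Suc by metis
    have "state w r < 0"
      using reach_Suc.prems st False \<open>m q r \<noteq> \<infinity>\<close>
      by (simp add: fire_def del: not_infinity_eq)
    then obtain n' where n': "n = Suc n'" "reach n' (r \<otimes> w)" using reach_Suc by blast
    have "state (r \<otimes> w) q = state w q"
      using False \<open>m r q \<noteq> \<infinity>\<close> state_mult[OF reach_Suc.prems(1) w]
      by (simp add: fire_def del: not_infinity_eq)
    then have "reach (Suc n') (q \<otimes> (r \<otimes> w))"
      using n' reach_Suc by (intro reach.reach_Suc) auto
    then show ?thesis
      using n' commute_left[of r q w] \<open>m r q \<noteq> \<infinity>\<close> reach_Suc w by simp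
  qed
qed

text \<open>The last fired node is negative, so \<open>reach_neg\<close> peels it off any other play
  that ends in the same element. No play of positive length returns to the unit, since all values
  there are 1.\<close>

lemma reach_unique: "reach n w \<Longrightarrow> reach k w \<Longrightarrow> n = k"
proof (induction arbitrary: k rule: reach.induct)
  case reach_one
  then show ?case
  proof cases
    case (reach_Suc n w s)
    have "state (s \<otimes> w) s < 0"
      using reach_Suc reach_carrier state_mult[of s w] by (simp add: fire_def)
    then show ?thesis using reach_Suc(2) state_one by (metis not_one_less_zero)
  qed simp
next
  case (reach_Suc n w s)
  have w: "w \<in> carrier G" using reach_Suc.hyps reach_carrier by blast
  then have "state (s \<otimes> w) s < 0"
    using reach_Suc.hyps state_mult[of s w] by (simp add: fire_def)
  then obtain k' where k': "k = Suc k'" "reach k' (s \<otimes> (s \<otimes> w))"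
    using reach_neg[OF reach_Suc.prems] reach_Suc.hyps by blast
  then show ?case using reach_Suc.IH[of k'] reach_Suc.hyps w by simp
qed

text \<open>Since no value is 0, each further generator either is a legal firing or undoes one, so
  the counter changes by exactly one.\<close>

lemma reach_list_prod:
  assumes "set xs \<subseteq> S"
  shows "\<exists>k\<le>length xs. reach k (list_prod G xs)"
  using assms
proof (induction xs)
  case Nil
  then show ?case by (simp add: list_prod_def reach_0)
next
  case (Cons s xs)
  then obtain k where k: "k \<le> length xs" "reach k (list_prod G xs)" by auto
  have e: "list_prod G (s # xs) = s \<otimes> list_prod G xs" by (simp add: list_prod_def)
  consider "state (list_prod G xs) s > 0" | "state (list_prod G xs) s < 0"
    using reach_invariant(1)[OF k(2)] Cons.prems by (metis even_zero insert_subset linorder_neqE_linordered_idom list.simps(15))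
  then show ?case
  proof cases
    case 1
    then show ?thesis using k Cons.prems reach_Suc e by (intro exI[of _ "Suc k"]) auto
  next
    case 2
    then obtain k' where "k = Suc k'" "reach k' (s \<otimes> list_prod G xs)"
      using reach_neg[OF k(2)] Cons.prems by auto
    then show ?thesis using k e by (intro exI[of _ k']) auto
  qed
qed

lemma reach_list: "reach n w \<Longrightarrow> \<exists>xs. set xs \<subseteq> S \<and> length xs = n \<and> list_prod G xs = w"
proof (induction rule: reach.induct)
  case reach_one
  then show ?case by (simp add: list_prod_def)
next
  case (reach_Suc n w s)
  then obtain xs where "set xs \<subseteq> S" "length xs = n" "list_prod G xs = w" by blast
  then show ?case using reach_Suc by (intro exI[of _ "s # xs"]) (auto simp: list_prod_def)
qed

lemma word_length_reach:
  assumes "reach n w"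
  shows "word_length G S w = n"
  unfolding word_length_def
proof (rule Least_equality)
  show "\<exists>xs. set xs \<subseteq> S \<and> length xs = n \<and> list_prod G xs = w" using reach_list assms by blast
  fix k assume "\<exists>xs. set xs \<subseteq> S \<and> length xs = k \<and> list_prod G xs = w"
  then obtain xs where xs: "set xs \<subseteq> S" "length xs = k" "list_prod G xs = w" by blast
  then obtain j where "j \<le> k" "reach j w" using reach_list_prod[of xs] by blast
  then show "n \<le> k" using reach_unique[OF assms] by blast
qed

lemma list_prod_generate: "w \<in> generate G \<sigma> \<Longrightarrow> \<sigma> \<subseteq> S \<Longrightarrow> \<exists>xs. set xs \<subseteq> \<sigma> \<and> list_prod G xs = w"
proof (induction rule: generate.induct)
  case one
  then show ?case by (intro exI[of _ "[]"]) (simp add: list_prod_def)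
next
  case (incl h)
  then show ?case by (intro exI[of _ "[h]"]) (auto simp: list_prod_def)
next
  case (inv h)
  then have "inv h = h" by auto
  with inv show ?case by (intro exI[of _ "[h]"]) (auto simp: list_prod_def)
next
  case (eng h1 h2)
  then obtain xs ys where 1: "set xs \<subseteq> \<sigma>" "list_prod G xs = h1" "set ys \<subseteq> \<sigma>" "list_prod G ys = h2"
    by blast
  have c: "list_prod G xs \<in> carrier G" if "set xs \<subseteq> S" for xs
    using that by (induction xs) (auto simp: list_prod_def)
  have "list_prod G (xs @ ys) = list_prod G xs \<otimes> list_prod G ys" if "set xs \<subseteq> S" "set ys \<subseteq> S"
    using that(1)
  proof (induction xs)
    case Nil
    then show ?case using c[OF that(2)] by (simp add: list_prod_def)
  next
    case (Cons a xs)
    then show ?case using c[of xs] c[OF that(2)] m_assoc by (auto simp: list_prod_def)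
  qed
  then show ?case using 1 eng.prems by (intro exI[of _ "xs @ ys"]) auto
qed

lemma reach_exists: "w \<in> carrier G \<Longrightarrow> \<exists>n. reach n w"
  using list_prod_generate[of w S] reach_list_prod S_generate by blast

lemma state_nonzero: "w \<in> carrier G \<Longrightarrow> s \<in> S \<Longrightarrow> state w s \<noteq> 0"
  using reach_exists reach_invariant(1) even_zero by metis

lemma word_length_mult:
  assumes "w \<in> carrier G" "s \<in> S"
  shows "state w s > 0 \<Longrightarrow> word_length G S (s \<otimes> w) = Suc (word_length G S w)"
    and "state w s < 0 \<Longrightarrow> Suc (word_length G S (s \<otimes> w)) = word_length G S w"
proof -
  obtain n where n: "reach n w" using reach_exists assms by blast
  show "state w s > 0 \<Longrightarrow> word_length G S (s \<otimes> w) = Suc (word_length G S w)"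
    using word_length_reach[OF n] word_length_reach[OF reach_Suc[OF n]] assms by simp
  show "state w s < 0 \<Longrightarrow> Suc (word_length G S (s \<otimes> w)) = word_length G S w"
    using word_length_reach[OF n] reach_neg[OF n] word_length_reach assms by fastforce
qed

lemma descents_state:
  assumes "w \<in> carrier G"
  shows "descents G S w = {s \<in> S. state w s < 0}"
  unfolding descents_def using word_length_mult[OF assms] state_nonzero[OF assms]
  by (smt (verit, best) Collect_cong lessI not_less_eq order_less_asym')

text \<open>Two joined nodes with negative values would contradict the positive sum in
  \<open>reach_invariant\<close>. This is what makes descent sets simplices of the nerve.\<close>

lemma descents_commuting:
  assumes "w \<in> carrier G" "s \<in> descents G S w" "t \<in> descents G S w"
  shows "m s t \<noteq> \<infinity>"
proof
  assume "m s t = \<infinity>"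
  obtain n where "reach n w" using reach_exists assms by blast
  then have "state w s + state w t > 0"
    using reach_invariant(2) assms \<open>m s t = \<infinity>\<close> by (auto simp: descents_state)
  then show False using assms by (auto simp: descents_state)
qed

lemma descents_mult_self:
  "w \<in> carrier G \<Longrightarrow> s \<in> S \<Longrightarrow> s \<in> descents G S (s \<otimes> w) \<longleftrightarrow> s \<notin> descents G S w"
  using state_nonzero[of w s] by (auto simp: descents_state state_mult fire_def)

lemma descents_mult_commuting:
  "w \<in> carrier G \<Longrightarrow> s \<in> S \<Longrightarrow> t \<in> S \<Longrightarrow> s \<noteq> t \<Longrightarrow> m s t \<noteq> \<infinity> \<Longrightarrow>
    t \<in> descents G S (s \<otimes> w) \<longleftrightarrow> t \<in> descents G S w"
  by (auto simp: descents_state state_mult fire_def)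

end

text \<open>The rule for consecutive letters. If \<sigma> lies in \<open>K\<close> it also forces
  \<sigma> and \<tau> to be disjoint, because inserting an element of \<sigma> changes nothing. It
  is stated for any family \<open>K\<close> so that the group side and the combinatorial side share
  it.\<close>

definition independent_over :: "'a set set \<Rightarrow> 'a set \<Rightarrow> 'a set \<Rightarrow> bool" where
  "independent_over K \<sigma> \<tau> \<longleftrightarrow> (\<forall>t\<in>\<tau>. insert t \<sigma> \<notin> K)"

section \<open>Spherical subsets and the local description of the normal form\<close>

context racg
begin

definition clique :: "'a set \<Rightarrow> bool" where
  "clique \<sigma> \<longleftrightarrow> \<sigma> \<subseteq> S \<and> (\<forall>s\<in>\<sigma>. \<forall>t\<in>\<sigma>. m s t \<noteq> \<infinity>)"

lemma clique_subset: "clique \<sigma> \<Longrightarrow> \<tau> \<subseteq> \<sigma> \<Longrightarrow> clique \<tau>"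
  unfolding clique_def by blast

lemma list_prod_Nil [simp]: "list_prod G [] = \<one>"
  and list_prod_Cons [simp]: "list_prod G (s # xs) = s \<otimes> list_prod G xs"
  by (simp_all add: list_prod_def)

lemma list_prod_closed [simp]: "set xs \<subseteq> carrier G \<Longrightarrow> list_prod G xs \<in> carrier G"
  by (induction xs) auto

lemma m_self: "s \<in> S \<Longrightarrow> m s s \<noteq> \<infinity>"
  using m_one[of s s] by auto

lemma descents_one: "descents G S \<one> = {}"
  by (auto simp: descents_state state_one)

text \<open>Left multiplication by \<open>t\<close> itself flips whether \<open>t\<close> is a
  descent, and multiplication by another generator commuting with \<open>t\<close> leaves this
  alone. In a duplicate-free list the flip happens at most once.\<close>

lemma descents_list_prod_mult:
  assumes "set xs \<subseteq> S" "distinct xs" "w \<in> carrier G" "t \<in> S" "\<forall>s\<in>set xs. m s t \<noteq> \<infinity>"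
  shows "t \<in> descents G S (list_prod G xs \<otimes> w) \<longleftrightarrow> (t \<in> descents G S w) \<noteq> (t \<in> set xs)"
  using assms
proof (induction xs)
  case (Cons s xs)
  have c: "list_prod G xs \<in> carrier G" using Cons.prems by (intro list_prod_closed) auto
  then have e: "list_prod G (s # xs) \<otimes> w = s \<otimes> (list_prod G xs \<otimes> w)"
    using Cons.prems by (simp add: m_assoc)
  have IH: "t \<in> descents G S (list_prod G xs \<otimes> w) \<longleftrightarrow> (t \<in> descents G S w) \<noteq> (t \<in> set xs)"
    using Cons by auto
  show ?case
  proof (cases "t = s")
    case True
    then show ?thesis
      using IH Cons.prems c descents_mult_self[of "list_prod G xs \<otimes> w" s] unfolding e by auto
  next
    case False
    then show ?thesis
      using IH Cons.prems c descents_mult_commuting[of "list_prod G xs \<otimes> w" s t] unfolding e by auto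
  qed
qed simp

lemma word_length_descents:
  assumes "w \<in> carrier G" "s \<in> S" "s \<notin> descents G S w"
  shows "word_length G S (s \<otimes> w) = Suc (word_length G S w)"
  using assms word_length_mult(1)[OF assms(1,2)] state_nonzero[OF assms(1,2)]
  by (auto simp: descents_state)

lemma word_length_one: "word_length G S \<one> = 0"
  using word_length_reach[OF reach_one] .

lemma word_length_list_prod:
  assumes "clique (set xs)" "distinct xs"
  shows "word_length G S (list_prod G xs) = length xs"
  using assms
proof (induction xs)
  case (Cons s xs)
  have xs: "set xs \<subseteq> S" "s \<in> S" using Cons.prems by (auto simp: clique_def)
  then have c: "list_prod G xs \<in> carrier G" by (intro list_prod_closed) auto
  have "s \<notin> descents G S (list_prod G xs \<otimes> \<one>)"
    using descents_list_prod_mult[of xs \<one> s] Cons.prems xs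
    by (auto simp: descents_one clique_def)
  moreover have "clique (set xs)" using Cons.prems by (auto simp: clique_def)
  ultimately show ?case using word_length_descents[OF c xs(2)] Cons c by simp
qed (simp add: word_length_one)

lemma list_prod_move:
  assumes "set (as @ s # bs) \<subseteq> S" "\<forall>t\<in>set as. m t s \<noteq> \<infinity>"
  shows "list_prod G (as @ s # bs) = s \<otimes> list_prod G (as @ bs)"
  using assms
proof (induction as)
  case (Cons a as)
  have "set (as @ bs) \<subseteq> carrier G" using Cons.prems by auto
  then show ?case using Cons commute_left[of a s "list_prod G (as @ bs)"] by simp
qed simp

text \<open>In a clique a later copy of a letter can be moved to the front, where it cancels as an
  involution.\<close>

lemma list_prod_distinct:
  assumes "clique (set ys)"
  shows "\<exists>xs. distinct xs \<and> set xs \<subseteq> set ys \<and> list_prod G xs = list_prod G ys"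
  using assms
proof (induction ys)
  case (Cons s ys)
  then have "clique (set ys)" by (auto simp: clique_def)
  then obtain xs where xs: "distinct xs" "set xs \<subseteq> set ys" "list_prod G xs = list_prod G ys"
    using Cons.IH by blast
  show ?case
  proof (cases "s \<in> set xs")
    case False
    then show ?thesis using xs by (intro exI[of _ "s # xs"]) auto
  next
    case True
    then obtain as bs where ab: "xs = as @ s # bs" by (meson split_list)
    have S: "set xs \<subseteq> S" "s \<in> S" "\<forall>t\<in>set xs. m t s \<noteq> \<infinity>"
      using Cons.prems xs by (auto simp: clique_def)
    then have "set (as @ bs) \<subseteq> carrier G" using ab by auto
    then have "list_prod G (s # ys) = list_prod G (as @ bs)"
      using list_prod_move[of as s bs] S ab by (simp add: xs(3)[symmetric])
    then show ?thesis using xs ab by (intro exI[of _ "as @ bs"]) auto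
  qed
qed (auto intro: exI[of _ "[]"])

lemma generate_clique:
  assumes "clique \<sigma>" "w \<in> generate G \<sigma>"
  obtains xs where "distinct xs" "set xs \<subseteq> \<sigma>" "w = list_prod G xs"
proof -
  obtain ys where ys: "set ys \<subseteq> \<sigma>" "list_prod G ys = w"
    using list_prod_generate[OF assms(2)] assms(1) by (auto simp: clique_def)
  then have "clique (set ys)" using assms(1) clique_subset by blast
  then obtain xs where "distinct xs" "set xs \<subseteq> set ys" "list_prod G xs = list_prod G ys"
    using list_prod_distinct by blast
  then show thesis using ys by (intro that[of xs]) auto
qed

lemma list_prod_in_generate: "set xs \<subseteq> \<sigma> \<Longrightarrow> list_prod G xs \<in> generate G \<sigma>"
  by (induction xs) (auto intro: generate.intros)

text \<open>The alternating products of \<open>s\<close> and \<open>t\<close> have strictly growing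
  length: the letter just multiplied is a descent, so the other one, joined to it by an infinite
  label, is not.\<close>

lemma infinite_generate:
  assumes "s \<in> \<sigma>" "t \<in> \<sigma>" "\<sigma> \<subseteq> S" "m s t = \<infinity>"
  shows "infinite (generate G \<sigma>)"
proof -
  define x where "x n = (if even n then s else t)" for n :: nat
  define a where "a n = rec_nat \<one> (\<lambda>n w. x n \<otimes> w) n" for n
  have a: "a 0 = \<one>" "a (Suc n) = x n \<otimes> a n" for n by (simp_all add: a_def)
  have xS: "x n \<in> S" "x n \<in> \<sigma>" for n using assms by (auto simp: x_def)
  have ac: "a n \<in> carrier G" for n by (induction n) (simp_all add: a xS)
  have ag: "a n \<in> generate G \<sigma>" for n
    by (induction n) (auto simp: a intro: generate.one generate.eng[OF generate.incl[OF xS(2)]])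
  have xx: "m (x n) (x (Suc n)) = \<infinity>" for n
    using assms m_sym[of s t] by (auto simp: x_def subset_iff)
  have "word_length G S (a n) = n \<and> x n \<notin> descents G S (a n)" for n
  proof (induction n)
    case 0
    then show ?case by (simp add: a word_length_one descents_one)
  next
    case (Suc n)
    have "x n \<in> descents G S (a (Suc n))"
      using descents_mult_self[OF ac xS(1)] Suc by (simp add: a)
    then have "x (Suc n) \<notin> descents G S (a (Suc n))"
      using descents_commuting[OF ac] xx by blast
    then show ?case using word_length_descents[OF ac xS(1)] Suc by (simp add: a)
  qed
  then have "inj a" by (metis injI)
  then show ?thesis using ag by (meson finite_subset image_subsetI range_inj_infinite)
qed

text \<open>An infinite label inside \<sigma> gives an infinite subgroup; otherwise every element is
  the product of one of finitely many duplicate-free lists over \<sigma>.\<close>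

lemma nerve_clique:
  assumes "finite S"
  shows "\<sigma> \<in> nerve G S \<longleftrightarrow> clique \<sigma>"
proof
  assume "\<sigma> \<in> nerve G S"
  then show "clique \<sigma>" using infinite_generate unfolding clique_def nerve_def by blast
next
  assume c: "clique \<sigma>"
  then have "finite \<sigma>" using assms finite_subset by (auto simp: clique_def)
  then have "finite {xs. set xs \<subseteq> \<sigma> \<and> distinct xs}" by (rule finite_subset_distinct)
  moreover have "generate G \<sigma> \<subseteq> list_prod G ` {xs. set xs \<subseteq> \<sigma> \<and> distinct xs}"
    using generate_clique[OF c] by blast
  ultimately have "finite (generate G \<sigma>)" by (meson finite_imageI finite_subset)
  then show "\<sigma> \<in> nerve G S" using c by (auto simp: nerve_def clique_def)
qed

text \<open>The longest element is defined by choice. A duplicate-free product has length equal to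
  its number of factors, so the maximum is |\<sigma>| and whichever element is chosen must use every
  letter of \<sigma>.\<close>

lemma longest_element_clique:
  assumes "clique \<sigma>" "finite \<sigma>"
  obtains xs where "distinct xs" "set xs = \<sigma>" "longest_element G S \<sigma> = list_prod G xs"
proof -
  let ?l = "word_length G S" and ?P = "\<lambda>w. w \<in> generate G \<sigma>"
  have len: "?l (list_prod G xs) = length xs" if "distinct xs" "set xs \<subseteq> \<sigma>" for xs
    using that assms(1) clique_subset by (intro word_length_list_prod) blast+
  obtain zs where zs: "distinct zs" "set zs = \<sigma>" using finite_distinct_list[OF assms(2)] by blast
  have bound: "?l w \<le> card \<sigma>" if w: "?P w" for w
  proof -
    obtain ys where ys: "distinct ys" "set ys \<subseteq> \<sigma>" "w = list_prod G ys"
      by (rule generate_clique[OF assms(1) w])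
    then show ?thesis using len[of ys] card_mono[OF assms(2) ys(2)] distinct_card[of ys] by simp
  qed
  have "is_arg_max ?l ?P (list_prod G zs)"
    using bound len[of zs] zs list_prod_in_generate[of zs \<sigma>] distinct_card[of zs]
    by (force simp: is_arg_max_def)
  then have am: "is_arg_max ?l ?P (longest_element G S \<sigma>)"
    unfolding longest_element_def arg_max_on_def arg_max_def by (rule someI)
  then obtain xs where xs: "distinct xs" "set xs \<subseteq> \<sigma>" "longest_element G S \<sigma> = list_prod G xs"
    using generate_clique[OF assms(1)] by (metis is_arg_max_def)
  have "\<not> ?l (list_prod G zs) > ?l (list_prod G xs)"
    using am list_prod_in_generate[of zs \<sigma>] zs unfolding xs(3) is_arg_max_def by blast
  then have "card \<sigma> \<le> card (set xs)" using len xs zs distinct_card by (metis leI order_refl)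
  then have "set xs = \<sigma>" using card_seteq[OF assms(2) xs(2)] by simp
  then show thesis using that xs by blast
qed

lemma insert_nerve:
  assumes "finite S" "\<sigma> \<in> nerve G S" "t \<in> S"
  shows "insert t \<sigma> \<in> nerve G S \<longleftrightarrow> (\<forall>s\<in>\<sigma>. m s t \<noteq> \<infinity>)"
proof -
  have "\<sigma> \<subseteq> S" using assms by (auto simp: nerve_def)
  then have "\<forall>s\<in>\<sigma>. m t s = m s t" using m_sym assms(3) by blast
  then show ?thesis
    using assms m_self[OF assms(3)]
    by (simp add: nerve_clique clique_def del: not_infinity_eq)
qed

text \<open>Both sides say that every vertex of \<rho> has finite label with every vertex of
  \<sigma>.\<close>

lemma nerve_flag:
  assumes "finite S" "\<sigma> \<in> nerve G S" "\<rho> \<in> nerve G S"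
  shows "\<sigma> \<union> \<rho> \<in> nerve G S \<longleftrightarrow> (\<forall>t\<in>\<rho>. insert t \<sigma> \<in> nerve G S)"
proof -
  have "\<rho> \<subseteq> S" "\<sigma> \<subseteq> S" using assms by (auto simp: nerve_def)
  then have "(\<forall>t\<in>\<rho>. insert t \<sigma> \<in> nerve G S) \<longleftrightarrow> (\<forall>t\<in>\<rho>. \<forall>s\<in>\<sigma>. m s t \<noteq> \<infinity>)"
    using insert_nerve[OF assms(1,2)] by blast
  moreover have "\<forall>t\<in>\<rho>. \<forall>s\<in>\<sigma>. m s t = m t s" using \<open>\<rho> \<subseteq> S\<close> \<open>\<sigma> \<subseteq> S\<close> m_sym by blast
  ultimately show ?thesis
    using assms(2,3) \<open>\<rho> \<subseteq> S\<close> \<open>\<sigma> \<subseteq> S\<close> unfolding nerve_clique[OF assms(1)] clique_def by auto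
qed

lemma longest_element_closed:
  assumes "finite S" "\<sigma> \<in> nerve G S"
  shows "longest_element G S \<sigma> \<in> carrier G"
proof -
  have c: "clique \<sigma>" "finite \<sigma>" "\<sigma> \<subseteq> S"
    using assms nerve_clique finite_subset[of \<sigma> S] by (auto simp: nerve_def)
  obtain xs where "distinct xs" "set xs = \<sigma>" "longest_element G S \<sigma> = list_prod G xs"
    by (rule longest_element_clique[OF c(1,2)])
  then show ?thesis using c(3) S_carrier by simp
qed

text \<open>Among the generators commuting with all of \<sigma>, the new descent set is the
  symmetric difference of the old one with \<sigma>. Independence makes \<sigma> part of the new
  descent set; all new descents then commute with \<sigma>, so this formula decides about every one
  of them.\<close>

lemma descents_longest_mult:
  assumes "finite S" "\<sigma> \<in> nerve G S" "w \<in> carrier G"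
  shows "descents G S (longest_element G S \<sigma> \<otimes> w) = \<sigma>
    \<longleftrightarrow> independent_over (nerve G S) \<sigma> (descents G S w)"
    (is "?D = \<sigma> \<longleftrightarrow> _")
proof -
  have c: "clique \<sigma>" "finite \<sigma>" "\<sigma> \<subseteq> S"
    using assms nerve_clique finite_subset[of \<sigma> S] by (auto simp: nerve_def)
  obtain xs where xs: "distinct xs" "set xs = \<sigma>" "longest_element G S \<sigma> = list_prod G xs"
    by (rule longest_element_clique[OF c(1,2)])
  have D: "t \<in> ?D \<longleftrightarrow> (t \<in> descents G S w) \<noteq> (t \<in> \<sigma>)" if "t \<in> S" "\<forall>s\<in>\<sigma>. m s t \<noteq> \<infinity>" for t
    using descents_list_prod_mult[of xs w t] xs c assms that by simp
  have dS: "descents G S v \<subseteq> S" for v by (auto simp: descents_def)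
  show ?thesis
  proof
    assume eq: "?D = \<sigma>"
    show "independent_over (nerve G S) \<sigma> (descents G S w)"
      unfolding independent_over_def
    proof (intro ballI notI)
      fix t assume t: "t \<in> descents G S w" "insert t \<sigma> \<in> nerve G S"
      then have "t \<in> S" using dS by blast
      then show False using D[of t] insert_nerve[OF assms(1,2)] t eq by auto
    qed
  next
    assume ind: "independent_over (nerve G S) \<sigma> (descents G S w)"
    have 1: "\<sigma> \<subseteq> ?D"
    proof
      fix s assume s: "s \<in> \<sigma>"
      then have "insert s \<sigma> \<in> nerve G S" using assms by (simp add: insert_absorb)
      then have "s \<notin> descents G S w" using ind by (auto simp: independent_over_def)
      moreover have "s \<in> S" "\<forall>r\<in>\<sigma>. m r s \<noteq> \<infinity>" using s c unfolding clique_def by blast+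
      ultimately show "s \<in> ?D" using D[of s] s by blast
    qed
    moreover have "?D \<subseteq> \<sigma>"
    proof
      fix t assume t: "t \<in> ?D"
      have "longest_element G S \<sigma> \<otimes> w \<in> carrier G"
        using longest_element_closed[OF assms(1,2)] assms(3) by simp
      then have com: "\<forall>s\<in>\<sigma>. m s t \<noteq> \<infinity>" using descents_commuting t 1 by blast
      have "t \<in> S" using t dS by blast
      then have "t \<notin> descents G S w"
        using ind insert_nerve[OF assms(1,2)] com by (auto simp: independent_over_def)
      then show "t \<in> \<sigma>" using D[OF \<open>t \<in> S\<close> com] t by simp
    qed
    ultimately show "?D = \<sigma>" by blast
  qed
qed

lemma left_greedy_nf_Cons:
  "\<sigma> # \<sigma>s \<in> left_greedy_nf G S \<longleftrightarrow> \<sigma> \<in> nerve_alphabet G S \<and> \<sigma>s \<in> left_greedy_nf G S \<and>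
     \<sigma> = descents G S (list_prod G (map (longest_element G S) (\<sigma> # \<sigma>s)))"
proof -
  let ?P = "\<lambda>i. (\<sigma> # \<sigma>s) ! i =
    descents G S (list_prod G (map (longest_element G S) (drop i (\<sigma> # \<sigma>s))))"
  have "(\<forall>i<length (\<sigma> # \<sigma>s). ?P i) \<longleftrightarrow> ?P 0 \<and> (\<forall>i<length \<sigma>s. ?P (Suc i))"
    by (simp only: length_Cons All_less_Suc2)
  then show ?thesis unfolding left_greedy_nf_def by auto
qed

lemma left_greedy_nf_eq:
  assumes "finite S"
  shows "left_greedy_nf G S =
    {\<sigma>s. set \<sigma>s \<subseteq> nerve_alphabet G S \<and> successively (independent_over (nerve G S)) \<sigma>s}"
proof -
  let ?l = "longest_element G S"
  \<comment> \<open>The value of a normal form has its first letter as descent set, which turns the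
    condition on a whole suffix into one on two consecutive letters. For the empty word the set is
    empty and independence is vacuous.\<close>
  have d: "\<sigma>s \<in> left_greedy_nf G S \<Longrightarrow>
      descents G S (list_prod G (map ?l \<sigma>s)) = (if \<sigma>s = [] then {} else hd \<sigma>s)" for \<sigma>s
    by (cases \<sigma>s) (simp_all add: descents_one left_greedy_nf_Cons)
  have "\<sigma>s \<in> left_greedy_nf G S \<longleftrightarrow>
      set \<sigma>s \<subseteq> nerve_alphabet G S \<and> successively (independent_over (nerve G S)) \<sigma>s" for \<sigma>s
  proof (induction \<sigma>s)
    case Nil
    then show ?case by (simp add: left_greedy_nf_def)
  next
    case (Cons \<sigma> \<sigma>s)
    show ?case
    proof (cases "\<sigma>s \<in> left_greedy_nf G S \<and> \<sigma> \<in> nerve_alphabet G S")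
      case False
      then show ?thesis using Cons by (auto simp: left_greedy_nf_Cons successively_Cons)
    next
      case True
      have "list_prod G (map ?l \<sigma>s) \<in> carrier G"
        using longest_element_closed[OF assms] True
        by (intro list_prod_closed) (auto simp: left_greedy_nf_def nerve_alphabet_def)
      moreover have "\<sigma> \<in> nerve G S" using True by (simp add: nerve_alphabet_def)
      ultimately have "\<sigma> = descents G S (list_prod G (map ?l (\<sigma> # \<sigma>s))) \<longleftrightarrow>
          independent_over (nerve G S) \<sigma> (if \<sigma>s = [] then {} else hd \<sigma>s)"
        using descents_longest_mult[OF assms, of \<sigma> "list_prod G (map ?l \<sigma>s)"] d[of \<sigma>s] True
        by auto
      then have "\<sigma> # \<sigma>s \<in> left_greedy_nf G S \<longleftrightarrow>
          independent_over (nerve G S) \<sigma> (if \<sigma>s = [] then {} else hd \<sigma>s)"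
        using True unfolding left_greedy_nf_Cons by blast
      then show ?thesis
        using True Cons by (cases \<sigma>s) (auto simp: independent_over_def successively_Cons)
    qed
  qed
  then show ?thesis by blast
qed

end

section \<open>Flag Eulerian spheres\<close>

definition sg :: "'a set \<Rightarrow> rat" where
  "sg \<sigma> = (- 1) ^ card \<sigma>"

lemma sg_empty [simp]: "sg {} = 1" and sg_sg [simp]: "sg \<sigma> * sg \<sigma> = 1"
  by (simp_all add: sg_def)

text \<open>Adding or removing \<open>v\<close> is a sign-reversing involution of \<open>F\<close>
  without fixed points.\<close>

lemma sum_sg_toggle:
  assumes "\<And>\<rho>. \<rho> \<in> F \<Longrightarrow> finite \<rho>" "\<And>\<rho>. \<rho> \<in> F \<Longrightarrow> insert v \<rho> \<in> F" "\<And>\<rho>. \<rho> \<in> F \<Longrightarrow> \<rho> - {v} \<in> F"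
  shows "sum sg F = 0"
proof -
  let ?f = "\<lambda>\<rho>. if v \<in> \<rho> then \<rho> - {v} else insert v \<rho>"
  have sgn: "sg (?f \<rho>) = - sg \<rho>" if "\<rho> \<in> F" for \<rho>
  proof (cases "v \<in> \<rho>")
    case True
    then have "card \<rho> = Suc (card (\<rho> - {v}))"
      using assms(1)[OF that] by (metis card_Suc_Diff1)
    then show ?thesis using True by (simp only: sg_def if_True power_Suc)
  qed (use assms(1)[OF that] in \<open>simp add: sg_def\<close>)
  have "sum sg F = (\<Sum>\<rho>\<in>F. sg (?f \<rho>))"
    by (rule sum.reindex_bij_witness[of _ ?f ?f]) (use assms in \<open>auto simp: insert_absorb\<close>)
  also have "\<dots> = - sum sg F" by (simp add: sgn flip: sum_negf)
  finally show ?thesis by simp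
qed

text \<open>Entries of matrix products such as E \<Delta> C have the form on the left; the right
  side is open to toggling.\<close>

lemma sum_of_bool_filter:
  fixes f :: "'b \<Rightarrow> rat"
  assumes "finite X"
  shows "(\<Sum>x\<in>X. of_bool (A x) * f x * of_bool (B x)) = (\<Sum>x\<in>{x \<in> X. A x \<and> B x}. f x)"
  unfolding sum.inter_filter[OF assms] by (rule sum.cong) auto

locale flag_sphere =
  fixes N :: "'a set set" and k :: int
  assumes sphere: "eulerian_sphere k N"
    and flag: "\<And>\<sigma> \<rho>. \<sigma> \<in> N \<Longrightarrow> \<rho> \<in> N \<Longrightarrow> \<forall>t\<in>\<rho>. insert t \<sigma> \<in> N \<Longrightarrow> \<sigma> \<union> \<rho> \<in> N"
begin

definition eps :: rat where "eps = (- 1) powi (k + 1)"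

definition J :: "'a set \<Rightarrow> 'a set \<Rightarrow> rat" where
  "J \<sigma> \<tau> = of_bool (independent_over N \<sigma> \<tau>)"

lemma finite_N [simp]: "finite N" and empty_N [simp]: "{} \<in> N"
  and finite_simplex: "\<sigma> \<in> N \<Longrightarrow> finite \<sigma>"
  and down: "\<sigma> \<in> N \<Longrightarrow> \<tau> \<subseteq> \<sigma> \<Longrightarrow> \<tau> \<in> N"
  using sphere by (auto simp: eulerian_sphere_def simplicial_complex_def)

lemma eps_eps: "eps * eps = 1"
  unfolding eps_def by (simp add: power_int_mult_distrib[symmetric])

text \<open>If some vertex \<open>v\<close> of \<tau> extends \<sigma>, flagness lets
  \<open>v\<close> be added to every admissible \<rho>, so toggling \<open>v\<close> cancels the
  sum. Otherwise only the empty \<rho> is left.\<close>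

lemma J_expand:
  assumes "\<sigma> \<in> N" "\<tau> \<in> N"
  shows "J \<sigma> \<tau> = (\<Sum>\<rho>\<in>N. of_bool (\<sigma> \<union> \<rho> \<in> N) * sg \<rho> * of_bool (\<rho> \<subseteq> \<tau>))"
proof -
  let ?F = "{\<rho> \<in> N. \<sigma> \<union> \<rho> \<in> N \<and> \<rho> \<subseteq> \<tau>}"
  have "sum sg ?F = J \<sigma> \<tau>"
  proof (cases "independent_over N \<sigma> \<tau>")
    case True
    have "\<rho> = {}" if "\<rho> \<in> ?F" for \<rho>
    proof (rule ccontr)
      assume "\<rho> \<noteq> {}"
      then obtain t where "t \<in> \<rho>" by blast
      then have "insert t \<sigma> \<in> N" "t \<in> \<tau>" using that down[of "\<sigma> \<union> \<rho>" "insert t \<sigma>"] by auto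
      then show False using True by (auto simp: independent_over_def)
    qed
    moreover have "{} \<in> ?F" using assms by simp
    ultimately have "?F = {{}}" by blast
    then show ?thesis using True by (simp add: J_def)
  next
    case False
    then obtain v where v: "v \<in> \<tau>" "insert v \<sigma> \<in> N" by (auto simp: independent_over_def)
    have "sum sg ?F = 0"
    proof (rule sum_sg_toggle[of _ v])
      fix \<rho> assume \<rho>: "\<rho> \<in> ?F"
      show "finite \<rho>" using \<rho> finite_simplex by blast
      have *: "insert v \<rho> \<in> N" using \<rho> v down[OF assms(2)] by auto
      have "\<forall>t\<in>insert v \<rho>. insert t \<sigma> \<in> N"
      proof
        fix t assume "t \<in> insert v \<rho>"
        then show "insert t \<sigma> \<in> N" using v(2) \<rho> down[of "\<sigma> \<union> \<rho>" "insert t \<sigma>"] by auto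
      qed
      then have "\<sigma> \<union> insert v \<rho> \<in> N" using flag[OF assms(1) *] by blast
      then show "insert v \<rho> \<in> ?F" using * \<rho> v by simp
      have "\<sigma> \<union> (\<rho> - {v}) \<in> N" by (rule down[of "\<sigma> \<union> \<rho>"]) (use \<rho> in auto)
      moreover have "\<rho> - {v} \<in> N" by (rule down[of \<rho>]) (use \<rho> in auto)
      ultimately show "\<rho> - {v} \<in> ?F" using \<rho> by auto
    qed
    then show ?thesis using False by (simp add: J_def)
  qed
  moreover have "(\<Sum>\<rho>\<in>N. of_bool (\<sigma> \<union> \<rho> \<in> N) * sg \<rho> * of_bool (\<rho> \<subseteq> \<tau>)) = sum sg ?F"
    by (rule sum_of_bool_filter) simp
  ultimately show ?thesis by simp
qed

text \<open>Each \<rho> is \<sigma> together with a simplex of its link. The signs over a link add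
  up to minus its Euler characteristic, and the sphere condition is exactly what makes the product
  with the sign of \<sigma> the same for all \<sigma>.\<close>

lemma sum_star:
  assumes "\<sigma> \<in> N"
  shows "(\<Sum>\<rho>\<in>{\<rho> \<in> N. \<sigma> \<subseteq> \<rho>}. sg \<rho>) = eps"
proof -
  have "(\<Sum>\<rho>\<in>{\<rho> \<in> N. \<sigma> \<subseteq> \<rho>}. sg \<rho>) = (\<Sum>\<eta>\<in>link N \<sigma>. sg \<sigma> * sg \<eta>)"
  proof (rule sum.reindex_bij_witness[of _ "\<lambda>\<eta>. \<sigma> \<union> \<eta>" "\<lambda>\<rho>. \<rho> - \<sigma>"])
    fix \<rho> assume \<rho>: "\<rho> \<in> {\<rho> \<in> N. \<sigma> \<subseteq> \<rho>}"
    then show "\<sigma> \<union> (\<rho> - \<sigma>) = \<rho>" by blast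
    have "\<rho> - \<sigma> \<in> N" by (rule down[of \<rho>]) (use \<rho> in auto)
    then show "\<rho> - \<sigma> \<in> link N \<sigma>" using \<rho> by (simp add: link_def Un_absorb1)
    show "sg \<sigma> * sg (\<rho> - \<sigma>) = sg \<rho>"
      using \<rho> finite_simplex[of \<rho>] finite_simplex[OF assms] card_mono[of \<rho> \<sigma>]
      by (simp add: sg_def card_Diff_subset flip: power_add)
  qed (auto simp: link_def)
  also have "\<dots> = sg \<sigma> * (\<Sum>\<eta>\<in>link N \<sigma>. sg \<eta>)" by (simp add: sum_distrib_left)
  also have "(\<Sum>\<eta>\<in>link N \<sigma>. sg \<eta>) = - reduced_euler_char (link N \<sigma>)"
  proof -
    have "(- 1) powi simplex_dim \<eta> = - sg \<eta>" for \<eta> :: "'a set"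
      by (simp add: simplex_dim_def sg_def power_int_diff)
    then show ?thesis by (simp add: reduced_euler_char_def sum_negf)
  qed
  also have "reduced_euler_char (link N \<sigma>) = (- 1) powi (k - int (card \<sigma>))"
    using sphere assms by (auto simp: eulerian_sphere_def simplex_dim_def)
  also have "sg \<sigma> * - ((- 1) powi (k - int (card \<sigma>))) = eps"
    by (simp add: sg_def eps_def power_int_diff power_int_add)
  finally show ?thesis .
qed

text \<open>If \<tau> lies in \<sigma>, the second condition on \<rho> is automatic and the sum runs
  over the star of \<sigma>. Otherwise a vertex of \<tau> outside \<sigma> can be toggled, since it
  does not affect the union of \<rho> with \<tau>.\<close>

lemma duality:
  assumes "\<sigma> \<in> N" "\<tau> \<in> N"
  shows "(\<Sum>\<rho>\<in>N. of_bool (\<sigma> \<subseteq> \<rho>) * sg \<rho> * of_bool (\<rho> \<union> \<tau> \<in> N)) = eps * of_bool (\<tau> \<subseteq> \<sigma>)"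
proof -
  let ?F = "{\<rho> \<in> N. \<sigma> \<subseteq> \<rho> \<and> \<rho> \<union> \<tau> \<in> N}"
  have "(\<Sum>\<rho>\<in>N. of_bool (\<sigma> \<subseteq> \<rho>) * sg \<rho> * of_bool (\<rho> \<union> \<tau> \<in> N)) = sum sg ?F"
    by (rule sum_of_bool_filter) simp
  also have "\<dots> = eps * of_bool (\<tau> \<subseteq> \<sigma>)"
  proof (cases "\<tau> \<subseteq> \<sigma>")
    case True
    then have "?F = {\<rho> \<in> N. \<sigma> \<subseteq> \<rho>}" by (auto simp: Un_absorb2)
    then show ?thesis using sum_star[OF assms(1)] True by simp
  next
    case False
    then obtain v where v: "v \<in> \<tau>" "v \<notin> \<sigma>" by blast
    have "sum sg ?F = 0"
    proof (rule sum_sg_toggle[of _ v])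
      fix \<rho> assume \<rho>: "\<rho> \<in> ?F"
      show "finite \<rho>" using \<rho> finite_simplex by blast
      have "insert v \<rho> \<in> N" by (rule down[of "\<rho> \<union> \<tau>"]) (use \<rho> v in auto)
      moreover have "insert v \<rho> \<union> \<tau> = \<rho> \<union> \<tau>" using v by blast
      ultimately show "insert v \<rho> \<in> ?F" using \<rho> by (simp add: subset_insertI2)
      have "\<rho> - {v} \<in> N" by (rule down[of \<rho>]) (use \<rho> in auto)
      moreover have "(\<rho> - {v}) \<union> \<tau> = \<rho> \<union> \<tau>" using v by blast
      moreover have "\<sigma> \<subseteq> \<rho> - {v}" using \<rho> v by blast
      ultimately show "\<rho> - {v} \<in> ?F" using \<rho> by simp
    qed
    then show ?thesis using False by simp
  qed
  finally show ?thesis .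
qed

lemma duality':
  assumes "\<sigma> \<in> N" "\<tau> \<in> N"
  shows "(\<Sum>\<rho>\<in>N. of_bool (\<sigma> \<union> \<rho> \<in> N) * sg \<rho> * of_bool (\<tau> \<subseteq> \<rho>)) = eps * of_bool (\<sigma> \<subseteq> \<tau>)"
  using duality[OF assms(2,1)] by (simp add: mult.commute mult.left_commute Un_commute)

lemma moebius:
  assumes "\<sigma> \<in> N" "\<tau> \<in> N"
  shows "(\<Sum>\<rho>\<in>N. of_bool (\<sigma> \<subseteq> \<rho>) * sg \<rho> * of_bool (\<rho> \<subseteq> \<tau>)) = of_bool (\<sigma> = \<tau>) * sg \<tau>"
proof -
  let ?F = "{\<rho> \<in> N. \<sigma> \<subseteq> \<rho> \<and> \<rho> \<subseteq> \<tau>}"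
  have "(\<Sum>\<rho>\<in>N. of_bool (\<sigma> \<subseteq> \<rho>) * sg \<rho> * of_bool (\<rho> \<subseteq> \<tau>)) = sum sg ?F"
    by (rule sum_of_bool_filter) simp
  also have "\<dots> = of_bool (\<sigma> = \<tau>) * sg \<tau>"
  proof (cases "\<sigma> \<subseteq> \<tau> \<and> \<sigma> \<noteq> \<tau>")
    case True
    then obtain v where v: "v \<in> \<tau>" "v \<notin> \<sigma>" by blast
    have "?F = {\<rho>. \<sigma> \<subseteq> \<rho> \<and> \<rho> \<subseteq> \<tau>}" using down[OF assms(2)] by blast
    moreover have "sum sg {\<rho>. \<sigma> \<subseteq> \<rho> \<and> \<rho> \<subseteq> \<tau>} = 0"
      by (rule sum_sg_toggle[of _ v])
        (use v finite_subset[OF _ finite_simplex[OF assms(2)]] in auto)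
    ultimately have "sum sg ?F = 0" by simp
    then show ?thesis using True by simp
  next
    case False
    then have "?F = (if \<sigma> = \<tau> then {\<tau>} else {})" using assms by auto
    then show ?thesis by simp
  qed
  finally show ?thesis .
qed

text \<open>The row of the empty simplex in C \<Delta> J = (C \<Delta> E) \<Delta> C: duality leaves
  only the empty \<rho>. It yields the initial vector of the representation.\<close>

lemma J_column_sum:
  assumes "\<tau> \<in> N"
  shows "(\<Sum>\<sigma>\<in>N. sg \<sigma> * J \<sigma> \<tau>) = eps"
proof -
  \<comment> \<open>The trivial factor for the inclusion of {} is inserted so that
    \<open>duality\<close> applies with {} as its first simplex.\<close>
  have "(\<Sum>\<sigma>\<in>N. sg \<sigma> * J \<sigma> \<tau>)
      = (\<Sum>\<sigma>\<in>N. \<Sum>\<rho>\<in>N. of_bool ({} \<subseteq> \<sigma>) * sg \<sigma> * of_bool (\<sigma> \<union> \<rho> \<in> N) * (sg \<rho> * of_bool (\<rho> \<subseteq> \<tau>)))"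
    by (rule sum.cong[OF refl])
      (simp only: J_expand[OF _ assms] sum_distrib_left mult.assoc empty_subsetI of_bool_eq mult_1)
  also have "\<dots> = (\<Sum>\<rho>\<in>N. (\<Sum>\<sigma>\<in>N. of_bool ({} \<subseteq> \<sigma>) * sg \<sigma> * of_bool (\<sigma> \<union> \<rho> \<in> N)) * (sg \<rho> * of_bool (\<rho> \<subseteq> \<tau>)))"
    by (subst sum.swap) (simp only: sum_distrib_right)
  also have "\<dots> = (\<Sum>\<rho>\<in>N. if \<rho> = {} then eps else 0)"
    by (rule sum.cong[OF refl], subst duality) auto
  finally show ?thesis by simp
qed

text \<open>J \<Delta> J = E \<Delta> (C \<Delta> E) \<Delta> C. The two dualities replace the
  bracket by the transpose of C and then what precedes \<Delta> C by C itself, each at the cost of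
  one factor \<open>eps\<close>; Moebius inversion finishes.\<close>

lemma J_involution:
  assumes "\<sigma> \<in> N" "\<tau> \<in> N"
  shows "(\<Sum>\<rho>\<in>N. J \<sigma> \<rho> * sg \<rho> * J \<rho> \<tau>) = of_bool (\<sigma> = \<tau>) * sg \<tau>"
proof -
  let ?E = "\<lambda>\<sigma> \<rho>. of_bool (\<sigma> \<union> \<rho> \<in> N) :: rat" and ?C = "\<lambda>\<sigma> \<tau>. of_bool (\<sigma> \<subseteq> \<tau>) :: rat"
  have "(\<Sum>\<rho>\<in>N. J \<sigma> \<rho> * sg \<rho> * J \<rho> \<tau>) = (\<Sum>\<rho>\<in>N. \<Sum>a\<in>N. ?E \<sigma> a * sg a * ?C a \<rho> * sg \<rho> * J \<rho> \<tau>)"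
    by (rule sum.cong[OF refl]) (simp only: J_expand[OF assms(1)] sum_distrib_right)
  also have "\<dots> = (\<Sum>\<rho>\<in>N. \<Sum>a\<in>N. \<Sum>b\<in>N. ?E \<sigma> a * sg a * (?C a \<rho> * sg \<rho> * ?E \<rho> b) * (sg b * ?C b \<tau>))"
    by (rule sum.cong[OF refl], rule sum.cong[OF refl])
      (simp only: J_expand[OF _ assms(2)] sum_distrib_left mult.assoc)
  also have "\<dots> = (\<Sum>a\<in>N. \<Sum>b\<in>N. \<Sum>\<rho>\<in>N. ?E \<sigma> a * sg a * (?C a \<rho> * sg \<rho> * ?E \<rho> b) * (sg b * ?C b \<tau>))"
    by (subst sum.swap, rule sum.cong[OF refl], rule sum.swap)
  also have "\<dots> = (\<Sum>a\<in>N. \<Sum>b\<in>N. ?E \<sigma> a * sg a * (\<Sum>\<rho>\<in>N. ?C a \<rho> * sg \<rho> * ?E \<rho> b) * (sg b * ?C b \<tau>))"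
    by (simp only: sum_distrib_left sum_distrib_right)
  also have "\<dots> = (\<Sum>a\<in>N. \<Sum>b\<in>N. (?E \<sigma> a * sg a * ?C b a) * (eps * sg b * ?C b \<tau>))"
    by (intro sum.cong refl, subst duality) (simp_all only: mult_ac)
  also have "\<dots> = (\<Sum>b\<in>N. (\<Sum>a\<in>N. ?E \<sigma> a * sg a * ?C b a) * (eps * sg b * ?C b \<tau>))"
    by (subst sum.swap) (simp only: sum_distrib_right)
  also have "\<dots> = (\<Sum>b\<in>N. (eps * ?C \<sigma> b) * (eps * sg b * ?C b \<tau>))"
    by (intro sum.cong refl) (simp only: duality'[OF assms(1)])
  also have "\<dots> = (\<Sum>b\<in>N. ?C \<sigma> b * sg b * ?C b \<tau>)"
  proof (intro sum.cong refl)
    fix b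
    have "(eps * ?C \<sigma> b) * (eps * sg b * ?C b \<tau>) = (eps * eps) * (?C \<sigma> b * sg b * ?C b \<tau>)"
      by (simp only: mult_ac)
    then show "(eps * ?C \<sigma> b) * (eps * sg b * ?C b \<tau>) = ?C \<sigma> b * sg b * ?C b \<tau>"
      by (simp only: eps_eps mult_1)
  qed
  also have "\<dots> = of_bool (\<sigma> = \<tau>) * sg \<tau>" by (rule moebius[OF assms])
  finally show ?thesis .
qed

section \<open>Separating the empty simplex from the letters\<close>

lemma J_empty_left: "\<tau> \<in> N \<Longrightarrow> J {} \<tau> = of_bool (\<tau> = {})"
  using down[of \<tau>] by (auto simp: J_def independent_over_def)

lemma J_empty_right [simp]: "J \<sigma> {} = 1"
  by (simp add: J_def independent_over_def)

text \<open>The empty simplex is a state but not a letter. Removing its row and column from J leaves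
  transitions that all read a letter, as homogeneous linear entries require.\<close>

definition P :: "'a set \<Rightarrow> 'a set \<Rightarrow> rat" where
  "P \<sigma> \<tau> = (if \<sigma> = {} \<or> \<tau> = {} then 0 else J \<sigma> \<tau>)"

text \<open>Block diagonal: 1 at the empty simplex and -J \<Delta> on the nonempty ones. Both signs
  of the second block give an involution; the minus sign makes all row sums 1.\<close>

definition Gam :: "'a set \<Rightarrow> 'a set \<Rightarrow> rat" where
  "Gam \<sigma> \<tau> = (of_bool (\<sigma> = {} \<and> \<tau> = {}) - P \<sigma> \<tau>) * sg \<tau>"

lemma sum_split_empty: "(\<Sum>\<sigma>\<in>N. f \<sigma>) = f {} + (\<Sum>\<sigma>\<in>N-{{}}. f \<sigma>)"
  by (rule sum.remove) auto

lemma Gam_involution: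
  assumes "\<sigma> \<in> N" "\<tau> \<in> N"
  shows "(\<Sum>\<rho>\<in>N. Gam \<sigma> \<rho> * Gam \<rho> \<tau>) = of_bool (\<sigma> = \<tau>)"
proof (cases "\<sigma> = {} \<or> \<tau> = {}")
  case True
  then show ?thesis by (auto simp: sum_split_empty Gam_def P_def)
next
  case False
  have "(\<Sum>\<rho>\<in>N. Gam \<sigma> \<rho> * Gam \<rho> \<tau>) = (\<Sum>\<rho>\<in>N. J \<sigma> \<rho> * sg \<rho> * J \<rho> \<tau>) * sg \<tau>"
    using False assms
    by (simp add: sum_split_empty Gam_def P_def J_empty_left sum_distrib_left mult_ac)
  then show ?thesis by (simp add: J_involution assms)
qed

text \<open>\<open>J_involution\<close> at the column of the empty simplex, where J is constantly 1.
  It means that the final vector of ones is fixed by this matrix.\<close>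

lemma Gam_row_sum:
  assumes "\<sigma> \<in> N"
  shows "(\<Sum>\<tau>\<in>N. Gam \<sigma> \<tau>) = 1"
proof (cases "\<sigma> = {}")
  case True
  then show ?thesis by (auto simp: sum_split_empty Gam_def P_def)
next
  case False
  then show ?thesis using J_involution[OF assms, of "{}"]
    by (auto simp: sum_split_empty Gam_def P_def sum_negf eq_neg_iff_add_eq_0 algebra_simps)
qed

lemma Gam_P:
  assumes "\<sigma> \<in> N" "\<tau> \<in> N"
  shows "(\<Sum>\<rho>\<in>N. Gam \<sigma> \<rho> * P \<rho> \<tau>) * sg \<tau> = of_bool (\<sigma> = {} \<and> \<tau> = {}) - of_bool (\<sigma> = \<tau>)"
proof (cases "\<tau> = {}")
  case True
  then show ?thesis by (simp add: P_def)
next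
  case False
  then have "(\<Sum>\<rho>\<in>N. Gam \<sigma> \<rho> * P \<rho> \<tau>) * sg \<tau> = - (\<Sum>\<rho>\<in>N. Gam \<sigma> \<rho> * Gam \<rho> \<tau>)"
    by (simp add: Gam_def[of _ \<tau>] sum_distrib_right sum_negf mult.assoc)
  then show ?thesis using False Gam_involution[OF assms] by simp
qed

end

section \<open>Coefficients of Laurent series\<close>

lemma laurent_fun_coeff: "laurent_fun (coeff f)"
  using coeff[of f] by simp

lemma coeff_reduced: "coeff f w \<noteq> 0 \<Longrightarrow> reduced w"
  using laurent_fun_coeff[of f] unfolding laurent_fun_def free_group_def by fastforce

lemma laurent_eqI: "(\<And>w. reduced w \<Longrightarrow> coeff f w = coeff g w) \<Longrightarrow> f = g"
  using coeff_reduced[of f] coeff_reduced[of g] by (metis coeff_inject ext)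

lemma coeff_add [simp]: "coeff (f + g) w = coeff f w + coeff g w"
  and coeff_diff [simp]: "coeff (f - g) w = coeff f w - coeff g w"
  and coeff_zero [simp]: "coeff 0 w = 0"
  and coeff_one: "coeff 1 w = (if w = [] then 1 else 0)"
  by (simp_all add: plus_laurent.rep_eq minus_laurent.rep_eq zero_laurent.rep_eq one_laurent.rep_eq)

lemma coeff_sum [simp]: "coeff (\<Sum>i\<in>I. f i) w = (\<Sum>i\<in>I. coeff (f i) w)"
  by (induction I rule: infinite_finite_induct) auto

text \<open>On reduced words, pushing \<open>x\<close> is a bijection whose inverse pushes the
  inverse letter, so the convolution has at most one term.\<close>

lemma coeff_single_mult:
  assumes "coeff f = (\<lambda>w. if w = [x] then 1 else 0)"
  shows "coeff (f * g) w = (if reduced w then coeff g (push (inv_letter x) w) else 0)"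
proof -
  let ?F = "{(u, v). coeff f u \<noteq> 0 \<and> coeff g v \<noteq> 0 \<and> free_mult u v = w}"
  have F: "?F = {(u, v). u = [x] \<and> coeff g v \<noteq> 0 \<and> push x v = w}"
    by (auto simp: assms free_mult_def split: if_splits)
  have inv: "push (inv_letter x) (push x v) = v" "reduced (push x v)" if "coeff g v \<noteq> 0" for v
    using push_push_inv[of v "inv_letter x"] coeff_reduced[OF that] reduced_push[of v x] by auto
  have "?F = (if reduced w \<and> coeff g (push (inv_letter x) w) \<noteq> 0
      then {([x], push (inv_letter x) w)} else {})"
    unfolding F by (auto simp: inv push_push_inv)
  then show ?thesis by (simp add: times_laurent.rep_eq convolution_def assms)
qed

lemma coeff_letter_mult:
  "coeff (letter a * f) w = (if reduced w then coeff f (push (a, False) w) else 0)"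
  using coeff_single_mult[of "letter a" "(a, True)"] by (simp add: letter.rep_eq inv_letter_def)

lemma coeff_letter_inv_mult:
  "coeff (letter_inv a * f) w = (if reduced w then coeff f (push (a, True) w) else 0)"
  using coeff_single_mult[of "letter_inv a" "(a, False)"] by (simp add: letter_inv.rep_eq inv_letter_def)

lemma coeff_const_mult [simp]: "coeff (const r * f) w = r * coeff f w"
proof -
  have "{(u, v). coeff (const r) u \<noteq> 0 \<and> coeff f v \<noteq> 0 \<and> free_mult u v = w}
      = (if r * coeff f w = 0 then {} else {([], w)})"
    by (auto simp: const.rep_eq split: if_splits)
  then show ?thesis by (simp add: times_laurent.rep_eq convolution_def const.rep_eq)
qed

lemma coeff_mult_const [simp]: "coeff (f * const r) w = r * coeff f w"
proof -
  have "free_mult u [] = u" if "coeff f u \<noteq> 0" for u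
    using that coeff_reduced free_mult_Nil_right by blast
  then have "{(u, v). coeff f u \<noteq> 0 \<and> coeff (const r) v \<noteq> 0 \<and> free_mult u v = w}
      = (if r * coeff f w = 0 then {} else {(w, [])})"
    by (auto simp: const.rep_eq split: if_splits)
  then show ?thesis by (simp add: times_laurent.rep_eq convolution_def const.rep_eq)
qed

lemma const_commute: "const r * f = f * const r"
  by (rule laurent_eqI) simp

lemma const_0 [simp]: "const 0 = 0" and const_1 [simp]: "const 1 = 1"
  and const_add: "const (r + s) = const r + const s"
  and const_diff: "const (r - s) = const r - const s"
  and const_mult: "const (r * s) = const r * const s"
  by (rule laurent_eqI; simp add: const.rep_eq coeff_one)+

lemma const_sum: "const (\<Sum>i\<in>I. r i) = (\<Sum>i\<in>I. const (r i))"
  by (induction I rule: infinite_finite_induct) (auto simp: const_add)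

lemma coeff_mult_nonzero:
  assumes "coeff (f * g) w \<noteq> 0"
  obtains u v where "coeff f u \<noteq> 0" "coeff g v \<noteq> 0" "free_mult u v = w"
proof -
  have "{(u, v). coeff f u \<noteq> 0 \<and> coeff g v \<noteq> 0 \<and> free_mult u v = w} \<noteq> {}"
    using assms unfolding times_laurent.rep_eq convolution_def by (metis (no_types, lifting) sum.empty)
  then show thesis using that by blast
qed

lemma laurent_series_mult:
  assumes "f \<in> laurent_series A" "g \<in> laurent_series A"
  shows "f * g \<in> laurent_series A"
  unfolding laurent_series_def
proof (intro CollectI allI impI)
  fix w assume "coeff (f * g) w \<noteq> 0"
  then obtain u v where "coeff f u \<noteq> 0" "coeff g v \<noteq> 0" "free_mult u v = w"
    by (rule coeff_mult_nonzero)
  then show "w \<in> carrier (free_group A)"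
    using assms free_mult_in_carrier[of u A v] by (simp add: laurent_series_def)
qed

lemma laurent_series_add:
  assumes "f \<in> laurent_series A" "g \<in> laurent_series A"
  shows "f + g \<in> laurent_series A"
  unfolding laurent_series_def
proof (intro CollectI allI impI)
  fix w assume "coeff (f + g) w \<noteq> 0"
  then have "coeff f w \<noteq> 0 \<or> coeff g w \<noteq> 0" by auto
  then show "w \<in> carrier (free_group A)" using assms unfolding laurent_series_def mem_Collect_eq by blast
qed

lemma laurent_series_sum:
  "(\<And>i. i \<in> I \<Longrightarrow> f i \<in> laurent_series A) \<Longrightarrow> (\<Sum>i\<in>I. f i) \<in> laurent_series A"
proof (induction I rule: infinite_finite_induct)
  case (insert i I)
  then show ?case by (simp add: laurent_series_add)
qed (simp_all add: laurent_series_def)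

lemma const_laurent_series: "const r \<in> laurent_series A"
  by (simp add: laurent_series_def const.rep_eq free_group_def)

lemma set_free_mult: "set (free_mult u v) \<subseteq> set u \<union> set v"
  unfolding free_mult_def
proof (induction u)
  case (Cons x u)
  then show ?case using set_push[of x "foldr push u v"] by auto
qed simp

lemma power_series_mult:
  assumes "f \<in> power_series A" "g \<in> power_series A"
  shows "f * g \<in> power_series A"
  unfolding power_series_def
proof (intro CollectI allI impI)
  fix w assume "coeff (f * g) w \<noteq> 0"
  then obtain u v where uv: "coeff f u \<noteq> 0" "coeff g v \<noteq> 0" "free_mult u v = w"
    by (rule coeff_mult_nonzero)
  then have "set u \<union> set v \<subseteq> A \<times> {True}" using assms unfolding power_series_def by blast
  then show "set w \<subseteq> A \<times> {True}" using set_free_mult[of u v] uv(3) by blast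
qed

lemma power_series_add:
  assumes "f \<in> power_series A" "g \<in> power_series A"
  shows "f + g \<in> power_series A"
  unfolding power_series_def
proof (intro CollectI allI impI)
  fix w assume "coeff (f + g) w \<noteq> 0"
  then have "coeff f w \<noteq> 0 \<or> coeff g w \<noteq> 0" by auto
  then show "set w \<subseteq> A \<times> {True}" using assms unfolding power_series_def mem_Collect_eq by blast
qed

lemma power_series_diff:
  assumes "f \<in> power_series A" "g \<in> power_series A"
  shows "f - g \<in> power_series A"
  unfolding power_series_def
proof (intro CollectI allI impI)
  fix w assume "coeff (f - g) w \<noteq> 0"
  then have "coeff f w \<noteq> 0 \<or> coeff g w \<noteq> 0" by auto
  then show "set w \<subseteq> A \<times> {True}" using assms unfolding power_series_def mem_Collect_eq by blast
qed

lemma power_series_sum: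
  "(\<And>i. i \<in> I \<Longrightarrow> f i \<in> power_series A) \<Longrightarrow> (\<Sum>i\<in>I. f i) \<in> power_series A"
proof (induction I rule: infinite_finite_induct)
  case (insert i I)
  then show ?case by (simp add: power_series_add)
qed (simp_all add: power_series_def)

lemma const_power_series: "const r \<in> power_series A"
  by (simp add: power_series_def const.rep_eq)

lemma letter_power_series: "a \<in> A \<Longrightarrow> letter a \<in> power_series A"
  by (simp add: power_series_def letter.rep_eq)

lemma power_series_coeff_neg: "f \<in> power_series A \<Longrightarrow> coeff f ((a, False) # w) = 0"
  by (auto simp: power_series_def)

lemma power_series_subset: "power_series A \<subseteq> laurent_series A"
  unfolding power_series_def laurent_series_def free_group_def using coeff_reduced by fastforce

lemma power_series_eqI:
  assumes "f \<in> power_series A" "g \<in> power_series A"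
    and "\<And>\<alpha>. set \<alpha> \<subseteq> A \<Longrightarrow> coeff f (pos_word \<alpha>) = coeff g (pos_word \<alpha>)"
  shows "f = g"
proof (rule laurent_eqI)
  fix w
  show "coeff f w = coeff g w"
  proof (cases "set w \<subseteq> A \<times> {True}")
    case True
    then have "w = pos_word (map fst w)" by (force simp: pos_word_def intro!: map_idI[symmetric])
    moreover have "set (map fst w) \<subseteq> A" using True by auto
    ultimately show ?thesis using assms(3) by metis
  next
    case False
    then show ?thesis using assms(1,2) unfolding power_series_def by force
  qed
qed

lemma coeff_letter_mult_pos_word:
  assumes "f \<in> power_series A"
  shows "coeff (letter b * f) (pos_word \<alpha>) = (case \<alpha> of [] \<Rightarrow> 0 | a # \<beta> \<Rightarrow> if a = b then coeff f (pos_word \<beta>) else 0)"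
proof (cases \<alpha>)
  case Nil
  then show ?thesis
    using power_series_coeff_neg[OF assms, of b "[]"] by (simp add: coeff_letter_mult pos_word_def)
next
  case (Cons a \<beta>)
  have "reduced ((a, True) # pos_word \<beta>)" using reduced_pos_word[of "a # \<beta>"] by (simp add: pos_word_def)
  then show ?thesis
    using power_series_coeff_neg[OF assms, of b "(a, True) # pos_word \<beta>"] Cons
    by (simp add: coeff_letter_mult pos_word_def inv_letter_def)
qed

lemma linear_form_eq:
  assumes "finite A" "q \<in> linear_forms A"
  shows "q = (\<Sum>a\<in>A. const (coeff q [(a, True)]) * letter a)"
proof -
  obtain c where q: "q = (\<Sum>a\<in>A. const (c a) * letter a)"
    using assms(2) by (auto simp: linear_forms_def)
  have "coeff q [(a, True)] = c a" if "a \<in> A" for a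
    using that assms(1) by (simp add: q letter.rep_eq sum.delta flip: of_bool_def)
  then show ?thesis by (subst q) (intro sum.cong, auto)
qed

section \<open>Finite permutation representations of the free group\<close>

definition swap_letter :: "'x \<Rightarrow> 'x \<times> bool \<Rightarrow> 'x \<times> bool" where
  "swap_letter a x = (if fst x = a then inv_letter x else x)"

text \<open>Left multiplication by a letter on the reduced words of length at most \<open>n\<close>, completed to a
  permutation: where the product would become too long, the letter is exchanged with its inverse
  throughout the word.\<close>

definition ball_act :: "nat \<Rightarrow> 'x \<times> bool \<Rightarrow> 'x word \<Rightarrow> 'x word" where
  "ball_act n x w = (if w \<noteq> [] \<and> hd w = inv_letter x then tl w
     else if length w < n then x # w else map (swap_letter (fst x)) w)"

definition word_ball :: "'x set \<Rightarrow> nat \<Rightarrow> 'x word set" where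
  "word_ball A n = {w \<in> carrier (free_group A). length w \<le> n}"

lemma swap_letter_swap [simp]: "swap_letter a (swap_letter a x) = x"
  and fst_swap_letter [simp]: "fst (swap_letter a x) = fst x"
  by (simp_all add: swap_letter_def)

lemma swap_letter_inv: "swap_letter a (inv_letter x) = inv_letter (swap_letter a x)"
  by (simp add: swap_letter_def)

lemma inv_letter_neq [simp]: "inv_letter x \<noteq> x" "x \<noteq> inv_letter x"
  by (auto simp: inv_letter_def prod_eq_iff)

lemma reduced_Cons: "reduced (x # w) \<longleftrightarrow> reduced w \<and> (w = [] \<or> hd w \<noteq> inv_letter x)"
  by (cases w) (auto simp: reduced_def)

lemma reduced_swap: "reduced w \<Longrightarrow> reduced (map (swap_letter a) w)"
  unfolding reduced_def successively_map
  by (erule successively_mono) (metis swap_letter_inv swap_letter_swap)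

lemma finite_word_ball: "finite A \<Longrightarrow> finite (word_ball A n)"
  by (rule finite_subset[OF _ finite_lists_length_le[of "A \<times> UNIV" n]])
     (auto simp: word_ball_def free_group_def)

lemma Nil_word_ball: "[] \<in> word_ball A n"
  by (simp add: word_ball_def free_group_def)

lemma ball_act_closed:
  assumes "w \<in> word_ball A n" "fst x \<in> A"
  shows "ball_act n x w \<in> word_ball A n"
proof (cases w)
  case Nil
  then show ?thesis using assms by (auto simp: ball_act_def word_ball_def free_group_def reduced_def)
next
  case (Cons y ys)
  have "reduced (map (swap_letter (fst x)) w)"
    using assms reduced_swap by (auto simp: word_ball_def free_group_def)
  then show ?thesis
    using assms Cons by (auto simp: ball_act_def word_ball_def free_group_def reduced_Cons)
qed

text \<open>Shortening by \<open>x\<close> is undone by lengthening with its inverse and conversely,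
  and an exchange of letters undoes itself. Reducedness prevents a second cancellation after a
  shortening.\<close>

lemma ball_act_inverse:
  assumes "w \<in> word_ball A n"
  shows "ball_act n (inv_letter x) (ball_act n x w) = w"
proof (cases w)
  case Nil
  then show ?thesis by (auto simp: ball_act_def)
next
  case (Cons y ys)
  have red: "reduced (y # ys)" "length ys < n"
    using assms Cons by (auto simp: word_ball_def free_group_def)
  \<comment> \<open>This keeps the exchange case separate: if the old first letter does not cancel
    against \<open>x\<close>, the exchanged one does not cancel against the inverse of
    \<open>x\<close>.\<close>
  have sw: "swap_letter (fst x) y = x \<longleftrightarrow> y = inv_letter x"
    by (metis fst_inv_letter inv_letter_inv_letter swap_letter_def swap_letter_swap)
  consider "y = inv_letter x" | "y \<noteq> inv_letter x" "length w < n" | "y \<noteq> inv_letter x" "\<not> length w < n"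
    by blast
  then show ?thesis
  proof cases
    case 1
    then have "ball_act n x w = ys" by (simp add: Cons ball_act_def)
    moreover have "\<not> (ys \<noteq> [] \<and> hd ys = inv_letter (inv_letter x))"
      using red(1) 1 by (auto simp: reduced_Cons)
    ultimately show ?thesis using red(2) 1 by (simp only: ball_act_def if_False if_True Cons)
  next
    case 2
    then have "ball_act n x w = x # w" by (simp add: Cons ball_act_def)
    then show ?thesis by (simp add: ball_act_def)
  next
    case 3
    then have "ball_act n x w = map (swap_letter (fst x)) w" by (simp add: Cons ball_act_def)
    then show ?thesis using 3 sw by (simp add: ball_act_def Cons comp_def)
  qed
qed

definition word_act :: "nat \<Rightarrow> 'x word \<Rightarrow> 'x word \<Rightarrow> 'x word" where
  "word_act n w y = foldr (ball_act n) w y"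

lemma word_act_Nil [simp]: "word_act n [] y = y"
  and word_act_Cons [simp]: "word_act n (x # w) y = ball_act n x (word_act n w y)"
  by (simp_all add: word_act_def)

lemma word_act_closed:
  "y \<in> word_ball A n \<Longrightarrow> fst ` set w \<subseteq> A \<Longrightarrow> word_act n w y \<in> word_ball A n"
  by (induction w) (auto intro: ball_act_closed)

lemma word_act_push:
  assumes "y \<in> word_ball A n" "fst ` set w \<subseteq> A"
  shows "word_act n (push x w) y = ball_act n x (word_act n w y)"
proof (cases w)
  case (Cons z zs)
  have "word_act n zs y \<in> word_ball A n" using assms Cons by (intro word_act_closed) auto
  then show ?thesis using ball_act_inverse[of "word_act n zs y" A n "inv_letter x"] Cons by auto
qed simp

text \<open>The orbit of the empty word tells all reduced words of length at most \<open>n\<close>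
  apart.\<close>

lemma word_act_short: "reduced w \<Longrightarrow> length w \<le> n \<Longrightarrow> word_act n w [] = w"
proof (induction w)
  case (Cons x w)
  then show ?case by (auto simp: reduced_Cons ball_act_def)
qed simp

section \<open>Uniqueness of the reciprocal\<close>

text \<open>Push-forward of the coefficients along the map that sends a word to its image of [] and
  its exponent sum \<open>e\<close>. Recording \<open>e\<close> keeps the sums finite: if the order
  is at least p, the words in the support have length at most e - 2p.\<close>

definition ball_image :: "nat \<Rightarrow> 'x laurent \<Rightarrow> 'x word \<Rightarrow> int \<Rightarrow> rat" where
  "ball_image n f x e = (\<Sum>w | coeff f w \<noteq> 0 \<and> word_act n w [] = x \<and> exponent_sum w = e. coeff f w)"

lemma exponent_sum_push: "exponent_sum (push x w) = (if snd x then 1 else - 1) + exponent_sum w"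
  using exponent_sum_free_mult[of "[x]" w] by (simp add: free_mult_def exponent_sum_def)

lemma support_bounded:
  obtains A p where "finite A" "{w. coeff f w \<noteq> 0} \<subseteq> bounded_words A p"
  using laurent_fun_coeff[of f] unfolding laurent_fun_iff by blast

lemma exponent_sum_bounded_words:
  assumes "w \<in> bounded_words A p"
  shows "exponent_sum w \<ge> 2 * p" "int (length w) \<le> exponent_sum w - 2 * p"
  using assms by (auto simp: bounded_words_def exponent_sum_length)

lemma length_bounded:
  obtains n where "\<And>w. coeff f w \<noteq> 0 \<Longrightarrow> exponent_sum w = e \<Longrightarrow> length w \<le> n"
proof -
  obtain A p where A: "{w. coeff f w \<noteq> 0} \<subseteq> bounded_words A p" by (rule support_bounded)
  show thesis
  proof (rule that[of "nat (e - 2 * p)"])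
    fix w assume "coeff f w \<noteq> 0" "exponent_sum w = e"
    then have "int (length w) \<le> e - 2 * p" using A exponent_sum_bounded_words(2)[of w A p] by auto
    then show "length w \<le> nat (e - 2 * p)" by linarith
  qed
qed

lemma finite_level: "finite {w. coeff f w \<noteq> 0 \<and> exponent_sum w = e}"
proof -
  obtain A p where A: "finite A" "{w. coeff f w \<noteq> 0} \<subseteq> bounded_words A p" by (rule support_bounded)
  obtain n where n: "\<And>w. coeff f w \<noteq> 0 \<Longrightarrow> exponent_sum w = e \<Longrightarrow> length w \<le> n"
    using length_bounded[of f e] by blast
  have "{w. coeff f w \<noteq> 0 \<and> exponent_sum w = e} \<subseteq> word_ball A n"
    using A n by (auto simp: word_ball_def bounded_words_def)
  then show ?thesis using finite_word_ball[OF A(1)] finite_subset by blast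
qed

lemma ball_image_eq:
  assumes "finite F" "{w. coeff f w \<noteq> 0 \<and> word_act n w [] = x \<and> exponent_sum w = e} \<subseteq> F"
    "F \<subseteq> {w. word_act n w [] = x \<and> exponent_sum w = e}"
  shows "ball_image n f x e = (\<Sum>w\<in>F. coeff f w)"
  unfolding ball_image_def using assms by (intro sum.mono_neutral_left) auto

lemma ball_image_add: "ball_image n (f + g) x e = ball_image n f x e + ball_image n g x e"
proof -
  let ?F = "{w. (coeff f w \<noteq> 0 \<or> coeff g w \<noteq> 0) \<and> word_act n w [] = x \<and> exponent_sum w = e}"
  have "?F \<subseteq> {w. coeff f w \<noteq> 0 \<and> exponent_sum w = e} \<union> {w. coeff g w \<noteq> 0 \<and> exponent_sum w = e}"
    by auto
  then have "finite ?F" by (rule finite_subset) (simp add: finite_level)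
  then have "ball_image n h x e = (\<Sum>w\<in>?F. coeff h w)" if "h \<in> {f, g, f + g}" for h
    using that by (intro ball_image_eq) auto
  then show ?thesis by (simp add: sum.distrib)
qed

lemma ball_image_zero: "ball_image n 0 x e = 0"
  by (simp add: ball_image_def)

lemma ball_image_sum: "ball_image n (\<Sum>i\<in>I. f i) x e = (\<Sum>i\<in>I. ball_image n (f i) x e)"
  by (induction I rule: infinite_finite_induct) (auto simp: ball_image_zero ball_image_add)

lemma ball_image_const_mult: "ball_image n (const r * f) x e = r * ball_image n f x e"
proof (cases "r = 0")
  case False
  then show ?thesis by (simp add: ball_image_def sum_distrib_left)
qed (simp add: ball_image_zero)

lemma ball_image_const: "ball_image n (const r) x e = (if x = [] \<and> e = 0 then r else 0)"
proof -
  have "{w. coeff (const r) w \<noteq> 0 \<and> word_act n w [] = x \<and> exponent_sum w = e} =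
      (if r \<noteq> 0 \<and> x = [] \<and> e = 0 then {[]} else {})"
    by (auto simp: const.rep_eq exponent_sum_def)
  then show ?thesis by (simp add: ball_image_def const.rep_eq)
qed

text \<open>The coefficient of the product at w is that of \<open>f\<close> at a w. The word a w
  carries [] to the image of \<open>x\<close> under a and has exponent sum one larger.\<close>

lemma ball_image_letter_inv:
  assumes "f \<in> laurent_series A" "a \<in> A" "x \<in> word_ball A n"
  shows "ball_image n (letter_inv a * f) x e = ball_image n f (ball_act n (a, True) x) (e + 1)"
  unfolding ball_image_def
proof (rule sum.reindex_bij_witness[of _ "push (a, False)" "push (a, True)"])
  have inv: "inv_letter (a, True) = (a, False)" "inv_letter (a, False) = (a, True)"
    by (simp_all add: inv_letter_def)
  have fs: "fst ` set w \<subseteq> A" "reduced w" if "coeff f w \<noteq> 0" for w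
    using assms(1) that by (auto simp: laurent_series_def free_group_def)
  have ps: "fst ` set (push y w) \<subseteq> A" if "fst y = a" "fst ` set w \<subseteq> A" for y w
    using set_push[of y w] that assms(2) by auto
  {
    fix w assume w: "w \<in> {w. coeff (letter_inv a * f) w \<noteq> 0 \<and> word_act n w [] = x \<and> exponent_sum w = e}"
    then have red: "reduced w" and c: "coeff f (push (a, True) w) \<noteq> 0"
      by (auto simp: coeff_letter_inv_mult split: if_splits)
    show eq: "push (a, False) (push (a, True) w) = w"
      using push_push_inv[OF red, of "(a, False)"] by (simp add: inv)
    have "fst ` set w \<subseteq> A" using ps[of "(a, False)" "push (a, True) w"] fs[OF c] eq by simp
    then have "word_act n (push (a, True) w) [] = ball_act n (a, True) x"
      using word_act_push[OF Nil_word_ball, of w A n "(a, True)"] w by simp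
    then show "push (a, True) w \<in> {w. coeff f w \<noteq> 0 \<and> word_act n w [] = ball_act n (a, True) x \<and>
        exponent_sum w = e + 1}"
      using c w by (simp add: exponent_sum_push)
    show "coeff f (push (a, True) w) = coeff (letter_inv a * f) w"
      using red by (simp add: coeff_letter_inv_mult)
  }
  fix w assume w: "w \<in> {w. coeff f w \<noteq> 0 \<and> word_act n w [] = ball_act n (a, True) x \<and>
      exponent_sum w = e + 1}"
  then have red: "reduced w" and A: "fst ` set w \<subseteq> A" using fs by auto
  show eq: "push (a, True) (push (a, False) w) = w"
    using push_push_inv[OF red, of "(a, True)"] by (simp add: inv)
  have "word_act n (push (a, False) w) [] = ball_act n (a, False) (ball_act n (a, True) x)"
    using word_act_push[OF Nil_word_ball A, of n "(a, False)"] w by simp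
  then have "word_act n (push (a, False) w) [] = x"
    using ball_act_inverse[OF assms(3), of "(a, True)"] by (simp add: inv)
  then show "push (a, False) w \<in> {w. coeff (letter_inv a * f) w \<noteq> 0 \<and> word_act n w [] = x \<and>
      exponent_sum w = e}"
    using w red eq by (simp add: exponent_sum_push coeff_letter_inv_mult reduced_push)
qed

text \<open>If the ball contains all support words with the exponent sum of \<open>v\<close>, then
  \<open>v\<close> is the only one of them that carries [] to \<open>v\<close>.\<close>

lemma ball_image_coeff:
  assumes "\<And>w. coeff f w \<noteq> 0 \<Longrightarrow> exponent_sum w = exponent_sum v \<Longrightarrow> length w \<le> n"
    and "reduced v" "length v \<le> n"
  shows "ball_image n f v (exponent_sum v) = coeff f v"
proof -
  have "ball_image n f v (exponent_sum v) = (\<Sum>w\<in>{v}. coeff f w)"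
  proof (rule ball_image_eq)
    show "{w. coeff f w \<noteq> 0 \<and> word_act n w [] = v \<and> exponent_sum w = exponent_sum v} \<subseteq> {v}"
      using assms(1) coeff_reduced word_act_short by fastforce
  qed (use assms word_act_short in auto)
  then show ?thesis by simp
qed

lemma ball_image_bounded_below:
  obtains b where "\<And>x e. e < b \<Longrightarrow> ball_image n f x e = 0"
proof -
  obtain A p where A: "{w. coeff f w \<noteq> 0} \<subseteq> bounded_words A p" by (rule support_bounded)
  show thesis
  proof (rule that[of "2 * p"])
    fix x and e :: int assume "e < 2 * p"
    moreover have "exponent_sum w \<ge> 2 * p" if "coeff f w \<noteq> 0" for w
      using A that exponent_sum_bounded_words(1) by blast
    ultimately have "{w. coeff f w \<noteq> 0 \<and> word_act n w [] = x \<and> exponent_sum w = e} = {}"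
      by fastforce
    then show "ball_image n f x e = 0" by (simp only: ball_image_def sum.empty)
  qed
qed

section \<open>Linear dependence and recurrences\<close>

lemma linear_dependence:
  fixes F :: "'i \<Rightarrow> 'j \<Rightarrow> 'f :: field"
  assumes "finite I" "finite K" "card I < card K"
  shows "\<exists>c. (\<exists>i\<in>K. c i \<noteq> 0) \<and> (\<forall>x\<in>I. (\<Sum>i\<in>K. c i * F i x) = 0)"
  using assms
proof (induction I arbitrary: K F rule: finite_induct)
  case empty
  then have "K \<noteq> {}" by auto
  then show ?case by (intro exI[of _ "\<lambda>_. 1"]) auto
next
  case (insert y I)
  show ?case
  proof (cases "\<forall>i\<in>K. F i y = 0")
    case True
    then show ?thesis using insert.IH[of K F] insert.prems insert.hyps by auto
  next
    case False
    then obtain p where p: "p \<in> K" "F p y \<noteq> 0" by blast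
    \<comment> \<open>Gaussian elimination with pivot \<open>p\<close>: subtracting this multiple of
      \<open>F p\<close> clears the coordinate \<open>y\<close>.\<close>
    define r where "r i = F i y / F p y" for i
    have "card I < card (K - {p})" using insert p by (simp add: card_Diff_singleton)
    then obtain c where c: "\<exists>i\<in>K - {p}. c i \<noteq> 0"
      "\<forall>x\<in>I. (\<Sum>i\<in>K - {p}. c i * (F i x - r i * F p x)) = 0"
      using insert.IH[of "K - {p}" "\<lambda>i x. F i x - r i * F p x"] insert.prems by auto
    \<comment> \<open>The coefficient at the pivot gathers all the multiples of \<open>F p\<close>
      that were subtracted.\<close>
    define d where "d i = (if i = p then - (\<Sum>i\<in>K - {p}. c i * r i) else c i)" for i
    have eq: "(\<Sum>i\<in>K. d i * F i x) = (\<Sum>i\<in>K - {p}. c i * (F i x - r i * F p x))" for x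
    proof -
      have "(\<Sum>i\<in>K. d i * F i x) = d p * F p x + (\<Sum>i\<in>K - {p}. d i * F i x)"
        using insert.prems p by (simp add: sum.remove)
      also have "(\<Sum>i\<in>K - {p}. d i * F i x) = (\<Sum>i\<in>K - {p}. c i * F i x)"
        by (rule sum.cong) (auto simp: d_def)
      also have "d p * F p x = - (\<Sum>i\<in>K - {p}. c i * (r i * F p x))"
        by (simp add: d_def) (simp only: sum_distrib_right mult.assoc)
      finally show ?thesis by (simp only: right_diff_distrib sum_subtractf) simp
    qed
    have "F i y - r i * F p y = 0" for i using p by (simp add: r_def)
    then have "(\<Sum>i\<in>K. d i * F i y) = 0" by (simp only: eq mult_zero_right sum.neutral_const)
    then have "\<forall>x\<in>insert y I. (\<Sum>i\<in>K. d i * F i x) = 0" using c(2) by (simp add: eq)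
    moreover have "\<exists>i\<in>K. d i \<noteq> 0" using c(1) by (auto simp: d_def)
    ultimately show ?thesis by (intro exI[of _ d] conjI)
  qed
qed

text \<open>Take the smallest i0 with a nonzero coefficient and the first argument x with a nonzero
  value, which exists by the bound below. In the recurrence at x + i0 the terms before i0 vanish by
  their coefficients and those after it by their values.\<close>

lemma recurrence_zero:
  fixes \<mu> :: "int \<Rightarrow> 'f :: field"
  assumes "i \<le> d" "c i \<noteq> 0" "\<And>e. (\<Sum>i\<le>d. c i * \<mu> (e - int i)) = 0" "\<And>e. e < b \<Longrightarrow> \<mu> e = 0"
  shows "\<mu> e = 0"
proof (rule ccontr)
  assume "\<mu> e \<noteq> 0"
  define i0 where "i0 = (LEAST i. c i \<noteq> 0)"
  have i0: "c i0 \<noteq> 0" "i0 \<le> i"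
    unfolding i0_def by (rule LeastI[of "\<lambda>i. c i \<noteq> 0", OF assms(2)], rule Least_le[of "\<lambda>i. c i \<noteq> 0", OF assms(2)])
  have below: "c j = 0" if "j < i0" for j
    using not_less_Least[OF that[unfolded i0_def]] by simp
  define q where "q = (LEAST q. \<mu> (b + int q) \<noteq> 0)"
  have "e \<ge> b" using assms(4) \<open>\<mu> e \<noteq> 0\<close> by force
  then have "\<mu> (b + int (nat (e - b))) \<noteq> 0" using \<open>\<mu> e \<noteq> 0\<close> by simp
  then have q: "\<mu> (b + int q) \<noteq> 0"
    unfolding q_def by (rule LeastI[of "\<lambda>q. \<mu> (b + int q) \<noteq> 0"])
  have q': "\<mu> (b + int j) = 0" if "j < q" for j
    using not_less_Least[OF that[unfolded q_def]] by simp
  have lt: "\<mu> x = 0" if "x < b + int q" for x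
  proof (cases "x < b")
    case False
    then show ?thesis using q'[of "nat (x - b)"] that by simp
  qed (rule assms(4))
  have "0 = (\<Sum>j\<le>d. c j * \<mu> (b + int q + int i0 - int j))" using assms(3) by metis
  also have "\<dots> = (\<Sum>j\<in>{i0}. c j * \<mu> (b + int q + int i0 - int j))"
  proof (rule sum.mono_neutral_right)
    show "\<forall>j\<in>{..d} - {i0}. c j * \<mu> (b + int q + int i0 - int j) = 0"
    proof
      fix j assume "j \<in> {..d} - {i0}"
      then consider "j < i0" | "j > i0" by force
      then show "c j * \<mu> (b + int q + int i0 - int j) = 0"
        by cases (use below lt in auto)
    qed
  qed (use i0 assms(1) in auto)
  finally show False using i0 q by simp
qed

text \<open>For \<alpha> = a b ... this is the row vector r Q_a Q_b ...; \<open>col_word\<close> is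
  the column Q_a Q_b ... v. The row form suits iteration from the left, the column form suits
  stripping the first letter of a coefficient.\<close>

primrec row_word :: "nat \<Rightarrow> ('x \<Rightarrow> nat \<Rightarrow> nat \<Rightarrow> rat) \<Rightarrow> (nat \<Rightarrow> rat) \<Rightarrow> 'x list \<Rightarrow> nat \<Rightarrow> rat" where
  "row_word n Q r [] = r"
| "row_word n Q r (a # \<alpha>) = row_word n Q (\<lambda>j. \<Sum>k<n. r k * Q a k j) \<alpha>"

primrec col_word :: "nat \<Rightarrow> ('x \<Rightarrow> nat \<Rightarrow> nat \<Rightarrow> rat) \<Rightarrow> (nat \<Rightarrow> rat) \<Rightarrow> 'x list \<Rightarrow> nat \<Rightarrow> rat" where
  "col_word n Q v [] = v"
| "col_word n Q v (a # \<alpha>) = (\<lambda>k. \<Sum>j<n. Q a k j * col_word n Q v \<alpha> j)"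

lemma row_word_col_word:
  "(\<Sum>k<n. row_word n Q r \<alpha> k * v k) = (\<Sum>k<n. r k * col_word n Q v \<alpha> k)"
proof (induction \<alpha> arbitrary: r)
  case (Cons a \<alpha>)
  have "(\<Sum>k<n. row_word n Q r (a # \<alpha>) k * v k) = (\<Sum>j<n. \<Sum>k<n. r k * Q a k j * col_word n Q v \<alpha> j)"
    by (simp add: Cons sum_distrib_right)
  also have "\<dots> = (\<Sum>k<n. r k * col_word n Q v (a # \<alpha>) k)"
    by (subst sum.swap) (simp add: sum_distrib_left mult.assoc)
  finally show ?case .
qed simp

section \<open>Iterating the barred system\<close>

definition words :: "'x set \<Rightarrow> nat \<Rightarrow> 'x list set" where
  "words A i = {\<alpha>. set \<alpha> \<subseteq> A \<and> length \<alpha> = i}"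

lemma words_0 [simp]: "words A 0 = {[]}"
  by (auto simp: words_def)

lemma sum_words_Suc:
  assumes "finite A"
  shows "(\<Sum>\<alpha>\<in>words A (Suc i). f \<alpha>) = (\<Sum>a\<in>A. \<Sum>\<alpha>\<in>words A i. f (a # \<alpha>))"
proof -
  have "(\<Sum>a\<in>A. \<Sum>\<alpha>\<in>words A i. f (a # \<alpha>)) = (\<Sum>(a, \<alpha>)\<in>A \<times> words A i. f (a # \<alpha>))"
    by (simp add: sum.cartesian_product)
  also have "\<dots> = (\<Sum>\<alpha>\<in>words A (Suc i). f \<alpha>)"
    by (rule sum.reindex_bij_witness[of _ "\<lambda>\<alpha>. (hd \<alpha>, tl \<alpha>)" "\<lambda>(a, \<alpha>). a # \<alpha>"])
       (auto simp: words_def length_Suc_conv)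
  finally show ?thesis by simp
qed

text \<open>The first letter acts first, in contrast to \<open>word_act\<close>: each substitution
  into the system moves the current point by the letter just read.\<close>

definition path_act :: "nat \<Rightarrow> 'x list \<Rightarrow> 'x word \<Rightarrow> 'x word" where
  "path_act N \<alpha> x = fold (\<lambda>a. ball_act N (a, True)) \<alpha> x"

lemma path_act_closed: "x \<in> word_ball A N \<Longrightarrow> set \<alpha> \<subseteq> A \<Longrightarrow> path_act N \<alpha> x \<in> word_ball A N"
  unfolding path_act_def by (induction \<alpha> arbitrary: x) (auto simp: ball_act_closed)

lemma sum_swap3:
  "(\<Sum>k\<in>K. \<Sum>j\<in>J. \<Sum>a\<in>A. f k j a) = (\<Sum>a\<in>A. \<Sum>j\<in>J. \<Sum>k\<in>K. f k j a)"
proof -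
  have "(\<Sum>k\<in>K. \<Sum>j\<in>J. \<Sum>a\<in>A. f k j a) = (\<Sum>k\<in>K. \<Sum>a\<in>A. \<Sum>j\<in>J. f k j a)"
    by (intro sum.cong refl sum.swap)
  also have "\<dots> = (\<Sum>a\<in>A. \<Sum>k\<in>K. \<Sum>j\<in>J. f k j a)" by (rule sum.swap)
  also have "\<dots> = (\<Sum>a\<in>A. \<Sum>j\<in>J. \<Sum>k\<in>K. f k j a)" by (intro sum.cong refl sum.swap)
  finally show ?thesis .
qed

text \<open>The column \<kappa> = (1 - bar Q)^-1 V, of which only its support in the alphabet and
  its linear equation are kept.\<close>

locale bar_system =
  fixes A :: "'x set" and n :: nat and Q :: "'x \<Rightarrow> nat \<Rightarrow> nat \<Rightarrow> rat" and V :: "nat \<Rightarrow> rat"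
    and \<kappa> :: "nat \<Rightarrow> 'x laurent"
  assumes finite_A: "finite A"
    and \<kappa>_series: "\<And>k. k < n \<Longrightarrow> \<kappa> k \<in> laurent_series A"
    and \<kappa>_eq: "\<And>k. k < n \<Longrightarrow>
      \<kappa> k = const (V k) + (\<Sum>j<n. (\<Sum>a\<in>A. const (Q a k j) * letter_inv a) * \<kappa> j)"
begin

lemma image_step:
  assumes "x \<in> word_ball A N"
  shows "(\<Sum>k<n. r k * ball_image N (\<kappa> k) x e) = (if x = [] \<and> e = 0 then \<Sum>k<n. r k * V k else 0)
    + (\<Sum>a\<in>A. \<Sum>j<n. (\<Sum>k<n. r k * Q a k j) * ball_image N (\<kappa> j) (ball_act N (a, True) x) (e + 1))"
proof -
  have "ball_image N (\<kappa> k) x e = (if x = [] \<and> e = 0 then V k else 0)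
      + (\<Sum>j<n. \<Sum>a\<in>A. Q a k j * ball_image N (\<kappa> j) (ball_act N (a, True) x) (e + 1))" if "k < n" for k
    by (subst \<kappa>_eq[OF that])
       (simp add: ball_image_add ball_image_const ball_image_sum sum_distrib_right mult.assoc
         ball_image_const_mult, intro sum.cong refl, simp add: ball_image_letter_inv[OF \<kappa>_series _ assms])
  then have "(\<Sum>k<n. r k * ball_image N (\<kappa> k) x e) = (\<Sum>k<n. r k * (if x = [] \<and> e = 0 then V k else 0))
      + (\<Sum>k<n. \<Sum>j<n. \<Sum>a\<in>A. r k * Q a k j * ball_image N (\<kappa> j) (ball_act N (a, True) x) (e + 1))"
    by (simp add: distrib_left sum.distrib sum_distrib_left mult.assoc)
  also have "(\<Sum>k<n. r k * (if x = [] \<and> e = 0 then V k else 0))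
      = (if x = [] \<and> e = 0 then \<Sum>k<n. r k * V k else 0)"
    by (cases "x = [] \<and> e = 0") (simp_all only: if_True if_False mult_zero_right sum.neutral_const simp_thms)
  also have "(\<Sum>k<n. \<Sum>j<n. \<Sum>a\<in>A. r k * Q a k j * ball_image N (\<kappa> j) (ball_act N (a, True) x) (e + 1))
      = (\<Sum>a\<in>A. \<Sum>j<n. \<Sum>k<n. r k * Q a k j * ball_image N (\<kappa> j) (ball_act N (a, True) x) (e + 1))"
    by (rule sum_swap3)
  finally show ?thesis by (simp add: sum_distrib_right)
qed

text \<open>Besides a remainder at exponent e + i, unrolling produces only terms that depend on the
  system through the numbers r Q_\<alpha> V. For the initial vector r these are the coefficients of
  the represented series, common to all its representations.\<close>

lemma image_iterate:
  assumes "x \<in> word_ball A N"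
  shows "(\<Sum>k<n. r k * ball_image N (\<kappa> k) x e) =
    (\<Sum>j<i. \<Sum>\<alpha>\<in>words A j. if path_act N \<alpha> x = [] \<and> e + int j = 0
        then \<Sum>k<n. row_word n Q r \<alpha> k * V k else 0)
    + (\<Sum>\<alpha>\<in>words A i. \<Sum>k<n. row_word n Q r \<alpha> k * ball_image N (\<kappa> k) (path_act N \<alpha> x) (e + int i))"
  using assms
proof (induction i arbitrary: r x e)
  case 0
  then show ?case by (simp add: path_act_def)
next
  case (Suc i)
  let ?r = "\<lambda>a j. \<Sum>k<n. r k * Q a k j"
  let ?x = "\<lambda>a. ball_act N (a, True) x"
  have p: "path_act N (a # \<alpha>) x = path_act N \<alpha> (?x a)" for a \<alpha> by (simp add: path_act_def)
  have e: "e + 1 + int j = e + int (Suc j)" for j by simp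
  have IH: "(\<Sum>j<n. ?r a j * ball_image N (\<kappa> j) (?x a) (e + 1)) =
      (\<Sum>j<i. \<Sum>\<alpha>\<in>words A j. if path_act N (a # \<alpha>) x = [] \<and> e + int (Suc j) = 0
          then \<Sum>k<n. row_word n Q r (a # \<alpha>) k * V k else 0)
      + (\<Sum>\<alpha>\<in>words A i. \<Sum>k<n. row_word n Q r (a # \<alpha>) k *
          ball_image N (\<kappa> k) (path_act N (a # \<alpha>) x) (e + int (Suc i)))" if "a \<in> A" for a
    using Suc.IH[of "?x a" "?r a" "e + 1"] ball_act_closed[OF Suc.prems, of "(a, True)"] that
    unfolding p e row_word.simps by simp
  have 0: "(\<Sum>\<alpha>\<in>words A 0. if path_act N \<alpha> x = [] \<and> e + int 0 = 0
      then \<Sum>k<n. row_word n Q r \<alpha> k * V k else 0) = (if x = [] \<and> e = 0 then \<Sum>k<n. r k * V k else 0)"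
    unfolding words_0 by (subst sum.insert) (auto simp: path_act_def)
  have "(\<Sum>a\<in>A. \<Sum>j<n. ?r a j * ball_image N (\<kappa> j) (?x a) (e + 1)) =
      (\<Sum>j<i. \<Sum>a\<in>A. \<Sum>\<alpha>\<in>words A j. if path_act N (a # \<alpha>) x = [] \<and> e + int (Suc j) = 0
          then \<Sum>k<n. row_word n Q r (a # \<alpha>) k * V k else 0)
      + (\<Sum>a\<in>A. \<Sum>\<alpha>\<in>words A i. \<Sum>k<n. row_word n Q r (a # \<alpha>) k *
          ball_image N (\<kappa> k) (path_act N (a # \<alpha>) x) (e + int (Suc i)))"
    by (subst sum.swap) (simp only: IH sum.distrib cong: sum.cong)
  then show ?case
    by (simp only: image_step[OF Suc.prems, of r e] sum.lessThan_Suc_shift sum_words_Suc[OF finite_A] 0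
        add.assoc)
qed

end

text \<open>Unrolling i steps from exponent e - i, the known terms of both systems cancel, and the
  remainders for all i live at the same exponent e. They are linear in vectors
  \<open>\<rho> i\<close> and \<open>\<rho>' i\<close> of a fixed finite-dimensional space, so a
  dependence among these vectors is a recurrence for the difference \<open>\<mu>\<close>, with
  coefficients independent of e.\<close>

lemma bar_systems_agree:
  assumes "bar_system A n Q V \<kappa>" "bar_system A n' Q' V' \<kappa>'"
    and words: "\<And>\<alpha>. set \<alpha> \<subseteq> A \<Longrightarrow>
      (\<Sum>k<n. row_word n Q U \<alpha> k * V k) = (\<Sum>k<n'. row_word n' Q' U' \<alpha> k * V' k)"
  shows "(\<Sum>k<n. const (U k) * \<kappa> k) = (\<Sum>k<n'. const (U' k) * \<kappa>' k)" (is "?g = ?g'")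
proof (rule laurent_eqI)
  interpret L: bar_system A n Q V \<kappa> by fact
  interpret R: bar_system A n' Q' V' \<kappa>' by fact
  fix v :: "'a word" assume v: "reduced v"
  have ser: "?g \<in> laurent_series A" "?g' \<in> laurent_series A"
    by (intro laurent_series_sum laurent_series_mult const_laurent_series; simp add: L.\<kappa>_series R.\<kappa>_series)+
  show "coeff ?g v = coeff ?g' v"
  proof (cases "fst ` set v \<subseteq> A")
    case False
    then have "v \<notin> carrier (free_group A)" by (simp add: free_group_def)
    then show ?thesis using ser unfolding laurent_series_def by (metis (mono_tags, lifting) mem_Collect_eq)
  next
    case True
    obtain n1 where n1: "\<And>w. coeff ?g w \<noteq> 0 \<Longrightarrow> exponent_sum w = exponent_sum v \<Longrightarrow> length w \<le> n1"
      using length_bounded[of ?g "exponent_sum v"] by blast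
    obtain n2 where n2: "\<And>w. coeff ?g' w \<noteq> 0 \<Longrightarrow> exponent_sum w = exponent_sum v \<Longrightarrow> length w \<le> n2"
      using length_bounded[of ?g' "exponent_sum v"] by blast
    \<comment> \<open>With this radius the image at \<open>v\<close> recovers the coefficient at
      \<open>v\<close> for both series.\<close>
    define N where "N = Max {n1, n2, length v}"
    have N: "n1 \<le> N" "n2 \<le> N" "length v \<le> N" by (auto simp: N_def)
    let ?B = "word_ball A N"
    have vB: "v \<in> ?B" using v True N by (simp add: word_ball_def free_group_def)
    have finB: "finite ?B" by (rule finite_word_ball[OF L.finite_A])
    define \<mu> where "\<mu> e = ball_image N ?g v e - ball_image N ?g' v e" for e
    have gL: "ball_image N ?g v e = (\<Sum>k<n. U k * ball_image N (\<kappa> k) v e)" for e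
      by (simp add: ball_image_sum ball_image_const_mult)
    have gR: "ball_image N ?g' v e = (\<Sum>k<n'. U' k * ball_image N (\<kappa>' k) v e)" for e
      by (simp add: ball_image_sum ball_image_const_mult)
    \<comment> \<open>Total row vector of the words of length \<open>i\<close> that carry
      \<open>v\<close> to \<open>x\<close>.\<close>
    define \<rho> where "\<rho> i x k = (\<Sum>\<alpha>\<in>words A i. if path_act N \<alpha> v = x then row_word n Q U \<alpha> k else 0)" for i x k
    define \<rho>' where "\<rho>' i x k = (\<Sum>\<alpha>\<in>words A i. if path_act N \<alpha> v = x then row_word n' Q' U' \<alpha> k else 0)" for i x k
    \<comment> \<open>The dimension of the pairs of vectors; the indices 0, ..., d are one too many
      for independence.\<close>
    define d where "d = card (?B \<times> {..<n} <+> ?B \<times> {..<n'})"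
    obtain c where c: "\<exists>i\<in>{..d}. c i \<noteq> (0 :: rat)"
      "\<forall>z\<in>?B \<times> {..<n} <+> ?B \<times> {..<n'}.
        (\<Sum>i\<le>d. c i * (case z of Inl (x, k) \<Rightarrow> \<rho> i x k | Inr (x, k) \<Rightarrow> \<rho>' i x k)) = 0"
      using linear_dependence[of "?B \<times> {..<n} <+> ?B \<times> {..<n'}" "{..d}"
          "\<lambda>i z. case z of Inl (x, k) \<Rightarrow> \<rho> i x k | Inr (x, k) \<Rightarrow> \<rho>' i x k"] finB
      by (auto simp: d_def)
    have c1: "(\<Sum>i\<le>d. c i * \<rho> i x k) = 0" if "x \<in> ?B" "k < n" for x k
      using bspec[OF c(2) InlI[of "(x, k)"]] that by simp
    have c2: "(\<Sum>i\<le>d. c i * \<rho>' i x k) = 0" if "x \<in> ?B" "k < n'" for x k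
      using bspec[OF c(2) InrI[of "(x, k)"]] that by simp
    \<comment> \<open>Sorting the words by the point to which they carry \<open>v\<close> makes the
      sum a linear function of the vectors above, so their dependence annihilates it.\<close>
    have regroup: "(\<Sum>i\<le>d. c i * (\<Sum>\<alpha>\<in>words A i. \<Sum>k<m. R \<alpha> k * h k (path_act N \<alpha> v))) = 0"
      if z: "\<And>x k. x \<in> ?B \<Longrightarrow> k < m \<Longrightarrow>
        (\<Sum>i\<le>d. c i * (\<Sum>\<alpha>\<in>words A i. if path_act N \<alpha> v = x then R \<alpha> k else 0)) = 0"
      for m :: nat and R :: "'a list \<Rightarrow> nat \<Rightarrow> rat" and h
    proof -
      have "h k (path_act N \<alpha> v) = (\<Sum>x\<in>?B. if path_act N \<alpha> v = x then h k x else 0)"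
        if "\<alpha> \<in> words A i" for \<alpha> i k
        using that path_act_closed[OF vB, of \<alpha>] finB by (simp add: words_def)
      then have "(\<Sum>\<alpha>\<in>words A i. \<Sum>k<m. R \<alpha> k * h k (path_act N \<alpha> v)) =
          (\<Sum>\<alpha>\<in>words A i. \<Sum>k<m. \<Sum>x\<in>?B. (if path_act N \<alpha> v = x then R \<alpha> k else 0) * h k x)" for i
        by (intro sum.cong refl) (auto simp: sum_distrib_left intro!: sum.cong)
      also have "\<dots> i = (\<Sum>k<m. \<Sum>x\<in>?B. \<Sum>\<alpha>\<in>words A i. (if path_act N \<alpha> v = x then R \<alpha> k else 0) * h k x)" for i
        by (subst sum.swap) (intro sum.cong refl sum.swap)
      finally have "(\<Sum>i\<le>d. c i * (\<Sum>\<alpha>\<in>words A i. \<Sum>k<m. R \<alpha> k * h k (path_act N \<alpha> v))) =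
          (\<Sum>i\<le>d. \<Sum>k<m. \<Sum>x\<in>?B. c i * (\<Sum>\<alpha>\<in>words A i. if path_act N \<alpha> v = x then R \<alpha> k else 0) * h k x)"
        by (simp add: sum_distrib_left sum_distrib_right mult.assoc)
      also have "\<dots> = (\<Sum>k<m. \<Sum>x\<in>?B. \<Sum>i\<le>d. c i * (\<Sum>\<alpha>\<in>words A i. if path_act N \<alpha> v = x then R \<alpha> k else 0) * h k x)"
        by (subst sum.swap) (intro sum.cong refl sum.swap)
      also have "\<dots> = 0"
        by (rule sum.neutral, rule ballI, rule sum.neutral, rule ballI)
          (simp only: sum_distrib_right[symmetric] z lessThan_iff mult_zero_left)
      finally show ?thesis .
    qed
    \<comment> \<open>Starting at e - i cancels the shift by i, so that every remainder involves the
      same values at exponent e.\<close>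
    have rec: "(\<Sum>i\<le>d. c i * \<mu> (e - int i)) = 0" for e
    proof -
      let ?L = "\<lambda>i. \<Sum>\<alpha>\<in>words A i. \<Sum>k<n. row_word n Q U \<alpha> k * ball_image N (\<kappa> k) (path_act N \<alpha> v) e"
      let ?R = "\<lambda>i. \<Sum>\<alpha>\<in>words A i. \<Sum>k<n'. row_word n' Q' U' \<alpha> k * ball_image N (\<kappa>' k) (path_act N \<alpha> v) e"
      have "\<mu> (e - int i) = ?L i - ?R i" for i
      proof -
        show ?thesis
          unfolding \<mu>_def gL gR L.image_iterate[OF vB, of U "e - int i" i]
            R.image_iterate[OF vB, of U' "e - int i" i]
          by simp (intro sum.cong refl if_cong words, simp add: words_def)
      qed
      then have "(\<Sum>i\<le>d. c i * \<mu> (e - int i)) = (\<Sum>i\<le>d. c i * ?L i) - (\<Sum>i\<le>d. c i * ?R i)"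
        by (simp add: right_diff_distrib sum_subtractf)
      also have "(\<Sum>i\<le>d. c i * ?L i) = 0"
        by (rule regroup[of n "row_word n Q U" "\<lambda>k x. ball_image N (\<kappa> k) x e"])
          (use c1 in \<open>simp add: \<rho>_def\<close>)
      also have "(\<Sum>i\<le>d. c i * ?R i) = 0"
        by (rule regroup[of n' "row_word n' Q' U'" "\<lambda>k x. ball_image N (\<kappa>' k) x e"])
          (use c2 in \<open>simp add: \<rho>'_def\<close>)
      finally show ?thesis by simp
    qed
    obtain b1 where b1: "\<And>x e. e < b1 \<Longrightarrow> ball_image N ?g x e = 0" using ball_image_bounded_below[of N ?g] by blast
    obtain b2 where b2: "\<And>x e. e < b2 \<Longrightarrow> ball_image N ?g' x e = 0" using ball_image_bounded_below[of N ?g'] by blast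
    obtain i where i: "i \<le> d" "c i \<noteq> 0" using c(1) by blast
    have "\<mu> (exponent_sum v) = 0"
      using recurrence_zero[OF i rec, of "min b1 b2"] b1 b2 by (simp add: \<mu>_def)
    moreover have "ball_image N ?g v (exponent_sum v) = coeff ?g v"
      using n1 N v by (intro ball_image_coeff) (auto intro: order_trans)
    moreover have "ball_image N ?g' v (exponent_sum v) = coeff ?g' v"
      using n2 N v by (intro ball_image_coeff) (auto intro: order_trans)
    ultimately show ?thesis by (simp add: \<mu>_def)
  qed
qed

section \<open>Representations\<close>

lemma index_mult_mat_sum:
  assumes "X \<in> carrier_mat l n" "Y \<in> carrier_mat n q" "i < l" "j < q"
  shows "(X * Y) $$ (i, j) = (\<Sum>k<n. X $$ (i, k) * Y $$ (k, j))"
  using assms by (simp add: scalar_prod_def lessThan_atLeast0)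

text \<open>An entry of the column M V: the unknowns of the linear system behind a
  representation.\<close>

definition column_sum :: "'x laurent mat \<Rightarrow> rat mat \<Rightarrow> nat \<Rightarrow> 'x laurent" where
  "column_sum M V k = (\<Sum>j<dim_row V. M $$ (k, j) * const (V $$ (j, 0)))"

lemma sandwich_eq:
  assumes "U \<in> carrier_mat 1 n" "M \<in> carrier_mat n n" "V \<in> carrier_mat n 1"
  shows "sandwich U M V = (\<Sum>k<n. const (U $$ (0, k)) * column_sum M V k)"
proof -
  have "map_mat const U * M * map_mat const V = map_mat const U * (M * map_mat const V)"
    using assms by (intro assoc_mult_mat) auto
  then have "sandwich U M V = (map_mat const U * (M * map_mat const V)) $$ (0, 0)"
    by (simp add: sandwich_def)
  also have "\<dots> = (\<Sum>k<n. map_mat const U $$ (0, k) * (M * map_mat const V) $$ (k, 0))"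
    using assms by (intro index_mult_mat_sum[of _ 1 _ _ 1]) auto
  also have "\<dots> = (\<Sum>k<n. const (U $$ (0, k)) * column_sum M V k)"
  proof (rule sum.cong[OF refl])
    fix k assume "k \<in> {..<n}"
    then have "(M * map_mat const V) $$ (k, 0) = (\<Sum>j<n. M $$ (k, j) * map_mat const V $$ (j, 0))"
      using assms by (intro index_mult_mat_sum[of _ n _ _ 1]) auto
    also have "\<dots> = column_sum M V k"
      using assms by (auto simp: column_sum_def intro!: sum.cong)
    finally show "map_mat const U $$ (0, k) * (M * map_mat const V) $$ (k, 0)
        = const (U $$ (0, k)) * column_sum M V k"
      using assms \<open>k \<in> {..<n}\<close> by simp
  qed
  finally show ?thesis .
qed

lemma sum_if_left:
  fixes f :: "nat \<Rightarrow> 'b :: ring_1"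
  shows "k < n \<Longrightarrow> (\<Sum>j<n. (if k = j then 1 else 0) * f j) = f k"
  by (subst sum.mono_neutral_right[of "{..<n}" "{k}"]) auto

lemma right_inverse_entries:
  fixes X :: "'r :: ring_1 mat"
  assumes "X \<in> carrier_mat n n" "M \<in> carrier_mat n n"
  shows "(1\<^sub>m n - X) * M = 1\<^sub>m n \<longleftrightarrow>
    (\<forall>i<n. \<forall>j<n. M $$ (i, j) = (if i = j then 1 else 0) + (\<Sum>k<n. X $$ (i, k) * M $$ (k, j)))"
proof -
  have e: "((1\<^sub>m n - X) * M) $$ (i, j) = M $$ (i, j) - (\<Sum>k<n. X $$ (i, k) * M $$ (k, j))"
    if "i < n" "j < n" for i j
  proof -
    have "((1\<^sub>m n - X) * M) $$ (i, j) = (\<Sum>k<n. (1\<^sub>m n - X) $$ (i, k) * M $$ (k, j))"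
      using assms that by (intro index_mult_mat_sum[of _ n _ _ n]) auto
    also have "\<dots> = (\<Sum>k<n. (if i = k then 1 else 0) * M $$ (k, j) - X $$ (i, k) * M $$ (k, j))"
      using assms that by (intro sum.cong) (auto simp: left_diff_distrib)
    also have "\<dots> = M $$ (i, j) - (\<Sum>k<n. X $$ (i, k) * M $$ (k, j))"
      using that by (simp only: sum_subtractf sum_if_left)
    finally show ?thesis .
  qed
  show ?thesis
  proof
    assume eq: "(1\<^sub>m n - X) * M = 1\<^sub>m n"
    show "\<forall>i<n. \<forall>j<n. M $$ (i, j) = (if i = j then 1 else 0) + (\<Sum>k<n. X $$ (i, k) * M $$ (k, j))"
    proof (intro allI impI)
      fix i j assume ij: "i < n" "j < n"
      then have "((1\<^sub>m n - X) * M) $$ (i, j) = (if i = j then 1 else 0)" unfolding eq by simp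
      then show "M $$ (i, j) = (if i = j then 1 else 0) + (\<Sum>k<n. X $$ (i, k) * M $$ (k, j))"
        unfolding e[OF ij] diff_eq_eq .
    qed
  next
    assume "\<forall>i<n. \<forall>j<n. M $$ (i, j) = (if i = j then 1 else 0) + (\<Sum>k<n. X $$ (i, k) * M $$ (k, j))"
    then have "((1\<^sub>m n - X) * M) $$ (i, j) = (if i = j then 1 else 0)" if "i < n" "j < n" for i j
      unfolding e[OF that] diff_eq_eq using that by blast
    then show "(1\<^sub>m n - X) * M = 1\<^sub>m n"
      using assms by (intro eq_matI) auto
  qed
qed

lemma column_sum_eq:
  assumes "X \<in> carrier_mat n n" "V \<in> carrier_mat n 1" "inverse_mat_over R (1\<^sub>m n - X) M" "k < n"
  shows "column_sum M V k = const (V $$ (k, 0)) + (\<Sum>j<n. X $$ (k, j) * column_sum M V j)"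
proof -
  have M: "M \<in> carrier_mat n n" "(1\<^sub>m n - X) * M = 1\<^sub>m n"
    using assms(1,3) by (auto simp: inverse_mat_over_def inverts_mat_def)
  have V: "dim_row V = n" using assms by simp
  have e: "M $$ (k, j) = (if k = j then 1 else 0) + (\<Sum>i<n. X $$ (k, i) * M $$ (i, j))" if "j < n" for j
    using right_inverse_entries[OF assms(1) M(1)] M(2) that assms(4) by blast
  have "column_sum M V k = (\<Sum>j<n. (if k = j then 1 else 0) * const (V $$ (j, 0))
      + (\<Sum>i<n. X $$ (k, i) * (M $$ (i, j) * const (V $$ (j, 0)))))"
    unfolding column_sum_def V
    by (rule sum.cong[OF refl], subst e) (simp_all only: lessThan_iff distrib_right sum_distrib_right mult.assoc)
  also have "\<dots> = const (V $$ (k, 0)) + (\<Sum>j<n. \<Sum>i<n. X $$ (k, i) * (M $$ (i, j) * const (V $$ (j, 0))))"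
    by (simp only: sum.distrib sum_if_left[OF assms(4)])
  also have "(\<Sum>j<n. \<Sum>i<n. X $$ (k, i) * (M $$ (i, j) * const (V $$ (j, 0))))
      = (\<Sum>i<n. X $$ (k, i) * column_sum M V i)"
    unfolding column_sum_def V by (subst sum.swap) (simp only: sum_distrib_left)
  finally show ?thesis .
qed

lemma inverse_mat_over_closed:
  assumes "X \<in> carrier_mat n n" "inverse_mat_over R (1\<^sub>m n - X) M" "i < n" "j < n"
  shows "M $$ (i, j) \<in> R"
  using assms by (force simp: inverse_mat_over_def)

text \<open>A nonempty positive word receives its first letter from a linear entry and the rest from
  a \<open>C j\<close>, so the equation strips one letter at a time.\<close>

lemma coeff_column:
  assumes fin: "finite A"
    and C: "\<And>k. k < n \<Longrightarrow> C k \<in> power_series A"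
      "\<And>k. k < n \<Longrightarrow> C k = const (v k) + (\<Sum>j<n. (\<Sum>a\<in>A. const (Q a k j) * letter a) * C j)"
    and "set \<alpha> \<subseteq> A" "k < n"
  shows "coeff (C k) (pos_word \<alpha>) = col_word n Q v \<alpha> k"
  using assms(4,5)
proof (induction \<alpha> arbitrary: k)
  case Nil
  then show ?case
    by (subst C(2)) (simp_all add: sum_distrib_right mult.assoc coeff_letter_mult_pos_word[OF C(1)],
      simp add: const.rep_eq pos_word_def)
next
  case (Cons b \<alpha>)
  have "coeff (C k) (pos_word (b # \<alpha>)) =
      (\<Sum>j<n. \<Sum>a\<in>A. Q a k j * coeff (letter a * C j) (pos_word (b # \<alpha>)))"
    using Cons.prems by (subst C(2)) (simp_all add: sum_distrib_right mult.assoc,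
      simp add: const.rep_eq pos_word_def)
  also have "\<dots> = (\<Sum>j<n. \<Sum>a\<in>A. if b = a then Q b k j * col_word n Q v \<alpha> j else 0)"
    using Cons by (intro sum.cong refl) (simp add: coeff_letter_mult_pos_word[OF C(1)])
  also have "\<dots> = col_word n Q v (b # \<alpha>) k" using Cons.prems fin by simp
  finally show ?case .
qed

text \<open>The inverse matrix disappears from the coefficients. Hence two representations of one
  series share all the numbers U Q_\<alpha> V.\<close>

lemma representation_coeff:
  assumes "finite A" "representation A f n U Q V" "set \<alpha> \<subseteq> A"
  shows "coeff f (pos_word \<alpha>) =
    (\<Sum>k<n. row_word n (\<lambda>a k j. coeff (Q $$ (k, j)) [(a, True)]) (\<lambda>k. U $$ (0, k)) \<alpha> k * V $$ (k, 0))"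
proof -
  obtain M where c: "U \<in> carrier_mat 1 n" "V \<in> carrier_mat n 1" "Q \<in> carrier_mat n n"
    and Q: "elements_mat Q \<subseteq> linear_forms A"
    and M: "inverse_mat_over (power_series A) (1\<^sub>m n - Q) M" and f: "f = sandwich U M V"
    using assms(2) unfolding representation_def by blast
  have Mc: "M \<in> carrier_mat n n" using M c by (auto simp: inverse_mat_over_def)
  have C: "column_sum M V k \<in> power_series A" if "k < n" for k
    unfolding column_sum_def using that c inverse_mat_over_closed[OF c(3) M]
    by (intro power_series_sum power_series_mult const_power_series) auto
  have "Q $$ (k, j) = (\<Sum>a\<in>A. const (coeff (Q $$ (k, j)) [(a, True)]) * letter a)" if "k < n" "j < n" for k j
    using that Q c by (intro linear_form_eq assms(1)) auto
  then have "column_sum M V k = const (V $$ (k, 0)) +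
      (\<Sum>j<n. (\<Sum>a\<in>A. const (coeff (Q $$ (k, j)) [(a, True)]) * letter a) * column_sum M V j)"
    if "k < n" for k
    using column_sum_eq[OF c(3,2) M that] that by simp
  note co = coeff_column[of A n "column_sum M V", OF assms(1) C this assms(3)]
  have "coeff f (pos_word \<alpha>) = (\<Sum>k<n. U $$ (0, k) * coeff (column_sum M V k) (pos_word \<alpha>))"
    unfolding f sandwich_eq[OF c(1) Mc c(2)] by simp
  also have "\<dots> = (\<Sum>k<n. U $$ (0, k) *
      col_word n (\<lambda>a k j. coeff (Q $$ (k, j)) [(a, True)]) (\<lambda>k. V $$ (k, 0)) \<alpha> k)"
    by (rule sum.cong) (simp_all add: co)
  finally show ?thesis by (simp only: row_word_col_word)
qed

text \<open>Passes from matrices to the data compared in \<open>bar_systems_agree\<close>, with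
  \<kappa> the column M V for the inverse M of the barred matrix.\<close>

lemma is_reciprocal_bar_system:
  assumes "finite A" "is_reciprocal A f g"
  obtains n U Q V \<kappa> where "bar_system A n Q V \<kappa>" "g = (\<Sum>k<n. const (U k) * \<kappa> k)"
    "\<And>\<alpha>. set \<alpha> \<subseteq> A \<Longrightarrow> coeff f (pos_word \<alpha>) = (\<Sum>k<n. row_word n Q U \<alpha> k * V k)"
proof -
  obtain n U Q V M where rep: "representation A f n U Q V"
    and M: "inverse_mat_over (laurent_series A) (1\<^sub>m n - map_mat (bar A) Q) M" and g: "g = sandwich U M V"
    using assms(2) unfolding is_reciprocal_def by blast
  have c: "U \<in> carrier_mat 1 n" "V \<in> carrier_mat n 1" "Q \<in> carrier_mat n n" "map_mat (bar A) Q \<in> carrier_mat n n"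
    using rep by (auto simp: representation_def)
  have Mc: "M \<in> carrier_mat n n" using M c by (auto simp: inverse_mat_over_def)
  show thesis
  proof (rule that)
    show "bar_system A n (\<lambda>a k j. coeff (Q $$ (k, j)) [(a, True)]) (\<lambda>k. V $$ (k, 0)) (column_sum M V)"
    proof
      fix k assume k: "k < n"
      show "column_sum M V k \<in> laurent_series A"
        unfolding column_sum_def using k c inverse_mat_over_closed[OF c(4) M]
        by (intro laurent_series_sum laurent_series_mult const_laurent_series) auto
      show "column_sum M V k = const (V $$ (k, 0)) +
          (\<Sum>j<n. (\<Sum>a\<in>A. const (coeff (Q $$ (k, j)) [(a, True)]) * letter_inv a) * column_sum M V j)"
        using column_sum_eq[OF c(4,2) M k] k c by (simp add: bar_def)
    qed (rule assms(1))
    show "g = (\<Sum>k<n. const (U $$ (0, k)) * column_sum M V k)"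
      unfolding g by (rule sandwich_eq[OF c(1) Mc c(2)])
  qed (rule representation_coeff[OF assms(1) rep])
qed

lemma is_reciprocal_unique:
  assumes "finite A" "is_reciprocal A f g" "is_reciprocal A f g'"
  shows "g = g'"
proof -
  obtain n U Q V \<kappa> where 1: "bar_system A n Q V \<kappa>" "g = (\<Sum>k<n. const (U k) * \<kappa> k)"
    "\<And>\<alpha>. set \<alpha> \<subseteq> A \<Longrightarrow> coeff f (pos_word \<alpha>) = (\<Sum>k<n. row_word n Q U \<alpha> k * V k)"
    by (rule is_reciprocal_bar_system[OF assms(1,2)]) blast
  obtain n' U' Q' V' \<kappa>' where 2: "bar_system A n' Q' V' \<kappa>'" "g' = (\<Sum>k<n'. const (U' k) * \<kappa>' k)"
    "\<And>\<alpha>. set \<alpha> \<subseteq> A \<Longrightarrow> coeff f (pos_word \<alpha>) = (\<Sum>k<n'. row_word n' Q' U' \<alpha> k * V' k)"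
    by (rule is_reciprocal_bar_system[OF assms(1,3)]) blast
  show ?thesis
    unfolding 1(2) 2(2) by (rule bar_systems_agree[OF 1(1) 2(1)]) (metis 1(3) 2(3))
qed

section \<open>Inverting 1 - Q over the power series\<close>

lemma power_series_exists:
  assumes "finite A"
  shows "\<exists>f\<in>power_series A. \<forall>\<alpha>. set \<alpha> \<subseteq> A \<longrightarrow> coeff f (pos_word \<alpha>) = c \<alpha>"
proof -
  let ?f = "\<lambda>w. if set w \<subseteq> A \<times> {True} then c (map fst w) else 0"
  have "w \<in> carrier (free_group A) \<and> word_order w = 0" if "set w \<subseteq> A \<times> {True}" for w
  proof -
    have "w = pos_word (map fst w)" using that by (force simp: pos_word_def intro!: map_idI[symmetric])
    then have "reduced w" using reduced_pos_word by metis
    moreover have "filter (\<lambda>x. \<not> snd x) w = []" using that by (auto simp: filter_empty_conv)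
    ultimately show ?thesis using that by (auto simp: free_group_def word_order_def)
  qed
  then have "laurent_fun ?f"
    unfolding laurent_fun_def using assms
    by (intro conjI exI[of _ A] bdd_belowI[of _ 0]) (auto split: if_splits)
  then have co: "coeff (Abs_laurent ?f) = ?f" by (simp add: Abs_laurent_inverse)
  show ?thesis
    by (intro bexI[of _ "Abs_laurent ?f"])
       (auto simp: co power_series_def pos_word_def comp_def split: if_splits)
qed

text \<open>The defect Z = M (1 - Q) - 1 satisfies (1 - Q) Z = 0, that is Z = Q Z. As Q has no
  constant terms, all coefficients of Z vanish.\<close>

lemma left_inverse_of_right_inverse:
  fixes A :: "'x set"
  assumes fin: "finite A" and Q: "Q \<in> carrier_mat n n" "elements_mat Q \<subseteq> linear_forms A"
    and M: "M \<in> carrier_mat n n" "elements_mat M \<subseteq> power_series A" "(1\<^sub>m n - Q) * M = 1\<^sub>m n"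
  shows "M * (1\<^sub>m n - Q) = 1\<^sub>m n"
proof -
  let ?I = "1\<^sub>m n :: 'x laurent mat"
  have Qp: "Q $$ (i, j) \<in> power_series A" if "i < n" "j < n" for i j
  proof -
    have "Q $$ (i, j) \<in> linear_forms A" using Q that by auto
    then show ?thesis
      by (subst linear_form_eq[OF fin, of "Q $$ (i, j)"])
        (auto intro!: power_series_sum power_series_mult const_power_series letter_power_series)
  qed
  have one: "(if b then 1 else 0) \<in> power_series A" for b
    using const_power_series[of 1 A] const_power_series[of 0 A] by simp
  define Z where "Z = M * (?I - Q) - ?I"
  have Zc: "Z \<in> carrier_mat n n" unfolding Z_def by (rule minus_carrier_mat) simp
  have "(?I - Q) * Z = (?I - Q) * (M * (?I - Q)) - (?I - Q) * ?I"
    unfolding Z_def using M Q by (intro mult_minus_distrib_mat) auto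
  also have "(?I - Q) * (M * (?I - Q)) = (?I - Q) * M * (?I - Q)"
    using M Q by (intro assoc_mult_mat[symmetric]) auto
  also have "\<dots> - (?I - Q) * ?I = 0\<^sub>m n n" using M(3) Q by auto
  finally have Z0: "(?I - Q) * Z = 0\<^sub>m n n" .
  have Zp: "Z $$ (i, j) \<in> power_series A" if "i < n" "j < n" for i j
  proof -
    have "(M * (?I - Q)) $$ (i, j) = (\<Sum>k<n. M $$ (i, k) * (?I - Q) $$ (k, j))"
      using M Q that by (intro index_mult_mat_sum[of _ n _ _ n]) auto
    moreover have "(?I - Q) $$ (k, j) \<in> power_series A" if "k < n" for k
    proof -
      have "(?I - Q) $$ (k, j) = (if k = j then 1 else 0) - Q $$ (k, j)"
        using Q that \<open>j < n\<close> by simp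
      then show ?thesis by (simp only: power_series_diff[OF one Qp[OF that \<open>j < n\<close>]])
    qed
    moreover have "M $$ (i, k) \<in> power_series A" if "k < n" for k
      using M that \<open>i < n\<close> by auto
    ultimately have "(M * (?I - Q)) $$ (i, j) \<in> power_series A"
      by (auto intro!: power_series_sum power_series_mult)
    moreover have "Z $$ (i, j) = (M * (?I - Q)) $$ (i, j) - (if i = j then 1 else 0)"
      using that M Q unfolding Z_def by simp
    ultimately show ?thesis by (simp only: power_series_diff[OF _ one])
  qed
  have Zeq: "Z $$ (i, j) = (\<Sum>k<n. Q $$ (i, k) * Z $$ (k, j))" if "i < n" "j < n" for i j
  proof -
    have "(?I - Q) * Z = Z - Q * Z"
      using Zc Q by (subst minus_mult_distrib_mat[of _ n n]) auto
    then have "Z - Q * Z = 0\<^sub>m n n" using Z0 by simp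
    then have "(Z - Q * Z) $$ (i, j) = 0" using that by (simp only: index_zero_mat)
    then have "Z $$ (i, j) = (Q * Z) $$ (i, j)" using Zc Q that by simp
    also have "\<dots> = (\<Sum>k<n. Q $$ (i, k) * Z $$ (k, j))"
      using Zc Q that by (intro index_mult_mat_sum[of _ n _ _ n]) auto
    finally show ?thesis .
  qed
  have Qs: "Q $$ (i, k) = (\<Sum>a\<in>A. const (coeff (Q $$ (i, k)) [(a, True)]) * letter a)" if "i < n" "k < n" for i k
    using that Q by (intro linear_form_eq fin) auto
  have "Z $$ (i, j) = 0" if ij: "i < n" "j < n" for i j
  proof (rule power_series_eqI[of _ A])
    show "Z $$ (i, j) \<in> power_series A" "0 \<in> power_series A"
      using Zp ij const_power_series[of 0 A] by auto
    fix \<alpha> assume "set \<alpha> \<subseteq> A"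
    \<comment> \<open>Each column of Z solves the system with zero inhomogeneous part, in the form
      required by \<open>coeff_column\<close>.\<close>
    have "Z $$ (k, j) = const 0 + (\<Sum>l<n. (\<Sum>a\<in>A. const (coeff (Q $$ (k, l)) [(a, True)]) * letter a) * Z $$ (l, j))"
      if "k < n" for k
      using Zeq[OF that ij(2)] Qs[OF that] by simp
    then have "coeff (Z $$ (i, j)) (pos_word \<alpha>) =
        col_word n (\<lambda>a k l. coeff (Q $$ (k, l)) [(a, True)]) (\<lambda>_. 0) \<alpha> i"
      using ij(2) by (intro coeff_column[OF fin _ _ \<open>set \<alpha> \<subseteq> A\<close> ij(1), of "\<lambda>k. Z $$ (k, j)"] Zp)
    moreover have "col_word n q (\<lambda>_. 0) \<alpha> = (\<lambda>_. 0)" for q :: "'x \<Rightarrow> nat \<Rightarrow> nat \<Rightarrow> rat"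
      by (induction \<alpha>) auto
    ultimately show "coeff (Z $$ (i, j)) (pos_word \<alpha>) = coeff 0 (pos_word \<alpha>)" by simp
  qed
  then have "Z = 0\<^sub>m n n" using Zc by (intro eq_matI) auto
  then have z: "(M * (?I - Q) - ?I) $$ (i, j) = 0" if "i < n" "j < n" for i j
    using that by (simp add: Z_def)
  show ?thesis
  proof (rule eq_matI)
    fix i j assume "i < dim_row ?I" "j < dim_col ?I"
    then show "(M * (?I - Q)) $$ (i, j) = ?I $$ (i, j)"
      using z[of i j] M Q by simp
  qed (use M Q in auto)
qed

text \<open>The geometric series of Q is built without infinite sums: its entry (i, j) has at the
  word \<alpha> the coefficient (Q_\<alpha>)(i, j), which is \<open>col_word\<close> started at the
  j-th unit vector.\<close>

lemma neumann_inverse: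
  assumes fin: "finite A" and Q: "Q \<in> carrier_mat n n" "elements_mat Q \<subseteq> linear_forms A"
  shows "\<exists>M. inverse_mat_over (power_series A) (1\<^sub>m n - Q) M"
proof -
  let ?Q = "\<lambda>a i k. coeff (Q $$ (i, k)) [(a, True)]"
  have Qs: "Q $$ (i, k) = (\<Sum>a\<in>A. const (?Q a i k) * letter a)" if "i < n" "k < n" for i k
    using that Q by (intro linear_form_eq fin) auto
  let ?c = "\<lambda>i j \<alpha>. col_word n ?Q (\<lambda>k. of_bool (k = j)) \<alpha> i"
  let ?F = "\<lambda>i j f. f \<in> power_series A \<and> (\<forall>\<alpha>. set \<alpha> \<subseteq> A \<longrightarrow> coeff f (pos_word \<alpha>) = ?c i j \<alpha>)"
  define F where "F i j = (SOME f. ?F i j f)" for i j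
  have "\<exists>f. ?F i j f" for i j
    using power_series_exists[OF fin, of "?c i j"] unfolding Bex_def .
  from someI_ex[OF this] have "?F i j (F i j)" for i j unfolding F_def .
  then have F: "\<And>i j. F i j \<in> power_series A"
    "\<And>i j \<alpha>. set \<alpha> \<subseteq> A \<Longrightarrow> coeff (F i j) (pos_word \<alpha>) = ?c i j \<alpha>"
    by simp_all
  define M where "M = mat n n (\<lambda>(i, j). F i j)"
  have M: "M \<in> carrier_mat n n" "elements_mat M \<subseteq> power_series A"
    using F by (auto simp: M_def)
  have "F i j = (if i = j then 1 else 0) + (\<Sum>k<n. Q $$ (i, k) * F k j)" if "i < n" "j < n" for i j
  proof -
    have "(\<Sum>k<n. Q $$ (i, k) * F k j) = (\<Sum>k<n. \<Sum>a\<in>A. const (?Q a i k) * (letter a * F k j))"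
      using that
      by (intro sum.cong refl, subst Qs) (simp_all only: lessThan_iff sum_distrib_right mult.assoc)
    moreover have "F i j = const (of_bool (i = j)) + (\<Sum>k<n. \<Sum>a\<in>A. const (?Q a i k) * (letter a * F k j))"
    proof (rule power_series_eqI[of _ A])
      show "F i j \<in> power_series A" by (rule F)
      show "const (of_bool (i = j)) + (\<Sum>k<n. \<Sum>a\<in>A. const (?Q a i k) * (letter a * F k j)) \<in> power_series A"
        by (intro power_series_add power_series_sum power_series_mult const_power_series letter_power_series F)
      fix \<alpha> assume \<alpha>: "set \<alpha> \<subseteq> A"
      show "coeff (F i j) (pos_word \<alpha>) =
          coeff (const (of_bool (i = j)) + (\<Sum>k<n. \<Sum>a\<in>A. const (?Q a i k) * (letter a * F k j))) (pos_word \<alpha>)"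
      proof (cases \<alpha>)
        case Nil
        then show ?thesis
          by (simp add: F coeff_letter_mult_pos_word[OF F(1)]) (simp add: pos_word_def const.rep_eq coeff_one)
      next
        case (Cons b \<beta>)
        then have b: "b \<in> A" "set \<beta> \<subseteq> A" using \<alpha> by auto
        have "(\<Sum>a\<in>A. ?Q a i k * (if b = a then coeff (F k j) (pos_word \<beta>) else 0)) =
            ?Q b i k * coeff (F k j) (pos_word \<beta>)" for k
          using b fin by (simp add: if_distrib cong: if_cong)
        then show ?thesis
          unfolding Cons using b
          by (simp add: F coeff_letter_mult_pos_word[OF F(1)]) (simp add: pos_word_def const.rep_eq coeff_one)
      qed
    qed
    ultimately show ?thesis by simp
  qed
  then have "(1\<^sub>m n - Q) * M = 1\<^sub>m n"
    unfolding right_inverse_entries[OF Q(1) M(1)] by (simp add: M_def)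
  moreover from left_inverse_of_right_inverse[OF fin Q M this]
  have "M * (1\<^sub>m n - Q) = 1\<^sub>m n" .
  ultimately have "inverse_mat_over (power_series A) (1\<^sub>m n - Q) M"
    using M Q by (simp add: inverse_mat_over_def inverts_mat_def)
  then show ?thesis by blast
qed

section \<open>The reciprocal of the language\<close>

lemma letter_letter_inv [simp]: "letter a * letter_inv a = 1" "letter_inv a * letter a = 1"
proof -
  have e: "coeff (letter_inv a) (push (a, False) w) = coeff 1 w"
    "coeff (letter a) (push (a, True) w) = coeff 1 w" if "reduced w" for w
    using that by (cases w; auto simp: letter_inv.rep_eq letter.rep_eq coeff_one inv_letter_def reduced_Cons)+
  show "letter a * letter_inv a = 1" "letter_inv a * letter a = 1"
    by (rule laurent_eqI; simp add: coeff_letter_mult coeff_letter_inv_mult e)+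
qed

lemma letter_laurent_series:
  assumes "a \<in> A"
  shows "letter a \<in> laurent_series A" "letter_inv a \<in> laurent_series A"
  using assms by (auto simp: laurent_series_def free_group_def letter.rep_eq letter_inv.rep_eq
    reduced_def split: if_splits)

lemma const_mult_assoc: "const r * (const s * f) = const (r * s) * f"
  by (simp add: const_mult mult.assoc)

lemma const_left_commute: "f * (const r * g) = const r * (f * g)"
  by (metis const_commute mult.assoc)

section \<open>The automaton of the language and its barred form\<close>

context flag_sphere
begin

abbreviation "alphabet \<equiv> N - {{}}"

definition language :: "'a set list set" where
  "language = {\<sigma>s. set \<sigma>s \<subseteq> alphabet \<and> successively (independent_over N) \<sigma>s}"

text \<open>The diagonal matrix \<Lambda>; its entry 1 at the empty simplex makes room for the
  constant terms of the system.\<close>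

definition Lam :: "'a set \<Rightarrow> 'a set laurent" where
  "Lam \<sigma> = (if \<sigma> = {} then 1 else letter \<sigma>)"

definition Lam_inv :: "'a set \<Rightarrow> 'a set laurent" where
  "Lam_inv \<sigma> = (if \<sigma> = {} then 1 else letter_inv \<sigma>)"

lemma Lam_Lam_inv [simp]: "Lam \<sigma> * Lam_inv \<sigma> = 1" "Lam_inv \<sigma> * Lam \<sigma> = 1"
  by (simp_all add: Lam_def Lam_inv_def)

lemma Lam_series: "\<sigma> \<in> N \<Longrightarrow> Lam \<sigma> \<in> laurent_series alphabet"
  "\<sigma> \<in> N \<Longrightarrow> Lam_inv \<sigma> \<in> laurent_series alphabet"
  using const_laurent_series[of 1 alphabet]
  by (auto simp: Lam_def Lam_inv_def intro: letter_laurent_series)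

text \<open>The system y = 1 + P \<Lambda> y is y = J \<Lambda> y: the column of ones of J at the
  empty simplex supplies the 1, and the row of J there is a unit vector.\<close>

lemma sum_J_split:
  fixes y :: "'a set \<Rightarrow> 'a set laurent"
  assumes "\<sigma> \<in> N" "y {} = 1"
  shows "(\<Sum>\<tau>\<in>N. const (J \<sigma> \<tau>) * (Lam \<tau> * y \<tau>)) = 1 + (\<Sum>\<tau>\<in>N. const (P \<sigma> \<tau>) * (Lam \<tau> * y \<tau>))"
proof (cases "\<sigma> = {}")
  case True
  have "(\<Sum>\<tau>\<in>alphabet. const (J {} \<tau>) * (Lam \<tau> * y \<tau>)) = 0"
    by (intro sum.neutral ballI) (simp add: J_empty_left)
  then show ?thesis using True assms(2) by (simp add: sum_split_empty P_def Lam_def)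
next
  case False
  have "(\<Sum>\<tau>\<in>alphabet. const (J \<sigma> \<tau>) * (Lam \<tau> * y \<tau>)) =
      (\<Sum>\<tau>\<in>alphabet. const (P \<sigma> \<tau>) * (Lam \<tau> * y \<tau>))"
    by (rule sum.cong) (use False in \<open>auto simp: P_def\<close>)
  moreover have "const (P \<sigma> {}) = 0" by (simp add: P_def)
  ultimately show ?thesis using assms(2) by (simp add: sum_split_empty Lam_def)
qed

text \<open>Thus y(\<sigma>) collects the words that may follow the letter \<sigma>; each step of
  the recursion checks one consecutive pair.\<close>

lemma coeff_state_series:
  assumes y: "\<And>\<sigma>. \<sigma> \<in> N \<Longrightarrow> y \<sigma> \<in> power_series alphabet"
    "\<And>\<sigma>. \<sigma> \<in> N \<Longrightarrow> y \<sigma> = 1 + (\<Sum>\<tau>\<in>N. const (P \<sigma> \<tau>) * (Lam \<tau> * y \<tau>))"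
    and "set \<alpha> \<subseteq> alphabet" "\<sigma> \<in> alphabet"
  shows "coeff (y \<sigma>) (pos_word \<alpha>) = of_bool (successively (independent_over N) (\<sigma> # \<alpha>))"
  using assms(3,4)
proof (induction \<alpha> arbitrary: \<sigma>)
  case Nil
  have "y \<sigma> = 1 + (\<Sum>\<tau>\<in>alphabet. const (P \<sigma> \<tau>) * (letter \<tau> * y \<tau>))"
    using y(2)[of \<sigma>] Nil by (simp add: sum_split_empty P_def Lam_def)
  then show ?case
    by (simp add: coeff_letter_mult_pos_word[OF y(1)]) (simp add: pos_word_def coeff_one)
next
  case (Cons \<rho> \<alpha>)
  have "y \<sigma> = 1 + (\<Sum>\<tau>\<in>alphabet. const (P \<sigma> \<tau>) * (letter \<tau> * y \<tau>))"
    using y(2)[of \<sigma>] Cons.prems by (simp add: sum_split_empty P_def Lam_def)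
  then have "coeff (y \<sigma>) (pos_word (\<rho> # \<alpha>)) =
      (\<Sum>\<tau>\<in>alphabet. P \<sigma> \<tau> * coeff (letter \<tau> * y \<tau>) (pos_word (\<rho> # \<alpha>)))"
    by simp (simp add: pos_word_def coeff_one)
  also have "\<dots> = (\<Sum>\<tau>\<in>alphabet. if \<rho> = \<tau> then P \<sigma> \<rho> * coeff (y \<rho>) (pos_word \<alpha>) else 0)"
    by (rule sum.cong[OF refl]) (simp add: coeff_letter_mult_pos_word[OF y(1)])
  also have "\<dots> = P \<sigma> \<rho> * coeff (y \<rho>) (pos_word \<alpha>)" using Cons.prems by simp
  also have "\<dots> = J \<sigma> \<rho> * of_bool (successively (independent_over N) (\<rho> # \<alpha>))"
    using Cons by (simp add: P_def)
  finally show ?case by (simp add: J_def)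
qed

text \<open>A nonempty word of the language is a first letter with an admissible continuation; the
  empty simplex contributes the empty word.\<close>

lemma char_series_language:
  assumes y: "\<And>\<sigma>. \<sigma> \<in> N \<Longrightarrow> y \<sigma> \<in> power_series alphabet"
    "\<And>\<sigma>. \<sigma> \<in> N \<Longrightarrow> y \<sigma> = 1 + (\<Sum>\<tau>\<in>N. const (P \<sigma> \<tau>) * (Lam \<tau> * y \<tau>))"
  shows "char_series language = (\<Sum>\<sigma>\<in>N. Lam \<sigma> * y \<sigma>)"
proof (rule power_series_eqI[of _ alphabet])
  have L: "language \<subseteq> lists alphabet" by (auto simp: language_def)
  have co: "coeff (char_series language) (pos_word \<alpha>) = of_bool (\<alpha> \<in> language)" for \<alpha>
  proof -
    have "inj (pos_word :: 'a set list \<Rightarrow> _)" unfolding pos_word_def by (intro inj_mapI) (simp add: inj_def)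
    then show ?thesis by (simp add: coeff_char_series[OF _ L] inj_image_mem_iff)
  qed
  show "char_series language \<in> power_series alphabet"
    using L by (force simp: power_series_def coeff_char_series[OF _ L] pos_word_def split: if_splits)
  show "(\<Sum>\<sigma>\<in>N. Lam \<sigma> * y \<sigma>) \<in> power_series alphabet"
    using y(1) const_power_series[of 1 alphabet]
    by (intro power_series_sum power_series_mult) (auto simp: Lam_def letter_power_series)
  have y0: "y {} = 1" using y(2)[of "{}"] by (simp add: P_def)
  fix \<alpha> assume \<alpha>: "set \<alpha> \<subseteq> alphabet"
  have "coeff (\<Sum>\<sigma>\<in>N. Lam \<sigma> * y \<sigma>) (pos_word \<alpha>) =
      coeff 1 (pos_word \<alpha>) + (\<Sum>\<sigma>\<in>alphabet. coeff (letter \<sigma> * y \<sigma>) (pos_word \<alpha>))"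
    using y0 by (simp add: sum_split_empty Lam_def)
  also have "\<dots> = of_bool (\<alpha> \<in> language)"
  proof (cases \<alpha>)
    case Nil
    have "(\<Sum>\<sigma>\<in>alphabet. coeff (letter \<sigma> * y \<sigma>) (pos_word \<alpha>)) = 0"
      by (intro sum.neutral ballI) (simp add: Nil coeff_letter_mult_pos_word[OF y(1)])
    then show ?thesis using Nil by (simp add: language_def pos_word_def coeff_one)
  next
    case (Cons \<rho> \<beta>)
    have "(\<Sum>\<sigma>\<in>alphabet. coeff (letter \<sigma> * y \<sigma>) (pos_word \<alpha>)) =
        (\<Sum>\<sigma>\<in>alphabet. if \<rho> = \<sigma> then coeff (y \<rho>) (pos_word \<beta>) else 0)"
      by (rule sum.cong[OF refl]) (simp add: Cons coeff_letter_mult_pos_word[OF y(1)])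
    also have "\<dots> = coeff (y \<rho>) (pos_word \<beta>)" using \<alpha> Cons by simp
    also have "\<dots> = of_bool (\<alpha> \<in> language)"
      using coeff_state_series[OF y, of \<beta> \<rho>] \<alpha> Cons by (simp add: language_def)
    finally show ?thesis using Cons by (simp add: pos_word_def coeff_one)
  qed
  finally show "coeff (char_series language) (pos_word \<alpha>) =
      coeff (\<Sum>\<sigma>\<in>N. Lam \<sigma> * y \<sigma>) (pos_word \<alpha>)" by (simp only: co)
qed

text \<open>Insert y = J \<Lambda> y and add up the columns of J with signs. This expresses the
  characteristic series by the states without any letter in the coefficients.\<close>

lemma signed_sum:
  fixes y :: "'a set \<Rightarrow> 'a set laurent"
  assumes "\<And>\<sigma>. \<sigma> \<in> N \<Longrightarrow> y \<sigma> = 1 + (\<Sum>\<tau>\<in>N. const (P \<sigma> \<tau>) * (Lam \<tau> * y \<tau>))"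
  shows "(\<Sum>\<sigma>\<in>N. const (sg \<sigma>) * y \<sigma>) = const eps * (\<Sum>\<sigma>\<in>N. Lam \<sigma> * y \<sigma>)"
proof -
  have y0: "y {} = 1" using assms[of "{}"] by (simp add: P_def)
  have "(\<Sum>\<sigma>\<in>N. const (sg \<sigma>) * y \<sigma>) =
      (\<Sum>\<sigma>\<in>N. \<Sum>\<tau>\<in>N. const (sg \<sigma> * J \<sigma> \<tau>) * (Lam \<tau> * y \<tau>))"
  proof (rule sum.cong[OF refl])
    fix \<sigma> assume "\<sigma> \<in> N"
    then have "y \<sigma> = (\<Sum>\<tau>\<in>N. const (J \<sigma> \<tau>) * (Lam \<tau> * y \<tau>))"
      using assms[of \<sigma>] sum_J_split[of \<sigma> y] y0 by simp
    then have "const (sg \<sigma>) * y \<sigma> = const (sg \<sigma>) * (\<Sum>\<tau>\<in>N. const (J \<sigma> \<tau>) * (Lam \<tau> * y \<tau>))" by simp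
    then show "const (sg \<sigma>) * y \<sigma> = (\<Sum>\<tau>\<in>N. const (sg \<sigma> * J \<sigma> \<tau>) * (Lam \<tau> * y \<tau>))"
      by (simp only: sum_distrib_left const_mult_assoc)
  qed
  also have "\<dots> = (\<Sum>\<tau>\<in>N. const (\<Sum>\<sigma>\<in>N. sg \<sigma> * J \<sigma> \<tau>) * (Lam \<tau> * y \<tau>))"
    by (subst sum.swap) (simp only: const_sum sum_distrib_right)
  also have "\<dots> = (\<Sum>\<tau>\<in>N. const eps * (Lam \<tau> * y \<tau>))"
    by (rule sum.cong) (simp_all add: J_column_sum)
  finally show ?thesis by (simp add: sum_distrib_left)
qed

text \<open>With \<open>Q = P \<Lambda>\<close> one has \<open>1 - bar Q = \<Gamma> (1 - Q) T\<close>, where \<open>\<Gamma>\<close> is a rational involution and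
  \<open>T\<close> is diagonal, so the two inverses determine each other.\<close>

lemma is_reciprocal_language:
  "is_reciprocal alphabet (char_series language) (const eps * char_series language)"
proof -
  define n where "n = card N"
  obtain e where e: "bij_betw e {..<n} N"
    using ex_bij_betw_nat_finite[OF finite_N] by (auto simp: n_def lessThan_atLeast0)
  have eN: "e i \<in> N" if "i < n" for i using e that by (auto simp: bij_betw_def)
  have einj: "e i = e j \<longleftrightarrow> i = j" if "i < n" "j < n" for i j
    using e that by (auto simp: bij_betw_def inj_on_def)
  have es: "(\<Sum>i<n. h (e i)) = (\<Sum>\<sigma>\<in>N. h \<sigma>)" for h :: "'a set \<Rightarrow> 'c :: comm_monoid_add"
    using sum.reindex_bij_betw[OF e, of h] by simp
  define Q where "Q = mat n n (\<lambda>(i, j). const (P (e i) (e j)) * Lam (e j))"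
  \<comment> \<open>By \<open>signed_sum\<close> these weights produce \<open>eps\<close> times
    \<open>eps\<close> times the characteristic series, and \<open>eps\<close> squares to 1.\<close>
  define U where "U = mat 1 n (\<lambda>(_, j). eps * sg (e j))"
  define V where "V = mat n 1 (\<lambda>_. 1 :: rat)"
  have carr: "Q \<in> carrier_mat n n" "U \<in> carrier_mat 1 n" "V \<in> carrier_mat n 1"
    by (simp_all add: Q_def U_def V_def)
  have Qe: "Q $$ (i, j) = const (P (e i) (e j)) * Lam (e j)" if "i < n" "j < n" for i j
    using that by (simp add: Q_def)
  have lin: "const (P \<sigma> \<tau>) * Lam \<tau> = (\<Sum>a\<in>alphabet. const (if a = \<tau> then P \<sigma> \<tau> else 0) * letter a)"
    if "\<tau> \<in> N" for \<sigma> \<tau>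
  proof (cases "\<tau> = {}")
    case False
    have "(\<Sum>a\<in>alphabet. const (if a = \<tau> then P \<sigma> \<tau> else 0) * letter a) =
        (\<Sum>a\<in>alphabet. if a = \<tau> then const (P \<sigma> \<tau>) * letter \<tau> else 0)"
      by (rule sum.cong) auto
    then show ?thesis using False that by (simp add: Lam_def)
  qed (simp add: P_def)
  have Qlin: "elements_mat Q \<subseteq> linear_forms alphabet"
  proof
    fix q assume "q \<in> elements_mat Q"
    then obtain i j where ij: "i < n" "j < n" "q = Q $$ (i, j)" using carr by auto
    then have "q = (\<Sum>a\<in>alphabet. const (if a = e j then P (e i) (e j) else 0) * letter a)"
      using lin eN Qe by simp
    then show "q \<in> linear_forms alphabet"
      unfolding linear_forms_def by (intro CollectI exI[of _ "\<lambda>a. if a = e j then P (e i) (e j) else 0"]) simp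
  qed
  have barQ: "bar alphabet (Q $$ (i, j)) = const (P (e i) (e j)) * Lam_inv (e j)" if ij: "i < n" "j < n" for i j
  proof (cases "e j = {}")
    case True
    then show ?thesis using Qe[OF ij] by (simp add: bar_def P_def)
  next
    case False
    have "coeff (Q $$ (i, j)) [(a, True)] = (if a = e j then P (e i) (e j) else 0)" for a
      using Qe[OF ij] False by (simp add: Lam_def letter.rep_eq)
    then have "bar alphabet (Q $$ (i, j)) =
        (\<Sum>a\<in>alphabet. if a = e j then const (P (e i) (e j)) * letter_inv a else 0)"
      unfolding bar_def by (intro sum.cong) auto
    then show ?thesis using False eN[OF ij(2)] by (simp add: Lam_inv_def)
  qed
  obtain M where M: "inverse_mat_over (power_series alphabet) (1\<^sub>m n - Q) M"
    using neumann_inverse[OF _ carr(1) Qlin] by auto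
  have Mc: "M \<in> carrier_mat n n" "(1\<^sub>m n - Q) * M = 1\<^sub>m n" "M * (1\<^sub>m n - Q) = 1\<^sub>m n"
    using M carr by (auto simp: inverse_mat_over_def inverts_mat_def)
  have Mp: "M $$ (i, j) \<in> power_series alphabet" if "i < n" "j < n" for i j
    using inverse_mat_over_closed[OF carr(1) M that] .
  \<comment> \<open>The unknowns, indexed again by simplices instead of by their numbers under
    \<open>e\<close>.\<close>
  define y where "y \<sigma> = column_sum M V (inv_into {..<n} e \<sigma>)" for \<sigma>
  have ye: "y (e i) = column_sum M V i" if "i < n" for i
    using that e by (simp add: y_def bij_betw_def)
  have ysum: "column_sum M V i = (\<Sum>j<n. M $$ (i, j))" for i
    by (simp add: column_sum_def V_def)
  have Ne: "\<exists>i<n. \<sigma> = e i" if "\<sigma> \<in> N" for \<sigma> using e that by (auto simp: bij_betw_def)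
  have y1: "y \<sigma> \<in> power_series alphabet" if "\<sigma> \<in> N" for \<sigma>
    using Ne[OF that] Mp by (auto simp: ye ysum intro!: power_series_sum)
  have y2: "y \<sigma> = 1 + (\<Sum>\<tau>\<in>N. const (P \<sigma> \<tau>) * (Lam \<tau> * y \<tau>))" if \<sigma>: "\<sigma> \<in> N" for \<sigma>
  proof -
    obtain i where i: "i < n" "\<sigma> = e i" using Ne[OF \<sigma>] by blast
    have "y \<sigma> = 1 + (\<Sum>j<n. Q $$ (i, j) * y (e j))"
      using column_sum_eq[OF carr(1,3) M i(1)] i by (simp add: ye V_def)
    also have "(\<Sum>j<n. Q $$ (i, j) * y (e j)) = (\<Sum>j<n. const (P \<sigma> (e j)) * (Lam (e j) * y (e j)))"
      using i by (intro sum.cong refl) (simp add: Qe mult.assoc)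
    also have "\<dots> = (\<Sum>\<tau>\<in>N. const (P \<sigma> \<tau>) * (Lam \<tau> * y \<tau>))"
      by (rule es[of "\<lambda>\<tau>. const (P \<sigma> \<tau>) * (Lam \<tau> * y \<tau>)"])
    finally show ?thesis .
  qed
  have chi: "char_series language = (\<Sum>\<sigma>\<in>N. Lam \<sigma> * y \<sigma>)"
    by (rule char_series_language[OF y1 y2])
  have "sandwich U M V = (\<Sum>k<n. const eps * (const (sg (e k)) * y (e k)))"
    unfolding sandwich_eq[OF carr(2) Mc(1) carr(3)]
    by (intro sum.cong refl) (simp add: U_def ye const_mult mult.assoc)
  also have "\<dots> = const eps * (\<Sum>\<sigma>\<in>N. const (sg \<sigma>) * y \<sigma>)"
    by (simp only: es[of "\<lambda>\<sigma>. const eps * (const (sg \<sigma>) * y \<sigma>)"] sum_distrib_left)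
  also have "\<dots> = char_series language"
    by (simp only: signed_sum[OF y2] chi const_mult_assoc eps_eps const_1 mult_1)
  finally have UMV: "char_series language = sandwich U M V" ..
  have rep: "representation alphabet (char_series language) n U Q V"
    unfolding representation_def using carr Qlin M UMV by blast
  let ?I = "1\<^sub>m n :: 'a set laurent mat"
  \<comment> \<open>In the factorization T = \<Delta> \<Lambda>^-1, and T' = \<Delta> \<Lambda> is
    its inverse because the signs are constants of square 1.\<close>
  define Ga :: "'a set laurent mat" where "Ga = mat n n (\<lambda>(i, j). const (Gam (e i) (e j)))"
  define T where "T = mat n n (\<lambda>(i, j). if i = j then const (sg (e j)) * Lam_inv (e j) else 0)"
  define T' where "T' = mat n n (\<lambda>(i, j). if i = j then const (sg (e j)) * Lam (e j) else 0)"
  have mc [simp]: "Ga \<in> carrier_mat n n" "T \<in> carrier_mat n n" "T' \<in> carrier_mat n n"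
    by (simp_all add: Ga_def T_def T'_def)
  have [simp]: "dim_row Ga = n" "dim_col Ga = n" "dim_row T = n" "dim_col T = n"
    "dim_row T' = n" "dim_col T' = n"
    by (simp_all add: Ga_def T_def T'_def)
  have [simp]: "M \<in> carrier_mat n n" "?I - Q \<in> carrier_mat n n" using Mc carr by auto
  note [simp] = mult_carrier_mat[of _ n n _ n] left_mult_one_mat[of _ n n] right_mult_one_mat[of _ n n]
  have Tr: "(X * T) $$ (i, j) = X $$ (i, j) * (const (sg (e j)) * Lam_inv (e j))"
    if "X \<in> carrier_mat n n" "i < n" "j < n" for X i j
  proof -
    have "(X * T) $$ (i, j) = (\<Sum>k<n. X $$ (i, k) * T $$ (k, j))"
      using that by (intro index_mult_mat_sum[of _ n _ _ n]) auto
    also have "\<dots> = (\<Sum>k<n. if k = j then X $$ (i, j) * (const (sg (e j)) * Lam_inv (e j)) else 0)"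
      using that by (intro sum.cong refl) (auto simp: T_def)
    finally show ?thesis using that by simp
  qed
  have T'l: "(T' * X) $$ (i, j) = const (sg (e i)) * Lam (e i) * X $$ (i, j)"
    if "X \<in> carrier_mat n n" "i < n" "j < n" for X i j
  proof -
    have "(T' * X) $$ (i, j) = (\<Sum>k<n. T' $$ (i, k) * X $$ (k, j))"
      using that by (intro index_mult_mat_sum[of _ n _ _ n]) auto
    also have "\<dots> = (\<Sum>k<n. if k = i then const (sg (e i)) * Lam (e i) * X $$ (i, j) else 0)"
      using that by (intro sum.cong refl) (auto simp: T'_def)
    finally show ?thesis using that by simp
  qed
  have diag: "const (sg \<sigma>) * f * (const (sg \<sigma>) * g) = f * g" for \<sigma> f g
    by (simp add: mult.assoc const_left_commute[of f] const_mult_assoc)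
  have TT: "T' * T = ?I" "T * T' = ?I"
  proof -
    have "(T' * T) $$ (i, j) = (if i = j then 1 else 0)" if "i < n" "j < n" for i j
      unfolding Tr[OF mc(3) that] using that by (simp add: T'_def diag)
    then show "T' * T = ?I" by (intro eq_matI) auto
    have "(T * T') $$ (i, j) = (if i = j then 1 else 0)" if ij: "i < n" "j < n" for i j
    proof -
      have "(T * T') $$ (i, j) = (\<Sum>k<n. T $$ (i, k) * T' $$ (k, j))"
        using ij by (intro index_mult_mat_sum[of _ n _ _ n]) auto
      also have "\<dots> = (\<Sum>k<n. if k = i then (if i = j then 1 else 0) else 0)"
        using ij by (intro sum.cong refl) (auto simp: T_def T'_def diag)
      finally show ?thesis using ij by simp
    qed
    then show "T * T' = ?I" by (intro eq_matI) auto
  qed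
  have GG: "Ga * Ga = ?I"
  proof (rule eq_matI)
    fix i j assume "i < dim_row ?I" "j < dim_col ?I"
    then have ij: "i < n" "j < n" by auto
    have "(Ga * Ga) $$ (i, j) = (\<Sum>k<n. Ga $$ (i, k) * Ga $$ (k, j))"
      using ij by (intro index_mult_mat_sum[of _ n _ _ n]) auto
    also have "\<dots> = (\<Sum>k<n. const (Gam (e i) (e k) * Gam (e k) (e j)))"
      using ij by (intro sum.cong refl) (simp add: Ga_def const_mult)
    also have "\<dots> = const (\<Sum>\<rho>\<in>N. Gam (e i) \<rho> * Gam \<rho> (e j))"
      unfolding const_sum by (rule es)
    finally show "(Ga * Ga) $$ (i, j) = ?I $$ (i, j)"
      using ij by (simp add: Gam_involution eN einj)
  qed (auto simp: Ga_def)
  have fact: "?I - map_mat (bar alphabet) Q = Ga * (?I - Q) * T"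
  proof (rule eq_matI)
    fix i j assume "i < dim_row (Ga * (?I - Q) * T)" "j < dim_col (Ga * (?I - Q) * T)"
    then have ij: "i < n" "j < n" by (auto simp: Ga_def T_def)
    let ?P = "P (e i) (e j)" and ?s = "sg (e j)" and ?z = "of_bool (e i = {} \<and> e j = {}) :: rat"
    have "(Ga * (?I - Q)) $$ (i, j) = (\<Sum>k<n. Ga $$ (i, k) * (?I - Q) $$ (k, j))"
      using ij by (intro index_mult_mat_sum[of _ n _ _ n]) auto
    also have "\<dots> = (\<Sum>k<n. (if k = j then const (Gam (e i) (e j)) else 0)
        - const (Gam (e i) (e k) * P (e k) (e j)) * Lam (e j))"
      using ij carr by (intro sum.cong refl) (auto simp: Ga_def Qe const_mult right_diff_distrib mult.assoc)
    also have "\<dots> = const (Gam (e i) (e j)) - (\<Sum>k<n. const (Gam (e i) (e k) * P (e k) (e j))) * Lam (e j)"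
      using ij by (simp add: sum_subtractf sum_distrib_right)
    also have "(\<Sum>k<n. const (Gam (e i) (e k) * P (e k) (e j))) = const (\<Sum>\<rho>\<in>N. Gam (e i) \<rho> * P \<rho> (e j))"
      unfolding const_sum by (rule es)
    finally have "(Ga * (?I - Q) * T) $$ (i, j) =
        (const (Gam (e i) (e j)) - const (\<Sum>\<rho>\<in>N. Gam (e i) \<rho> * P \<rho> (e j)) * Lam (e j)) * (const ?s * Lam_inv (e j))"
      using ij by (subst Tr) auto
    \<comment> \<open>The letter at \<open>e j\<close> cancels against its inverse, so the second
      term becomes a constant to which \<open>Gam_P\<close> applies.\<close>
    also have "\<dots> = const (Gam (e i) (e j) * ?s) * Lam_inv (e j)
        - const ((\<Sum>\<rho>\<in>N. Gam (e i) \<rho> * P \<rho> (e j)) * ?s)"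
      by (simp only: left_diff_distrib mult.assoc const_left_commute[of "Lam (e j)"] Lam_Lam_inv const_mult mult_1_right)
    also have "(\<Sum>\<rho>\<in>N. Gam (e i) \<rho> * P \<rho> (e j)) * ?s = ?z - of_bool (i = j)"
      using Gam_P[OF eN[OF ij(1)] eN[OF ij(2)]] einj[OF ij] by simp
    also have "Gam (e i) (e j) * ?s = ?z - ?P"
      by (simp add: Gam_def mult.assoc)
    \<comment> \<open>Where \<open>?z\<close> is nonzero, \<open>e j\<close> is empty and its
      inverse letter is 1, so the two occurrences of \<open>?z\<close> cancel.\<close>
    also have "const (?z - ?P) * Lam_inv (e j) - const (?z - of_bool (i = j)) =
        (if i = j then 1 else 0) - const ?P * Lam_inv (e j)"
      by (auto simp: const_diff left_diff_distrib Lam_inv_def)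
    finally show "(?I - map_mat (bar alphabet) Q) $$ (i, j) = (Ga * (?I - Q) * T) $$ (i, j)"
      using ij carr by (simp add: barQ)
  qed (use carr in \<open>auto simp: Ga_def T_def\<close>)
  \<comment> \<open>The inverse of \<Gamma> (1 - Q) T in reversed order; \<Gamma> is its own
    inverse.\<close>
  define M' where "M' = T' * (M * Ga)"
  have M'c: "M' \<in> carrier_mat n n" by (simp add: M'_def)
  have "(Ga * (?I - Q) * T) * M' = Ga * ((?I - Q) * ((T * T') * (M * Ga)))"
    unfolding M'_def by (simp add: assoc_mult_mat[of _ n n _ n _ n])
  also have "\<dots> = Ga * (((?I - Q) * M) * Ga)"
    unfolding TT by (simp add: assoc_mult_mat[of _ n n _ n _ n])
  also have "\<dots> = ?I" unfolding Mc(2) by (simp add: GG)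
  finally have inv1: "(Ga * (?I - Q) * T) * M' = ?I" .
  have "M' * (Ga * (?I - Q) * T) = T' * (M * ((Ga * Ga) * ((?I - Q) * T)))"
    unfolding M'_def by (simp add: assoc_mult_mat[of _ n n _ n _ n])
  also have "\<dots> = T' * ((M * (?I - Q)) * T)"
    unfolding GG by (simp add: assoc_mult_mat[of _ n n _ n _ n])
  also have "\<dots> = ?I" unfolding Mc(3) by (simp add: TT)
  finally have inv2: "M' * (Ga * (?I - Q) * T) = ?I" .
  have MGa: "(M * Ga) $$ (i, j) = (\<Sum>k<n. M $$ (i, k) * const (Gam (e k) (e j)))" if "i < n" "j < n" for i j
  proof -
    have "(M * Ga) $$ (i, j) = (\<Sum>k<n. M $$ (i, k) * Ga $$ (k, j))"
      using that by (intro index_mult_mat_sum[of _ n _ _ n]) auto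
    then show ?thesis using that by (simp add: Ga_def)
  qed
  have M'e: "M' $$ (i, j) = const (sg (e i)) * Lam (e i) * (\<Sum>k<n. M $$ (i, k) * const (Gam (e k) (e j)))"
    if "i < n" "j < n" for i j
    unfolding M'_def using that by (subst T'l) (auto simp: MGa)
  have "elements_mat M' \<subseteq> laurent_series alphabet"
  proof
    fix f assume "f \<in> elements_mat M'"
    then obtain i j where ij: "i < n" "j < n" "f = M' $$ (i, j)" using M'c by auto
    have "M $$ (i, k) \<in> laurent_series alphabet" if "k < n" for k
      using Mp[OF ij(1) that] power_series_subset by blast
    then show "f \<in> laurent_series alphabet"
      unfolding ij(3) M'e[OF ij(1,2)] using eN[OF ij(1)]
      by (intro laurent_series_mult laurent_series_sum const_laurent_series Lam_series) auto
  qed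
  then have inv: "inverse_mat_over (laurent_series alphabet) (1\<^sub>m n - map_mat (bar alphabet) Q) M'"
    unfolding inverse_mat_over_def inverts_mat_def using M'c inv1 inv2 carr fact by auto
  \<comment> \<open>\<Gamma> fixes the vector of ones, so M' V = T' (M \<Gamma> V) = T' y: the
    vector z = \<Delta> \<Lambda> y that solves the barred system.\<close>
  have col: "column_sum M' V k = const (sg (e k)) * (Lam (e k) * y (e k))" if k: "k < n" for k
  proof -
    have "column_sum M' V k = (\<Sum>j<n. M' $$ (k, j))" by (simp add: column_sum_def V_def)
    also have "\<dots> = (\<Sum>j<n. const (sg (e k)) * Lam (e k) * (\<Sum>l<n. M $$ (k, l) * const (Gam (e l) (e j))))"
      using k by (intro sum.cong refl) (simp add: M'e)
    also have "\<dots> = const (sg (e k)) * Lam (e k) * (\<Sum>l<n. M $$ (k, l) * (\<Sum>j<n. const (Gam (e l) (e j))))"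
      unfolding sum_distrib_left[symmetric] by (subst sum.swap) (simp only: sum_distrib_left)
    also have "(\<Sum>l<n. M $$ (k, l) * (\<Sum>j<n. const (Gam (e l) (e j)))) = (\<Sum>l<n. M $$ (k, l))"
    proof (rule sum.cong[OF refl])
      fix l assume "l \<in> {..<n}"
      have "(\<Sum>j<n. const (Gam (e l) (e j)) :: 'a set laurent) = const (\<Sum>\<tau>\<in>N. Gam (e l) \<tau>)"
        unfolding const_sum by (rule es)
      then show "M $$ (k, l) * (\<Sum>j<n. const (Gam (e l) (e j))) = M $$ (k, l)"
        using Gam_row_sum[OF eN] \<open>l \<in> {..<n}\<close> by simp
    qed
    finally show ?thesis using k by (simp add: ye ysum mult.assoc)
  qed
  \<comment> \<open>The signs in \<open>U\<close> cancel those of z; what remains is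
    \<open>eps\<close> times the sum of \<Lambda> y.\<close>
  have "sandwich U M' V = (\<Sum>k<n. const eps * (Lam (e k) * y (e k)))"
    unfolding sandwich_eq[OF carr(2) M'c carr(3)]
    by (intro sum.cong refl) (simp add: U_def col const_mult_assoc mult.assoc)
  also have "\<dots> = const eps * char_series language"
    by (simp only: chi es[of "\<lambda>\<sigma>. const eps * (Lam \<sigma> * y \<sigma>)"] sum_distrib_left)
  finally show ?thesis
    unfolding is_reciprocal_def using rep inv by metis
qed

end

theorem theorem2:
  fixes G :: "('a, 'b) monoid_scheme"
    and S :: "'a set"
    and m :: "'a \<Rightarrow> 'a \<Rightarrow> enat"
    and k :: int
  assumes "finite S"
    and "coxeter_system G S m"
    and "right_angled S m"
    and "eulerian_sphere k (nerve G S)"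
  shows "reciprocal_exists (nerve_alphabet G S) (char_series (left_greedy_nf G S)) \<and>
    reciprocal (nerve_alphabet G S) (char_series (left_greedy_nf G S)) =
      const ((- 1) powi (k + 1)) * char_series (left_greedy_nf G S)"
proof -
  have "group G" using assms(2) by (simp add: coxeter_system_def presented_by_def)
  then interpret racg G S m using assms(2,3) by (simp add: racg_def racg_axioms_def)
  interpret K: flag_sphere "nerve G S" k
    by unfold_locales (use assms(4) nerve_flag[OF assms(1)] in auto)
  let ?A = "nerve_alphabet G S" and ?L = "left_greedy_nf G S"
  have L: "K.language = ?L"
    by (simp add: K.language_def left_greedy_nf_eq[OF assms(1)] nerve_alphabet_def)
  have rec: "is_reciprocal ?A (char_series ?L) (const ((- 1) powi (k + 1)) * char_series ?L)"
    using K.is_reciprocal_language unfolding L K.eps_def nerve_alphabet_def .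
  have "reciprocal ?A (char_series ?L) = const ((- 1) powi (k + 1)) * char_series ?L"
    unfolding reciprocal_def
    by (rule the_equality, rule rec)
      (erule is_reciprocal_unique[OF finite_nerve_alphabet[OF assms(1)] _ rec])
  with rec show ?thesis unfolding reciprocal_exists_def by blast
qed

end
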